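(* Let $N\in\mathbb N$ and let $\omega$ be an admissible radial measure on $\overline{\mathbb B_d}$. If $\varphi,\psi\in \mathrm{Mult}(B^N_\omega)$ with $\varphi/\psi\in H^\infty(\mathbb B_d)$, then for each $k\in\mathbb N$ we have $\varphi^{N+k-1}\in[\psi^k]\subseteq[\psi]$.
   Context: $\mathbb N=\{1,2,\dots\}$, $d\in\mathbb N$, $\mathbb B_d$ is the open unit ball of $\mathbb C^d$, $\sigma$ is the normalized rotationally invariant measure on $\partial\mathbb B_d$, $\mathrm{Hol}(\mathbb B_d)$ is the set of analytic functions on $\mathbb B_d$, and $H^\infty(\mathbb B_d)$ is the set of bounded ones. An admissible radial measure $\omega$ on $\overline{\mathbb B_d}$ is one of the form $d\omega(z)=d\mu(r)\,d\sigma(w)$, $z=rw$ (i.e. the image of $\mu\times\sigma$ under $(r,w)\mapsto rw$), where $\mu$ is a finite Borel measure on $[0,1]$ with $\mu((r,1])>0$ for all $0<r<1$. For analytic $f$ put $\|f\|^2_{L^2(\omega)}=\int_{\mathbb B_d}|f|^2d\omega+\mu(\{1\})\|f\|^2_{H^2(\partial\mathbb B_d)}$, where $\|f\|^2_{H^2(\partial\mathbb B_d)}=\sup_{0<r<1}\int_{\partial\mathbb B_d}|f(rw)|^2d\sigma(w)$ and the second term is omitted if $\mu(\{1\})=0$. Let $R=\sum_{j=1}^d z_j\frac{\partial}{\partial z_j}$. The radially weighted Besov space is $B^N_\omega=\{f\in\mathrm{Hol}(\mathbb B_d):\|R^Nf\|_{L^2(\omega)}<\infty\}$ with $\|f\|^2_{B^N_\omega}=\mu([0,1])|f(0)|^2+\|R^Nf\|^2_{L^2(\omega)}$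 for $N\ge1$. It is a Hilbert function space on $\mathbb B_d$. For a Hilbert space $\mathcal H$ of functions, $\mathrm{Mult}(\mathcal H)=\{\varphi:\varphi f\in\mathcal H\text{ for all }f\in\mathcal H\}$, and for $f\in\mathcal H$, $[f]$ denotes the closure in $\mathcal H$ of $\{\varphi f:\varphi\in\mathrm{Mult}(\mathcal H)\}$; here $\mathcal H=B^N_\omega$. The notation $\varphi/\psi\in H^\infty(\mathbb B_d)$ means that $\psi$ is not identically zero and $\varphi=h\psi$ for some $h\in H^\infty(\mathbb B_d)$. *)

theory Defs
  imports "HOL-Analysis.Analysis"
begin

text \<open>Functions on the unit ball are total functions on \<open>complex ^ 'd\<close>; all notions below depend
  only on their values on \<open>ball 0 1\<close>.\<close>

definition hol_on :: "(complex ^ 'd) set \<Rightarrow> (complex ^ 'd \<Rightarrow> complex) set" where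
  "hol_on S = {f. \<forall>z\<in>S. \<exists>D. (f has_derivative D) (at z) \<and> (\<forall>c v. D (c *s v) = c * D v)}"

definition Hinf :: "(complex ^ 'd \<Rightarrow> complex) set" where
  "Hinf = {h \<in> hol_on (ball 0 1). bounded (h ` ball 0 1)}"

text \<open>The normalized rotationally invariant measure on the unit sphere, realized on the ambient
  space as the image of normalized Lebesgue measure on the unit ball under \<open>z \<mapsto> z / \<parallel>z\<parallel>\<close>;
  see \<open>emeasure_sphere_measure_sphere\<close> and \<open>sphere_measure_orthogonal_invariant\<close>.\<close>

definition sphere_measure :: "'a::euclidean_space measure" where
  "sphere_measure = distr (uniform_measure lborel (ball 0 1)) borel sgn"

lemma lborel_distr_orthogonal:
  fixes U :: "'a::euclidean_space \<Rightarrow> 'a"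
  assumes U: "orthogonal_transformation U"
  shows "distr lborel borel U = lborel"
proof -
  have lin: "linear U" using U by (rule orthogonal_transformation_linear)
  have [measurable]: "U \<in> borel_measurable borel"
    using lin by (intro borel_measurable_continuous_onI linear_continuous_on linear_conv_bounded_linear[THEN iffD1])
  define M where "M = distr lborel borel U"
  have [measurable_cong, simp]: "sets M = sets borel" and space_M [simp]: "space M = UNIV"
    by (simp_all add: M_def)
  obtain V where V: "orthogonal_transformation V" "\<And>x. U (V x) = x"
    using U by (metis orthogonal_transformation_inv orthogonal_transformation_surj surj_f_inv_f)
  have trans: "(\<integral>\<^sup>+x. g (x + a) \<partial>M) = (\<integral>\<^sup>+x. g x \<partial>M)"
    if [measurable]: "g \<in> borel_measurable borel" for g :: "'a \<Rightarrow> ennreal" and a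
  proof -
    have "(\<integral>\<^sup>+x. g (x + a) \<partial>M) = (\<integral>\<^sup>+x. g (U x + a) \<partial>lborel)"
      unfolding M_def by (subst nn_integral_distr) auto
    also have "\<dots> = (\<integral>\<^sup>+x. g (U (V a + x)) \<partial>lborel)"
      by (intro nn_integral_cong) (simp add: linear_add[OF lin] V add.commute)
    also have "\<dots> = (\<integral>\<^sup>+x. g (U x) \<partial>(distr lborel borel ((+) (V a))))"
      by (subst nn_integral_distr) auto
    also have "\<dots> = (\<integral>\<^sup>+x. g (U x) \<partial>lborel)"
      by (simp only: lborel_distr_plus)
    also have "\<dots> = (\<integral>\<^sup>+x. g x \<partial>M)"
      unfolding M_def by (subst nn_integral_distr) auto
    finally show ?thesis .
  qed
  have transl: "(\<integral>\<^sup>+x. g (x + a) \<partial>lborel) = (\<integral>\<^sup>+x. g x \<partial>lborel)"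
    if [measurable]: "g \<in> borel_measurable borel" for g :: "'a \<Rightarrow> ennreal" and a
  proof -
    have "(\<integral>\<^sup>+x. g (x + a) \<partial>lborel) = (\<integral>\<^sup>+x. g x \<partial>(distr lborel borel ((+) a)))"
      by (subst nn_integral_distr) (auto simp: add.commute)
    then show ?thesis by (simp only: lborel_distr_plus)
  qed
  have preim: "U -` ball 0 r = ball 0 r" for r
    by (auto simp: orthogonal_transformation_norm[OF U])
  have Mball: "emeasure M (ball 0 r) = emeasure lborel (ball (0::'a) r)" for r
    unfolding M_def by (subst emeasure_distr) (auto simp: preim)
  have sf: "sigma_finite_measure M"
  proof
    let ?A = "range (\<lambda>n::nat. ball (0::'a) (real n))"
    have "\<Union> ?A = UNIV"
      using reals_Archimedean2 by (auto simp: dist_norm)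
    moreover have "\<forall>a\<in>?A. emeasure M a \<noteq> \<infinity>"
      using emeasure_lborel_ball_finite by (auto simp: Mball less_top[symmetric])
    ultimately show "\<exists>A. countable A \<and> A \<subseteq> sets M \<and> \<Union> A = space M \<and> (\<forall>a\<in>A. emeasure M a \<noteq> \<infinity>)"
      by (intro exI[of _ ?A]) auto
  qed
  interpret P: pair_sigma_finite M lborel
    using sf by (simp add: pair_sigma_finite_def sigma_finite_lborel)
  let ?B = "ball (0::'a) 1"
  have [measurable]: "?B \<in> sets borel" by simp
  have "emeasure M A = emeasure lborel A" if [measurable]: "A \<in> sets borel" for A
  proof -
    have "emeasure M A * emeasure lborel ?B
        = (\<integral>\<^sup>+x. indicator A x * emeasure lborel ?B \<partial>M)"
      by (simp add: nn_integral_multc)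
    also have "\<dots> = (\<integral>\<^sup>+x. (\<integral>\<^sup>+y. indicator A x * indicator ?B y \<partial>lborel) \<partial>M)"
      by (rule nn_integral_cong, subst nn_integral_cmult) (auto intro: borel_measurable_indicator)
    also have "\<dots> = (\<integral>\<^sup>+x. (\<integral>\<^sup>+y. indicator A x * indicator ?B (y - x) \<partial>lborel) \<partial>M)"
    proof (rule nn_integral_cong)
      fix x show "(\<integral>\<^sup>+y. indicator A x * indicator ?B y \<partial>lborel)
          = (\<integral>\<^sup>+y. indicator A x * indicator ?B (y - x) \<partial>lborel)"
        using transl[of "\<lambda>y. indicator A x * indicator ?B y" "- x"] by simp
    qed
    also have "\<dots> = (\<integral>\<^sup>+y. (\<integral>\<^sup>+x. indicator A x * indicator ?B (y - x) \<partial>M) \<partial>lborel)"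
      by (rule P.Fubini'[symmetric]) measurable
    also have "\<dots> = (\<integral>\<^sup>+y. (\<integral>\<^sup>+x. indicator A (x + y) * indicator ?B (- x) \<partial>M) \<partial>lborel)"
    proof (rule nn_integral_cong)
      fix y show "(\<integral>\<^sup>+x. indicator A x * indicator ?B (y - x) \<partial>M)
          = (\<integral>\<^sup>+x. indicator A (x + y) * indicator ?B (- x) \<partial>M)"
        using trans[of "\<lambda>x. indicator A x * indicator ?B (y - x)" y, symmetric]
        by (simp add: borel_measurable_times borel_measurable_indicator)
    qed
    also have "\<dots> = (\<integral>\<^sup>+x. (\<integral>\<^sup>+y. indicator A (x + y) * indicator ?B (- x) \<partial>lborel) \<partial>M)"
      by (rule P.Fubini') measurable
    also have "\<dots> = (\<integral>\<^sup>+x. emeasure lborel A * indicator ?B x \<partial>M)"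
    proof (rule nn_integral_cong)
      fix x
      have "(\<integral>\<^sup>+y. indicator A (x + y) * indicator ?B (- x) \<partial>lborel)
          = (\<integral>\<^sup>+y. indicator A (y + x) \<partial>lborel) * indicator ?B (- x)"
        by (subst nn_integral_multc) (auto simp: add.commute)
      also have "\<dots> = emeasure lborel A * indicator ?B (- x)"
        by (subst transl) auto
      finally show "(\<integral>\<^sup>+y. indicator A (x + y) * indicator ?B (- x) \<partial>lborel)
          = emeasure lborel A * indicator ?B x"
        by (simp add: indicator_def)
    qed
    also have "\<dots> = emeasure lborel A * emeasure lborel ?B"
      by (simp add: nn_integral_cmult Mball)
    finally have *: "emeasure M A * emeasure lborel ?B = emeasure lborel A * emeasure lborel ?B" .
    have "emeasure lborel ?B \<noteq> 0"
      using open_not_negligible[of ?B]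
      by (auto simp: negligible_iff_null_sets null_sets_def)
    moreover have "emeasure lborel ?B \<noteq> \<infinity>"
      using emeasure_lborel_ball_finite[of "0::'a" 1] by auto
    ultimately show ?thesis
      using * by (metis ennreal_mult_cancel_left mult.commute infinity_ennreal_def)
  qed
  then have "M = lborel" by (intro measure_eqI) auto
  then show ?thesis by (simp add: M_def)
qed

lemma emeasure_sphere_measure_UNIV: "emeasure (sphere_measure :: 'a::euclidean_space measure) UNIV = 1"
  and emeasure_sphere_measure_sphere: "emeasure (sphere_measure :: 'a measure) (sphere 0 1) = 1"
proof -
  let ?B = "ball (0::'a) 1"
  have B: "emeasure lborel ?B \<noteq> 0" "emeasure lborel ?B \<noteq> \<infinity>"
    using open_not_negligible[of ?B] emeasure_lborel_ball_finite[of "0::'a" 1]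
    by (auto simp: negligible_iff_null_sets null_sets_def)
  have sgn_meas: "sgn \<in> borel_measurable (borel :: 'a measure)"
    unfolding sgn_div_norm by measurable
  show "emeasure (sphere_measure :: 'a measure) UNIV = 1"
    using B sgn_meas unfolding sphere_measure_def
    by (subst emeasure_distr) (auto simp: ennreal_divide_self less_top)
  have pre: "sgn -` sphere (0::'a) 1 = UNIV - {0}"
    by (auto simp: norm_sgn)
  have "emeasure lborel (?B \<inter> (UNIV - {0})) = emeasure lborel ?B"
  proof -
    have "?B \<inter> (UNIV - {0}) = ?B - {0}" by auto
    then show ?thesis by (simp add: emeasure_Diff_null_set[of "{0}"] null_sets_def)
  qed
  then show "emeasure (sphere_measure :: 'a measure) (sphere 0 1) = 1"
    using B sgn_meas unfolding sphere_measure_def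
    by (subst emeasure_distr) (auto simp: pre ennreal_divide_self less_top)
qed

lemma sphere_measure_orthogonal_invariant:
  fixes U :: "'a::euclidean_space \<Rightarrow> 'a"
  assumes U: "orthogonal_transformation U"
  shows "distr sphere_measure borel U = sphere_measure"
proof -
  have lin: "linear U" using U by (rule orthogonal_transformation_linear)
  have [measurable]: "U \<in> borel_measurable borel"
    using lin by (intro borel_measurable_continuous_onI linear_continuous_on linear_conv_bounded_linear[THEN iffD1])
  have sgn_meas[measurable]: "sgn \<in> borel_measurable (borel :: 'a measure)"
    unfolding sgn_div_norm by measurable
  have U_sgn: "U (sgn z) = sgn (U z)" for z
    by (simp add: sgn_div_norm linear_scale[OF lin] orthogonal_transformation_norm[OF U])
  let ?L = "uniform_measure lborel (ball (0::'a) 1)"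
  have "distr ?L borel U = ?L"
  proof (rule measure_eqI)
    fix A assume "A \<in> sets (distr ?L borel U)"
    then have [measurable]: "A \<in> sets borel" by simp
    have "emeasure (distr ?L borel U) A = emeasure ?L (U -` A)"
      by (subst emeasure_distr) auto
    also have "\<dots> = emeasure lborel (U -` (ball 0 1 \<inter> A)) / emeasure lborel (ball (0::'a) 1)"
    proof -
      have [measurable]: "U -` A \<in> sets borel"
        using measurable_sets[of U borel borel A] by simp
      have "ball 0 1 \<inter> U -` A = U -` (ball 0 1 \<inter> A)"
        by (auto simp: orthogonal_transformation_norm[OF U])
      then show ?thesis by simp
    qed
    also have "emeasure lborel (U -` (ball 0 1 \<inter> A)) = emeasure (distr lborel borel U) (ball 0 1 \<inter> A)"
      by (subst emeasure_distr) auto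
    finally show "emeasure (distr ?L borel U) A = emeasure ?L A"
      by (simp add: lborel_distr_orthogonal[OF U])
  qed simp
  have "distr sphere_measure borel U = distr ?L borel (U \<circ> sgn)"
    unfolding sphere_measure_def by (rule distr_distr) auto
  also have "U \<circ> sgn = sgn \<circ> U"
    by (simp add: fun_eq_iff U_sgn)
  also have "distr ?L borel (sgn \<circ> U) = distr (distr ?L borel U) borel sgn"
    by (rule distr_distr[symmetric]) auto
  also have "distr ?L borel U = ?L" by fact
  finally show ?thesis
    by (simp only: sphere_measure_def)
qed

text \<open>The measure on \<open>[0,1]\<close> is the parameter of the theory; the associated measure on the closed
  ball is \<open>radial_measure \<mu>\<close>.\<close>

definition admissible :: "real measure \<Rightarrow> bool" where
  "admissible \<mu> \<longleftrightarrow> sets \<mu> = sets (restrict_space borel {0..1}) \<and> finite_measure \<mu> \<and>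
     (\<forall>r. 0 < r \<and> r < 1 \<longrightarrow> emeasure \<mu> {r<..1} > 0)"

definition radial_measure :: "real measure \<Rightarrow> (complex ^ 'd) measure" where
  "radial_measure \<mu> = distr (\<mu> \<Otimes>\<^sub>M sphere_measure) borel (\<lambda>(r, w). r *\<^sub>R w)"

text \<open>All norms are squared and take values in the extended nonnegative reals.\<close>

definition H2_norm2 :: "(complex ^ 'd \<Rightarrow> complex) \<Rightarrow> ennreal" where
  "H2_norm2 f = (SUP r\<in>{0<..<1}. \<integral>\<^sup>+ w. ennreal ((cmod (f (r *\<^sub>R w)))\<^sup>2) \<partial>sphere_measure)"

text \<open>As \<open>0 * \<infinity> = 0\<close> in \<^typ>\<open>ennreal\<close>, the second summand vanishes when \<open>\<mu> {1} = 0\<close>.\<close>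

definition L2_norm2 :: "real measure \<Rightarrow> (complex ^ 'd \<Rightarrow> complex) \<Rightarrow> ennreal" where
  "L2_norm2 \<mu> f = (\<integral>\<^sup>+ z \<in> ball 0 1. ennreal ((cmod (f z))\<^sup>2) \<partial>radial_measure \<mu>)
     + emeasure \<mu> {1} * H2_norm2 f"

definition partial_deriv :: "'d \<Rightarrow> (complex ^ 'd \<Rightarrow> complex) \<Rightarrow> complex ^ 'd \<Rightarrow> complex" where
  "partial_deriv j f z = deriv (\<lambda>t. f (z + axis j t)) 0"

definition radial_deriv :: "(complex ^ 'd \<Rightarrow> complex) \<Rightarrow> complex ^ 'd \<Rightarrow> complex" where
  "radial_deriv f z = (\<Sum>j\<in>UNIV. z $ j * partial_deriv j f z)"

definition Besov :: "real measure \<Rightarrow> nat \<Rightarrow> (complex ^ 'd \<Rightarrow> complex) set" where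
  "Besov \<mu> N = {f \<in> hol_on (ball 0 1). L2_norm2 \<mu> ((radial_deriv ^^ N) f) < \<infinity>}"

definition Besov_norm2 :: "real measure \<Rightarrow> nat \<Rightarrow> (complex ^ 'd \<Rightarrow> complex) \<Rightarrow> ennreal" where
  "Besov_norm2 \<mu> N f = emeasure \<mu> {0..1} * ennreal ((cmod (f 0))\<^sup>2)
     + L2_norm2 \<mu> ((radial_deriv ^^ N) f)"

definition Mult :: "(complex ^ 'd \<Rightarrow> complex) set \<Rightarrow> (complex ^ 'd \<Rightarrow> complex) set" where
  "Mult H = {\<phi>. \<forall>f\<in>H. (\<lambda>z. \<phi> z * f z) \<in> H}"

text \<open>\<open>cyclic \<mu> N f\<close> is the multiplier invariant subspace \<open>[f]\<close> generated by \<open>f \<in> Besov \<mu> N\<close>.\<close>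

definition cyclic :: "real measure \<Rightarrow> nat \<Rightarrow> (complex ^ 'd \<Rightarrow> complex) \<Rightarrow> (complex ^ 'd \<Rightarrow> complex) set" where
  "cyclic \<mu> N f = {g \<in> Besov \<mu> N. \<forall>\<epsilon>>0. \<exists>\<phi>\<in>Mult (Besov \<mu> N).
     Besov_norm2 \<mu> N (\<lambda>z. g z - \<phi> z * f z) < ennreal (\<epsilon>\<^sup>2)}"

definition quotient_in_Hinf :: "(complex ^ 'd \<Rightarrow> complex) \<Rightarrow> (complex ^ 'd \<Rightarrow> complex) \<Rightarrow> bool" where
  "quotient_in_Hinf \<phi> \<psi> \<longleftrightarrow> (\<exists>z\<in>ball 0 1. \<psi> z \<noteq> 0) \<and>
     (\<exists>h\<in>Hinf. \<forall>z\<in>ball 0 1. \<phi> z = h z * \<psi> z)"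

end

theory Submission
  imports Defs "HOL-Complex_Analysis.Conformal_Mappings"
begin

text \<open>Let \<open>h = \<phi> / \<psi>\<close>, \<open>m = N + k - 1\<close> and \<open>H = h ^ m\<close>, so that \<open>\<phi> ^ m = H * \<psi> ^ m\<close> with \<open>H\<close> bounded.
  As \<open>H\<close> need not be a multiplier, it is replaced by its dilations \<open>H\<^sub>r z = H (r z)\<close>, \<open>r < 1\<close>,
  which are. Put \<open>u = \<psi>\<^sub>r - \<psi>\<close> and expand the dilation of \<open>\<phi> ^ m\<close>,
  \<open>\<phi>\<^sub>r ^ m = H\<^sub>r * (\<psi> + u) ^ m = (\<Sum>i\<le>m. (m choose i) * H\<^sub>r * \<psi> ^ i * u ^ (m - i))\<close>. The terms
  with \<open>i \<ge> k\<close> are multiplier multiples of \<open>\<psi> ^ k\<close>; the others contain \<open>u\<close> at least \<open>N\<close> times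
  (\<open>binomial_split\<close>). So the multiples of \<open>\<psi> ^ k\<close> differ from \<open>\<phi> ^ m\<close> by \<open>\<phi> ^ m - \<phi>\<^sub>r ^ m\<close> plus
  the terms with \<open>i < k\<close>, and this error tends to \<open>0\<close> locally uniformly as \<open>r \<rightarrow> 1\<close>. It suffices
  that the error stays bounded in the norm of the space: then suitable averages of the errors tend
  to \<open>0\<close> in norm (\<open>midpoint_hull_small\<close>).

  The boundedness is the estimate \<open>L2_norm2_jet_product_bound\<close>. With \<open>r = exp (-a)\<close>, Cauchy's
  estimate only gives that the \<open>j\<close>-th radial derivative of \<open>H\<^sub>r\<close> is at most a constant times
  \<open>(1 / a) ^ j\<close>. Against this, \<open>u / a\<close> is an average of radial derivatives of \<open>\<psi>\<close>, so the \<open>N\<close>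
  factors \<open>u\<close> compensate up to \<open>N\<close> factors \<open>1 / a\<close>, and the \<open>N\<close>-th radial derivative of the
  product is bounded by products of radial derivatives of \<open>\<psi>\<close> of total order \<open>N\<close>
  (\<open>jet_product_bound\<close>). Such products are square integrable by the Gagliardo--Nirenberg
  inequality: for bounded \<open>\<psi>\<close>, the \<open>b\<close>-th derivative raised to the power \<open>N / b\<close> is controlled in
  \<open>L\<^sup>2\<close> by the \<open>N\<close>-th one. Because \<open>\<i> * radial_deriv\<close> is differentiation in the angle along the
  circles \<open>cis \<theta> *s z\<close>, the one-variable inequality for periodic functions
  (\<open>Gagliardo_Nirenberg_periodic\<close>) and averaging over the sphere are enough.

  That \<open>\<psi>\<close> is bounded is a consequence of the uniform boundedness principle and of the continuity
  of point evaluations (\<open>Mult_bounded\<close>, \<open>point_evaluation_Besov\<close>). The inclusion of the cyclic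
  subspaces holds because \<open>q * \<psi> ^ (k - 1)\<close> is a multiplier whenever \<open>q\<close> is.\<close>

\<comment> \<open>frees \<open>$\<close> for the components of vectors\<close>
unbundle no fps_syntax

section \<open>Holomorphic functions on the unit ball\<close>

lemma norm_vector_smult: "norm (c *s v) = cmod c * norm (v :: complex ^ 'd)"
  by (simp add: norm_vec_def norm_mult L2_set_right_distrib)

lemma bounded_linear_smult_right: "bounded_linear (\<lambda>c. c *s (v :: complex ^ 'd))"
  by (rule bounded_linear_intro[where K = "norm v"])
     (auto simp: norm_vector_smult vec_eq_iff algebra_simps)

lemma bounded_linear_smult_left: "bounded_linear (\<lambda>v :: complex ^ 'd. c *s v)"
  by (rule bounded_linear_intro[where K = "cmod c"])
     (auto simp: norm_vector_smult vec_eq_iff algebra_simps)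

lemma scaleR_eq_smult: "r *\<^sub>R v = complex_of_real r *s (v :: complex ^ 'd)"
  by (simp add: vec_eq_iff) (simp add: scaleR_conv_of_real)

lemma continuous_on_smult [continuous_intros]:
  "continuous_on S f \<Longrightarrow> continuous_on S g \<Longrightarrow> continuous_on S (\<lambda>x. f x *s (g x :: complex ^ 'd))"
  unfolding vector_scalar_mult_def by (intro continuous_intros)

abbreviation uball :: "(complex ^ 'd) set" where "uball \<equiv> ball 0 1"
abbreviation Hol :: "(complex ^ 'd \<Rightarrow> complex) set" where "Hol \<equiv> hol_on uball"

definition cderiv :: "(complex ^ 'd \<Rightarrow> complex) \<Rightarrow> complex ^ 'd \<Rightarrow> complex ^ 'd \<Rightarrow> complex" where
  "cderiv f z v = deriv (\<lambda>t. f (z + t *s v)) 0"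

lemma has_field_derivative_curve:
  fixes g :: "complex \<Rightarrow> complex"
  assumes D: "(f has_derivative D) (at (g t *s v + z))" "\<And>c v. D (c *s v) = c * D v"
    and g: "(g has_field_derivative g') (at t)"
  shows "((\<lambda>t. f (g t *s v + z)) has_field_derivative D v * g') (at t)"
proof -
  have "((\<lambda>t. g t *s v) has_derivative (\<lambda>h. (g' * h) *s v)) (at t)"
    using bounded_linear.has_derivative[OF bounded_linear_smult_right, of g "(*) g'" "at t" v] g
    by (simp add: has_field_derivative_def)
  then have "((\<lambda>t. g t *s v + z) has_derivative (\<lambda>h. (g' * h) *s v)) (at t)"
    by (auto intro!: derivative_eq_intros)
  from diff_chain_at[OF this D(1)]
  have "((\<lambda>t. f (g t *s v + z)) has_derivative (\<lambda>h. D v * g' * h)) (at t)"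
    by (simp add: o_def D(2) mult_ac)
  then show ?thesis by (simp add: has_field_derivative_def)
qed

lemma hol_on_has_derivative_cderiv:
  assumes "f \<in> hol_on S" "z \<in> S"
  shows "(f has_derivative cderiv f z) (at z)" "cderiv f z (c *s v) = c * cderiv f z v"
proof -
  obtain D where D: "(f has_derivative D) (at z)" "\<And>c v. D (c *s v) = c * D v"
    using assms by (auto simp: hol_on_def)
  have "cderiv f z v = D v" for v
  proof -
    have "((\<lambda>t. f (t *s v + z)) has_field_derivative D v * 1) (at 0)"
      by (rule has_field_derivative_curve) (use D in auto)
    then show ?thesis unfolding cderiv_def by (auto intro!: DERIV_imp_deriv simp: add.commute)
  qed
  then have "cderiv f z = D" by auto
  with D show "(f has_derivative cderiv f z) (at z)" "cderiv f z (c *s v) = c * cderiv f z v" by auto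
qed

lemma hol_on_imp_continuous_on: "f \<in> hol_on S \<Longrightarrow> continuous_on S f"
  unfolding hol_on_def
  by (auto intro!: continuous_at_imp_continuous_on dest!: bspec dest: has_derivative_continuous)

lemma hol_on_curve:
  fixes g :: "complex \<Rightarrow> complex"
  assumes f: "f \<in> hol_on S" and "g t *s v + z \<in> S" and g: "(g has_field_derivative g') (at t)"
  shows "((\<lambda>t. f (g t *s v + z)) has_field_derivative cderiv f (g t *s v + z) v * g') (at t)"
  using hol_on_has_derivative_cderiv[OF f assms(2)] g by (intro has_field_derivative_curve) auto

lemma radial_deriv_eq_cderiv:
  assumes f: "f \<in> hol_on S" and z: "z \<in> S"
  shows "radial_deriv f z = cderiv f z z"
proof -
  interpret D: bounded_linear "cderiv f z"
    using hol_on_has_derivative_cderiv(1)[OF f z] by (rule has_derivative_bounded_linear)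
  have ax: "axis j t = t *s axis j 1" for j and t :: complex
    by (auto simp: vec_eq_iff axis_def)
  have "partial_deriv j f z = cderiv f z (axis j 1)" for j
    unfolding partial_deriv_def cderiv_def by (subst ax) simp
  then have "radial_deriv f z = (\<Sum>j\<in>UNIV. cderiv f z (z $ j *s axis j 1))"
    unfolding radial_deriv_def by (simp add: hol_on_has_derivative_cderiv(2)[OF f z])
  also have "\<dots> = cderiv f z (\<Sum>j\<in>UNIV. z $ j *s axis j 1)"
    by (simp add: D.sum)
  also have "(\<Sum>j\<in>UNIV. z $ j *s axis j 1) = z"
    by (rule basis_expansion)
  finally show ?thesis .
qed

lemma norm_circlepath_0 [simp]: "r > 0 \<Longrightarrow> cmod (circlepath 0 r t) = r"
  by (simp add: circlepath norm_mult norm_exp_eq_Re)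

lemma circlepath_0_neq_0 [simp]: "r > 0 \<Longrightarrow> circlepath 0 r t \<noteq> 0"
  by (metis norm_circlepath_0 norm_zero less_irrefl)

lemma continuous_on_circlepath [continuous_intros]:
  "continuous_on S g \<Longrightarrow> continuous_on S (\<lambda>x. circlepath z r (g x))"
  unfolding circlepath by (intro continuous_intros)

lemma norm_add_smult_less:
  assumes "norm z < \<rho>" "cmod t \<le> r" "\<rho> + r * norm v \<le> 1"
  shows "norm (z + t *s (v :: complex ^ 'd)) < 1"
proof -
  have "norm (z + t *s v) \<le> norm z + norm (t *s v)" by (rule norm_triangle_ineq)
  also have "norm (t *s v) \<le> r * norm v"
    using assms by (auto simp: norm_vector_smult intro!: mult_right_mono)
  finally show ?thesis using assms by auto
qed

text \<open>Cauchy's formula for the derivative at \<open>0\<close> of the one-variable function \<open>t \<mapsto> f (z + t *s v)\<close>,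
  with the circle parametrised over \<open>[0,1]\<close>. As a formula in \<open>z\<close> it expresses a derivative of \<open>f\<close>
  through values of \<open>f\<close> only, which gives both size estimates and further differentiability.\<close>

lemma cderiv_Cauchy:
  assumes f: "f \<in> Hol" and z: "norm z < \<rho>" and r: "r > 0" "\<rho> + r * norm v \<le> 1"
  shows "((\<lambda>t. f (z + circlepath 0 r t *s v) / circlepath 0 r t) has_integral cderiv f z v) {0..1}"
proof -
  define g where "g = (\<lambda>t. f (z + t *s v))"
  have *: "t *s v + z \<in> uball" if "t \<in> cball 0 r" for t
    using norm_add_smult_less[OF z _ r(2), of t] that by (simp add: add.commute)
  have g': "(g has_field_derivative cderiv f (t *s v + z) v) (at t)" if "t \<in> cball 0 r" for t
    using hol_on_curve[OF f, of "\<lambda>t. t" t v z 1] *[OF that] unfolding g_def by (auto simp: add.commute)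
  have "continuous_on (cball 0 r) g"
    by (rule DERIV_continuous_on) (rule has_field_derivative_at_within, rule g')
  moreover have "g holomorphic_on ball 0 r"
    using g' ball_subset_cball unfolding holomorphic_on_open[OF open_ball] by blast
  ultimately have "((\<lambda>u. g u / (u - 0) ^ Suc 1) has_contour_integral (2 * pi * \<i>) / fact 1 * (deriv ^^ 1) g 0) (circlepath 0 r)"
    using r by (intro Cauchy_has_contour_integral_higher_derivative_circlepath) auto
  then have 1: "((\<lambda>t. g (circlepath 0 r t) / (circlepath 0 r t - 0) ^ Suc 1 * vector_derivative (circlepath 0 r) (at t within {0..1}))
        has_integral 2 * pi * \<i> * cderiv f z v) {0..1}"
    unfolding has_contour_integral_def by (simp add: cderiv_def g_def)
  have "((\<lambda>t. 1 / (2 * pi * \<i>) * (g (circlepath 0 r t) / (circlepath 0 r t - 0) ^ Suc 1 * vector_derivative (circlepath 0 r) (at t within {0..1})))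
        has_integral 1 / (2 * pi * \<i>) * (2 * pi * \<i> * cderiv f z v)) {0..1}"
    by (rule has_integral_mult_right[OF 1])
  also have "1 / (2 * pi * \<i>) * (2 * pi * \<i> * cderiv f z v) = cderiv f z v"
    by simp
  finally show ?thesis
  proof (rule has_integral_eq[rotated])
    fix t :: real assume t: "t \<in> {0..1}"
    have "vector_derivative (circlepath 0 r) (at t within {0..1}) = 2 * pi * \<i> * circlepath 0 r t"
      using t by (simp add: vector_derivative_circlepath01) (simp add: circlepath)
    then show "1 / (2 * pi * \<i>) * (g (circlepath 0 r t) / (circlepath 0 r t - 0) ^ Suc 1 * vector_derivative (circlepath 0 r) (at t within {0..1}))
      = f (z + circlepath 0 r t *s v) / circlepath 0 r t"
      using r by (simp add: g_def)
  qed
qed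

lemma cderiv_bound:
  assumes f: "f \<in> Hol" and z: "norm z < \<rho>" and \<rho>: "\<rho> < 1" and M: "\<And>w. w \<in> uball \<Longrightarrow> norm w \<le> (1 + \<rho>) / 2 \<Longrightarrow> cmod (f w) \<le> M"
  shows "cmod (cderiv f z v) \<le> 2 * M / (1 - \<rho>) * norm v"
proof (cases "v = 0")
  case True
  then show ?thesis using hol_on_has_derivative_cderiv(2)[OF f, of z 0 v] z \<rho> by auto
next
  case False
  define r where "r = (1 - \<rho>) / (2 * norm v)"
  have r: "r > 0" "r * norm v = (1 - \<rho>) / 2" using False \<rho> by (auto simp: r_def)
  have "\<rho> > 0" using z norm_ge_zero[of z] by linarith
  then have "M \<ge> 0" using order_trans[OF norm_ge_zero M[of 0]] by auto
  have "norm (cderiv f z v) \<le> M / r * measure lborel (cbox 0 (1::real))"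
  proof (rule has_integral_bound)
    show "((\<lambda>t. f (z + circlepath 0 r t *s v) / circlepath 0 r t) has_integral cderiv f z v) (cbox 0 1)"
      using cderiv_Cauchy[OF f z r(1)] r \<rho> by (simp add: field_simps)
    fix t :: real
    have "norm (z + circlepath 0 r t *s v) \<le> norm z + r * norm v"
      using norm_triangle_ineq[of z "circlepath 0 r t *s v"] r(1) by (simp add: norm_vector_smult)
    also have "\<dots> \<le> (1 + \<rho>) / 2" using z r by (simp add: field_simps)
    finally have "cmod (f (z + circlepath 0 r t *s v)) \<le> M" using \<rho> by (intro M) auto
    then show "cmod (f (z + circlepath 0 r t *s v) / circlepath 0 r t) \<le> M / r"
      using r by (simp add: norm_divide divide_right_mono)
  qed (use r \<open>M \<ge> 0\<close> in auto)
  also have "M / r * measure lborel (cbox 0 (1::real)) = 2 * M / (1 - \<rho>) * norm v"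
    by (simp add: r_def)
  finally show ?thesis .
qed

text \<open>Differentiate Cauchy's formula under the integral sign. This needs the derivative of \<open>f\<close> to be
  continuous, which follows from the same formula as a parameter integral of a continuous
  function. Consequently \<open>radial_deriv\<close> can be iterated inside \<open>Hol\<close>.\<close>

lemma cderiv_hol:
  fixes v :: "complex ^ 'd"
  assumes f: "f \<in> Hol"
  shows "(\<lambda>z. cderiv f z v) \<in> Hol"
proof -
  \<comment> \<open>small enough for the circle around each point of \<open>ball 0 \<rho>\<close> to stay in the unit ball\<close>
  define r where "r = (\<lambda>\<rho> (v::complex ^ 'd). (1 - \<rho>) / (1 + norm v))"
  have r: "r \<rho> v > 0" "\<rho> + r \<rho> v * norm v \<le> 1" if "\<rho> < 1" for \<rho> v
  proof -
    have p: "1 + norm v > 0" using norm_ge_zero[of v] by linarith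
    then show "r \<rho> v > 0" using that by (auto simp: r_def)
    show "\<rho> + r \<rho> v * norm v \<le> 1" using that p by (auto simp: r_def field_simps)
  qed
  have ball: "x + circlepath 0 (r \<rho> v) t *s v \<in> uball" if "\<rho> < 1" "x \<in> ball 0 \<rho>" for x v \<rho> t
    using norm_add_smult_less[of x \<rho> "circlepath 0 (r \<rho> v) t" "r \<rho> v" v] r[of \<rho> v] that by auto
  \<comment> \<open>the integrand of Cauchy's formula, for \<open>f\<close> itself and for its derivative\<close>
  have cf: "continuous_on (ball 0 \<rho> \<times> {0..1}) (\<lambda>(x, t). g (x + circlepath 0 (r \<rho> v) t *s v) / circlepath 0 (r \<rho> v) t)"
    if g: "continuous_on uball g" and "\<rho> < 1" for \<rho> v and g :: "_ \<Rightarrow> complex"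
  proof -
    have "continuous_on (ball 0 \<rho> \<times> {0..1::real}) (\<lambda>p. g (fst p + circlepath 0 (r \<rho> v) (snd p) *s v))"
      by (rule continuous_on_compose2[OF g]) (use ball that in \<open>auto intro!: continuous_intros\<close>)
    then show ?thesis using r[OF that(2)] unfolding split_beta by (auto intro!: continuous_intros)
  qed
  \<comment> \<open>continuity of the derivative in the base point, from Cauchy's formula\<close>
  have cont: "continuous_on uball (\<lambda>z. cderiv f z v)" for v
  proof -
    have "continuous_on (ball 0 \<rho>) (\<lambda>z. cderiv f z v)" if "\<rho> < 1" for \<rho>
    proof -
      have "continuous_on (ball 0 \<rho>) (\<lambda>x. integral (cbox 0 1) (\<lambda>t. f (x + circlepath 0 (r \<rho> v) t *s v) / circlepath 0 (r \<rho> v) t))"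
        by (rule integral_continuous_on_param) (use cf[OF hol_on_imp_continuous_on[OF f] that] in simp)
      also have "?this \<longleftrightarrow> ?thesis"
        by (rule continuous_on_cong)
           (use cderiv_Cauchy[OF f _ r(1)[OF that] r(2)[OF that]] in \<open>auto intro!: integral_unique\<close>)
      finally show ?thesis .
    qed
    then have "isCont (\<lambda>z. cderiv f z v) z" if "z \<in> uball" for z :: "complex ^ 'd"
    proof -
      have "norm z < 1" using that by simp
      obtain \<rho> where "norm z < \<rho>" "\<rho> < 1" using dense[OF \<open>norm z < 1\<close>] by blast
      then show ?thesis
        using \<open>\<And>\<rho>. \<rho> < 1 \<Longrightarrow> continuous_on (ball 0 \<rho>) (\<lambda>z. cderiv f z v)\<close>[of \<rho>]
        by (auto simp: continuous_on_eq_continuous_at)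
    qed
    then show ?thesis by (auto intro: continuous_at_imp_continuous_on)
  qed
  show ?thesis unfolding hol_on_def
  proof (intro CollectI ballI)
    fix z :: "complex ^ 'd" assume "z \<in> uball"
    then have "norm z < 1" by simp
    then obtain \<rho> where \<rho>: "norm z < \<rho>" "\<rho> < 1" using dense[OF \<open>norm z < 1\<close>] by blast
    define e where "e = circlepath 0 (r \<rho> v)"
    have e: "e t \<noteq> 0" for t using r[OF \<rho>(2)] by (simp add: e_def)
    define D where "D = (\<lambda>x t h. cderiv f (x + e t *s v) h / e t)"
    have b: "x + e t *s v \<in> uball" if "x \<in> ball 0 \<rho>" for x t using ball[OF \<rho>(2)] that by (auto simp: e_def)
    have bl: "bounded_linear (D x t)" if "x \<in> ball 0 \<rho>" for x t
      unfolding D_def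
      using has_derivative_bounded_linear[OF hol_on_has_derivative_cderiv(1)[OF f b[OF that, of t]]]
      by (rule bounded_linear_compose[OF bounded_linear_divide])
    have contD: "continuous_on (ball 0 \<rho> \<times> cbox 0 1) (\<lambda>(x, t). Blinfun (D x t))"
    proof (rule continuous_on_blinfun_componentwise)
      fix i :: "complex ^ 'd"
      have "continuous_on (ball 0 \<rho> \<times> {0..1}) (\<lambda>(x, t). cderiv f (x + circlepath 0 (r \<rho> v) t *s v) i / circlepath 0 (r \<rho> v) t)"
        by (rule cf[OF cont \<rho>(2)])
      then have "continuous_on (ball 0 \<rho> \<times> cbox 0 1) (\<lambda>p. D (fst p) (snd p) i)"
        by (simp add: D_def e_def split_beta)
      also have "?this \<longleftrightarrow> continuous_on (ball 0 \<rho> \<times> cbox 0 1) (\<lambda>x. blinfun_apply (case x of (x, t) \<Rightarrow> Blinfun (D x t)) i)"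
        by (rule continuous_on_cong) (auto simp: bounded_linear_Blinfun_apply bl)
      finally show "continuous_on (ball 0 \<rho> \<times> cbox 0 1) (\<lambda>x. blinfun_apply (case x of (x, t) \<Rightarrow> Blinfun (D x t)) i)" .
    qed
    have zin: "z \<in> ball 0 \<rho>" using \<rho> by simp
    have "((\<lambda>x. integral (cbox 0 1) (\<lambda>t. f (x + e t *s v) / e t)) has_derivative
            blinfun_apply (integral (cbox 0 1) (\<lambda>t. Blinfun (D z t)))) (at z within ball 0 \<rho>)"
    proof (rule leibniz_rule[where fx = "\<lambda>x t. Blinfun (D x t)"])
      fix x :: "complex ^ 'd" and t :: real assume x: "x \<in> ball 0 \<rho>"
      have "((\<lambda>x. f (x + e t *s v)) has_derivative cderiv f (x + e t *s v)) (at x)"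
      proof -
        have "((\<lambda>x. x + e t *s v) has_derivative (\<lambda>h. h)) (at x)" by (auto intro!: derivative_eq_intros)
        from diff_chain_at[OF this hol_on_has_derivative_cderiv(1)[OF f b[OF x, of t]]]
        show ?thesis by (simp add: o_def)
      qed
      from bounded_linear.has_derivative[OF bounded_linear_divide this, of "e t"]
      show "((\<lambda>x. f (x + e t *s v) / e t) has_derivative blinfun_apply (Blinfun (D x t))) (at x within ball 0 \<rho>)"
        unfolding bounded_linear_Blinfun_apply[OF bl[OF x]] by (simp add: D_def[abs_def] has_derivative_at_withinI)
    next
      fix x :: "complex ^ 'd" assume "x \<in> ball 0 \<rho>"
      then show "(\<lambda>t. f (x + e t *s v) / e t) integrable_on cbox 0 1"
        using cderiv_Cauchy[OF f _ r(1)[OF \<rho>(2)] r(2)[OF \<rho>(2)], of x v] by (auto simp: e_def)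
    qed (use contD zin in auto)
    then have "((\<lambda>x. cderiv f x v) has_derivative
            blinfun_apply (integral (cbox 0 1) (\<lambda>t. Blinfun (D z t)))) (at z within ball 0 \<rho>)"
    proof (rule has_derivative_transform[rotated 2])
      fix x :: "complex ^ 'd" assume "x \<in> ball 0 \<rho>"
      then show "cderiv f x v = integral (cbox 0 1) (\<lambda>t. f (x + e t *s v) / e t)"
        using cderiv_Cauchy[OF f _ r(1)[OF \<rho>(2)] r(2)[OF \<rho>(2)], of x v]
        by (auto simp: e_def intro!: integral_unique[symmetric])
    qed (use zin in auto)
    then have 1: "((\<lambda>x. cderiv f x v) has_derivative
            blinfun_apply (integral (cbox 0 1) (\<lambda>t. Blinfun (D z t)))) (at z)"
      using zin by (simp add: at_within_open[OF zin open_ball])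
    have "continuous_on (cbox 0 1) (\<lambda>t. Blinfun (D z t))"
    proof -
      have "continuous_on (cbox 0 1) (\<lambda>t. case (z, t) of (x, t) \<Rightarrow> Blinfun (D x t))"
        by (rule continuous_on_compose2[OF contD]) (use zin in \<open>auto intro!: continuous_intros\<close>)
      then show ?thesis by simp
    qed
    then have int: "(\<lambda>t. Blinfun (D z t)) integrable_on cbox 0 1"
      by (rule integrable_continuous)
    have 2: "blinfun_apply (integral (cbox 0 1) (\<lambda>t. Blinfun (D z t))) (c *s h)
        = c * blinfun_apply (integral (cbox 0 1) (\<lambda>t. Blinfun (D z t))) h" for c h
    proof -
      have "D z t (c *s h) = c * D z t h" for t
        using hol_on_has_derivative_cderiv(2)[OF f b[OF zin]] by (simp add: D_def)
      then show ?thesis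
        unfolding blinfun_apply_integral[OF int] by (simp add: bounded_linear_Blinfun_apply bl[OF zin])
    qed
    show "\<exists>D. ((\<lambda>z. cderiv f z v) has_derivative D) (at z) \<and> (\<forall>c v. D (c *s v) = c * D v)"
      using 1 2 by blast
  qed
qed

lemma Hol_const [simp, intro]: "(\<lambda>z. c) \<in> Hol"
  unfolding hol_on_def by (auto intro!: exI[of _ "\<lambda>_. 0"])

lemma Hol_add [intro]:
  fixes f g :: "complex ^ 'd \<Rightarrow> complex"
  assumes "f \<in> Hol" "g \<in> Hol" shows "(\<lambda>z. f z + g z) \<in> Hol"
  unfolding hol_on_def
proof (intro CollectI ballI)
  fix z :: "complex ^ 'd" assume "z \<in> uball"
  with assms obtain D E where "(f has_derivative D) (at z)" "\<forall>c v. D (c *s v) = c * D v"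
    "(g has_derivative E) (at z)" "\<forall>c v. E (c *s v) = c * E v"
    unfolding hol_on_def by blast
  then show "\<exists>D. ((\<lambda>z. f z + g z) has_derivative D) (at z) \<and> (\<forall>c v. D (c *s v) = c * D v)"
    by (intro exI[of _ "\<lambda>h. D h + E h"] conjI has_derivative_add) (auto simp: algebra_simps)
qed

lemma Hol_mult [intro]:
  fixes f g :: "complex ^ 'd \<Rightarrow> complex"
  assumes "f \<in> Hol" "g \<in> Hol" shows "(\<lambda>z. f z * g z) \<in> Hol"
  unfolding hol_on_def
proof (intro CollectI ballI)
  fix z :: "complex ^ 'd" assume "z \<in> uball"
  with assms obtain D E where "(f has_derivative D) (at z)" "\<forall>c v. D (c *s v) = c * D v"
    "(g has_derivative E) (at z)" "\<forall>c v. E (c *s v) = c * E v"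
    unfolding hol_on_def by blast
  then show "\<exists>D. ((\<lambda>z. f z * g z) has_derivative D) (at z) \<and> (\<forall>c v. D (c *s v) = c * D v)"
    by (intro exI[of _ "\<lambda>h. f z * E h + D h * g z"] conjI has_derivative_mult) (auto simp: algebra_simps)
qed

lemma Hol_cmult [intro]: "f \<in> Hol \<Longrightarrow> (\<lambda>z. c * f z) \<in> Hol"
  by (intro Hol_mult Hol_const)

lemma Hol_diff [intro]: "f \<in> Hol \<Longrightarrow> g \<in> Hol \<Longrightarrow> (\<lambda>z. f z - g z) \<in> Hol"
  using Hol_add[of f "\<lambda>z. (-1) * g z"] Hol_cmult[of g "-1"] by simp

lemma Hol_power [intro]: "f \<in> Hol \<Longrightarrow> (\<lambda>z. f z ^ n) \<in> Hol"
  by (induction n) auto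

lemma Hol_sum [intro]: "(\<And>i. i \<in> I \<Longrightarrow> f i \<in> Hol) \<Longrightarrow> (\<lambda>z. \<Sum>i\<in>I. f i z) \<in> Hol"
  by (induction I rule: infinite_finite_induct) auto

lemma Hol_coord [intro]: "(\<lambda>z. z $ j) \<in> Hol"
  unfolding hol_on_def
  by (auto intro!: exI[of _ "\<lambda>z. z $ j"] bounded_linear_imp_has_derivative bounded_linear_vec_nth)

lemma hol_on_cong:
  assumes "open S" "\<And>z. z \<in> S \<Longrightarrow> f z = g z" "f \<in> hol_on S" shows "g \<in> hol_on S"
  unfolding hol_on_def
proof (intro CollectI ballI)
  fix z assume z: "z \<in> S"
  with assms(3) obtain D where D: "(f has_derivative D) (at z)" "\<forall>c v. D (c *s v) = c * D v"
    unfolding hol_on_def by blast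
  then show "\<exists>D. (g has_derivative D) (at z) \<and> (\<forall>c v. D (c *s v) = c * D v)"
    using has_derivative_transform_within_open[OF D(1) assms(1) z assms(2)] by blast
qed

lemma smult_in_ball: "cmod c \<le> 1 \<Longrightarrow> z \<in> uball \<Longrightarrow> c *s z \<in> uball"
  using mult_mono[of "cmod c" 1 "norm z" "norm z"] by (auto simp: norm_vector_smult)

lemma Hol_smult:
  fixes f :: "complex ^ 'd \<Rightarrow> complex"
  assumes "f \<in> Hol" "cmod c \<le> 1" shows "(\<lambda>z. f (c *s z)) \<in> Hol"
  unfolding hol_on_def
proof (intro CollectI ballI)
  fix z :: "complex ^ 'd" assume "z \<in> uball"
  then have "c *s z \<in> uball" by (rule smult_in_ball[OF assms(2)])
  with assms obtain D where D: "(f has_derivative D) (at (c *s z))" "\<forall>c v. D (c *s v) = c * D v"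
    unfolding hol_on_def by blast
  have "((\<lambda>z. c *s z) has_derivative (\<lambda>z. c *s z)) (at z)"
    by (rule bounded_linear_imp_has_derivative[OF bounded_linear_smult_left])
  from diff_chain_at[OF this D(1)] D(2)
  show "\<exists>D. ((\<lambda>z. f (c *s z)) has_derivative D) (at z) \<and> (\<forall>c v. D (c *s v) = c * D v)"
    by (intro exI[of _ "\<lambda>h. D (c *s h)"]) (auto simp: o_def)
qed

lemma Hol_scaleR: "f \<in> Hol \<Longrightarrow> 0 \<le> r \<Longrightarrow> r \<le> 1 \<Longrightarrow> (\<lambda>z. f (r *\<^sub>R z)) \<in> Hol"
  unfolding scaleR_eq_smult by (rule Hol_smult) auto

lemma Hol_radial_deriv: assumes f: "f \<in> Hol" shows "radial_deriv f \<in> Hol"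
proof -
  have ax: "axis j t = t *s axis j 1" for j and t :: complex
    by (auto simp: vec_eq_iff axis_def)
  have "(\<lambda>z. \<Sum>j\<in>UNIV. z $ j * cderiv f z (axis j 1)) \<in> Hol"
    by (intro Hol_sum Hol_mult Hol_coord cderiv_hol f)
  also have "(\<lambda>z. \<Sum>j\<in>UNIV. z $ j * cderiv f z (axis j 1)) = radial_deriv f"
    unfolding radial_deriv_def partial_deriv_def cderiv_def by (subst (2) ax) simp
  finally show ?thesis .
qed

lemma Hol_radial_deriv_pow [intro]: "f \<in> Hol \<Longrightarrow> (radial_deriv ^^ n) f \<in> Hol"
  by (induction n) (auto intro: Hol_radial_deriv)

section \<open>Iterated radial derivatives\<close>

text \<open>In the logarithmic coordinate \<open>\<zeta>\<close> along a complex line, \<open>radial_deriv\<close> becomes \<open>d/d\<zeta>\<close>. All rules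
  for iterated radial derivatives are thereby rules for higher derivatives of one-variable
  functions. Purely imaginary \<open>\<zeta>\<close> moves along a circle, real negative \<open>\<zeta>\<close> along a radius.\<close>

definition eslice :: "(complex ^ 'd \<Rightarrow> complex) \<Rightarrow> complex ^ 'd \<Rightarrow> complex \<Rightarrow> complex" where
  "eslice f z \<zeta> = f (exp \<zeta> *s z)"

abbreviation edom :: "complex ^ 'd \<Rightarrow> complex set" where
  "edom z \<equiv> {\<zeta>. exp \<zeta> *s z \<in> uball}"

lemma open_edom: "open (edom z)"
proof -
  have "open ((\<lambda>\<zeta>. exp \<zeta> *s z) -` uball)"
    by (rule open_vimage) (auto intro!: continuous_intros)
  then show ?thesis by (simp add: vimage_def)
qed

lemma eslice_deriv:
  assumes f: "f \<in> Hol" and \<zeta>: "\<zeta> \<in> edom z"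
  shows "(eslice f z has_field_derivative eslice (radial_deriv f) z \<zeta>) (at \<zeta>)"
proof -
  have "((\<lambda>\<zeta>. f (exp \<zeta> *s z + 0)) has_field_derivative cderiv f (exp \<zeta> *s z + 0) z * exp \<zeta>) (at \<zeta>)"
    by (rule hol_on_curve[OF f]) (use \<zeta> in \<open>auto intro!: derivative_eq_intros\<close>)
  also have "cderiv f (exp \<zeta> *s z + 0) z * exp \<zeta> = eslice (radial_deriv f) z \<zeta>"
    using \<zeta> hol_on_has_derivative_cderiv(2)[OF f, of "exp \<zeta> *s z" "exp \<zeta>" z]
    by (simp add: eslice_def radial_deriv_eq_cderiv[OF f] mult.commute)
  finally show ?thesis by (simp add: eslice_def[abs_def])
qed

lemma eslice_holomorphic: "f \<in> Hol \<Longrightarrow> eslice f z holomorphic_on edom z"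
  unfolding holomorphic_on_open[OF open_edom] using eslice_deriv by blast

lemma higher_deriv_eslice:
  assumes f: "f \<in> Hol" and "\<zeta> \<in> edom z"
  shows "(deriv ^^ n) (eslice f z) \<zeta> = eslice ((radial_deriv ^^ n) f) z \<zeta>"
  using assms(2)
proof (induction n arbitrary: \<zeta>)
  case (Suc n)
  have "deriv ((deriv ^^ n) (eslice f z)) \<zeta> = deriv (eslice ((radial_deriv ^^ n) f) z) \<zeta>"
    using Suc eventually_nhds_in_open[OF open_edom Suc.prems]
    by (intro deriv_cong_ev) (auto elim: eventually_mono)
  then show ?case using eslice_deriv[OF Hol_radial_deriv_pow[OF f] Suc.prems] by (simp add: DERIV_imp_deriv)
qed simp

lemma radial_deriv_pow_eq_deriv:
  "f \<in> Hol \<Longrightarrow> z \<in> uball \<Longrightarrow> (radial_deriv ^^ n) f z = (deriv ^^ n) (eslice f z) 0"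
  using higher_deriv_eslice[of f 0 z n] by (simp add: eslice_def)

lemma radial_deriv_pow_cong:
  assumes "f \<in> Hol" "\<And>z. z \<in> uball \<Longrightarrow> f z = g z" "z \<in> uball"
  shows "(radial_deriv ^^ n) f z = (radial_deriv ^^ n) g z"
proof -
  have g: "g \<in> Hol" using hol_on_cong[OF open_ball assms(2,1)] .
  have 0: "0 \<in> edom z" using assms by simp
  have "eventually (\<lambda>x. eslice f z x = eslice g z x) (nhds 0)"
    using eventually_nhds_in_open[OF open_edom 0] assms(2) by (auto simp: eslice_def elim: eventually_mono)
  then show ?thesis
    using assms g by (simp add: radial_deriv_pow_eq_deriv higher_deriv_cong_ev)
qed

lemma eslice_smult: "eslice f (c *s z) = eslice (\<lambda>z. f (c *s z)) z"
  by (auto simp: eslice_def fun_eq_iff vector_smult_assoc mult.commute)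

lemma radial_deriv_pow_smult:
  assumes "f \<in> Hol" "cmod c \<le> 1" "z \<in> uball"
  shows "(radial_deriv ^^ n) (\<lambda>z. f (c *s z)) z = (radial_deriv ^^ n) f (c *s z)"
  using assms smult_in_ball[OF assms(2,3)]
  by (simp add: radial_deriv_pow_eq_deriv Hol_smult eslice_smult)

lemma radial_deriv_pow_mult:
  assumes "f \<in> Hol" "g \<in> Hol" "z \<in> uball"
  shows "(radial_deriv ^^ n) (\<lambda>z. f z * g z) z =
    (\<Sum>i = 0..n. of_nat (n choose i) * (radial_deriv ^^ i) f z * (radial_deriv ^^ (n - i)) g z)"
proof -
  have "eslice (\<lambda>z. f z * g z) z = (\<lambda>w. eslice f z w * eslice g z w)" by (simp add: eslice_def[abs_def])
  then show ?thesis
    using higher_deriv_mult[OF eslice_holomorphic[OF assms(1)] eslice_holomorphic[OF assms(2)] open_edom, of 0 z n] assms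
    by (simp add: radial_deriv_pow_eq_deriv Hol_mult)
qed

lemma radial_deriv_pow_add:
  assumes "f \<in> Hol" "g \<in> Hol" "z \<in> uball"
  shows "(radial_deriv ^^ n) (\<lambda>z. f z + g z) z = (radial_deriv ^^ n) f z + (radial_deriv ^^ n) g z"
proof -
  have "eslice (\<lambda>z. f z + g z) z = (\<lambda>w. eslice f z w + eslice g z w)" by (simp add: eslice_def[abs_def])
  then show ?thesis
    using higher_deriv_add[OF eslice_holomorphic[OF assms(1)] eslice_holomorphic[OF assms(2)] open_edom, of 0 z n] assms
    by (simp add: radial_deriv_pow_eq_deriv Hol_add)
qed

lemma radial_deriv_pow_cmult:
  assumes "f \<in> Hol" "z \<in> uball"
  shows "(radial_deriv ^^ n) (\<lambda>z. c * f z) z = c * (radial_deriv ^^ n) f z"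
proof -
  have "eslice (\<lambda>z. c * f z) z = (\<lambda>w. c * eslice f z w)" by (simp add: eslice_def[abs_def])
  then show ?thesis
    using higher_deriv_cmult[OF eslice_holomorphic[OF assms(1)] _ open_edom, of 0 z n c] assms
    by (simp add: radial_deriv_pow_eq_deriv Hol_cmult)
qed

lemma radial_deriv_pow_const:
  assumes "z \<in> uball" "n > 0"
  shows "(radial_deriv ^^ n) (\<lambda>z. c) z = 0"
proof -
  have "eslice (\<lambda>z. c) z = (\<lambda>w. c)" by (simp add: eslice_def[abs_def])
  then show ?thesis using assms by (simp add: radial_deriv_pow_eq_deriv)
qed

lemma radial_deriv_pow_sum:
  assumes "finite I" "\<And>i. i \<in> I \<Longrightarrow> f i \<in> Hol" "z \<in> uball"
  shows "(radial_deriv ^^ n) (\<lambda>z. \<Sum>i\<in>I. f i z) z = (\<Sum>i\<in>I. (radial_deriv ^^ n) (f i) z)"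
  using assms(1,2)
proof induction
  case empty
  then show ?case using assms(3) by (cases "n = 0") (auto simp: radial_deriv_pow_const)
next
  case (insert i I)
  then show ?case using assms(3) by (simp add: radial_deriv_pow_add Hol_sum)
qed

section \<open>The Gagliardo--Nirenberg inequality for periodic functions\<close>

lemma has_vector_derivative_at_iff_tendsto:
  fixes f :: "real \<Rightarrow> 'a::real_normed_vector"
  shows "(f has_vector_derivative D) (at t) \<longleftrightarrow> ((\<lambda>u. (f u - f t) /\<^sub>R (u - t)) \<longlongrightarrow> D) (at t)"
proof -
  have "(f has_vector_derivative D) (at t) \<longleftrightarrow>
     ((\<lambda>u. (1 / norm (u - t)) *\<^sub>R (f u - (f t + (u - t) *\<^sub>R D))) \<longlongrightarrow> 0) (at t)"
    unfolding has_vector_derivative_def has_derivative_within[of f _ t UNIV]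
    by (simp add: bounded_linear_scaleR_left)
  also have "\<dots> \<longleftrightarrow> ((\<lambda>u. norm ((f u - f t) /\<^sub>R (u - t) - D)) \<longlongrightarrow> 0) (at t)"
  proof -
    have "norm ((1 / norm (u - t)) *\<^sub>R (f u - (f t + (u - t) *\<^sub>R D))) = norm ((f u - f t) /\<^sub>R (u - t) - D)"
      if "u \<noteq> t" for u
    proof -
      have "(f u - f t) /\<^sub>R (u - t) - D = (1 / (u - t)) *\<^sub>R (f u - (f t + (u - t) *\<^sub>R D))"
        using that by (simp add: scaleR_diff_right scaleR_add_right inverse_eq_divide)
      then show ?thesis by simp
    qed
    then have ev: "eventually (\<lambda>u. norm ((1 / norm (u - t)) *\<^sub>R (f u - (f t + (u - t) *\<^sub>R D))) = norm ((f u - f t) /\<^sub>R (u - t) - D)) (at t)"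
      by (auto simp: eventually_at_filter)
    show ?thesis
      by (subst tendsto_norm_zero_iff[symmetric]) (rule tendsto_cong[OF ev])
  qed
  finally show ?thesis by (simp add: tendsto_norm_zero_iff LIM_zero_iff)
qed

text \<open>The function \<open>w \<mapsto> cnj w * \<bar>w\<bar> powr s\<close> is continuously differentiable as a function on the real
  plane; at \<open>0\<close> its derivative vanishes because \<open>s > 0\<close>. The chain rule therefore holds also at
  the zeros of \<open>y\<close>.\<close>

lemma has_vector_derivative_cnj_powr:
  fixes y :: "real \<Rightarrow> complex"
  assumes y: "(y has_vector_derivative y') (at t)" and s: "s > 0"
  shows "\<exists>V. ((\<lambda>t. cnj (y t) * of_real (cmod (y t) powr s)) has_vector_derivative V) (at t)
    \<and> cmod V \<le> (1 + s) * cmod (y t) powr s * cmod y'"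
proof (cases "y t = 0")
  case True
  have cont: "isCont y t" using y by (rule has_vector_derivative_continuous)
  have 1: "((\<lambda>u. norm ((y u - y t) /\<^sub>R (u - t)) * (cmod (y u) powr s)) \<longlongrightarrow> norm y' * 0) (at t)"
  proof (intro tendsto_mult tendsto_norm)
    show "((\<lambda>u. (y u - y t) /\<^sub>R (u - t)) \<longlongrightarrow> y') (at t)"
      using y by (simp add: has_vector_derivative_at_iff_tendsto)
    have "((\<lambda>u. cmod (y u)) \<longlongrightarrow> 0) (at t)"
      using tendsto_norm[OF isContD[OF cont]] True by simp
    then show "((\<lambda>u. cmod (y u) powr s) \<longlongrightarrow> 0) (at t)"
      using s by (intro tendsto_zero_powrI[where b = s]) auto
  qed
  have "((\<lambda>t. cnj (y t) * of_real (cmod (y t) powr s)) has_vector_derivative 0) (at t)"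
    unfolding has_vector_derivative_at_iff_tendsto
    by (subst tendsto_norm_zero_iff[symmetric]) (use 1 True in \<open>simp add: norm_mult mult_ac\<close>)
  then show ?thesis using True by auto
next
  case False
  have d: "(y has_derivative (\<lambda>h. h *\<^sub>R y')) (at t)" using y by (simp add: has_vector_derivative_def)
  have n: "((\<lambda>u. cmod (y u)) has_derivative (\<lambda>h. (h *\<^sub>R y') \<bullet> sgn (y t))) (at t)"
    using has_derivative_compose[OF d has_derivative_norm[OF False]] by simp
  then have n': "((\<lambda>u. cmod (y u)) has_real_derivative (y' \<bullet> sgn (y t))) (at t)"
    by (simp add: has_field_derivative_def mult_commute_abs)
  have p: "((\<lambda>u. cmod (y u) powr s) has_real_derivative (s * cmod (y t) powr (s - 1) * (y' \<bullet> sgn (y t)))) (at t)"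
    using DERIV_powr[OF n' _ DERIV_const, of s] False by (simp add: powr_diff field_simps)
  have p': "((\<lambda>u. complex_of_real (cmod (y u) powr s)) has_vector_derivative of_real (s * cmod (y t) powr (s - 1) * (y' \<bullet> sgn (y t)))) (at t)"
    using p by (intro has_vector_derivative_of_real) (simp add: has_real_derivative_iff_has_vector_derivative)
  have c: "((\<lambda>u. cnj (y u)) has_vector_derivative cnj y') (at t)"
    using y by (rule has_vector_derivative_cnj)
  let ?V = "cnj (y t) * of_real (s * cmod (y t) powr (s - 1) * (y' \<bullet> sgn (y t))) + cnj y' * of_real (cmod (y t) powr s)"
  have "cmod ?V \<le> cmod (y t) * (s * cmod (y t) powr (s - 1) * \<bar>y' \<bullet> sgn (y t)\<bar>) + cmod y' * cmod (y t) powr s"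
    by (rule order_trans[OF norm_triangle_ineq]) (use s in \<open>simp add: norm_mult abs_mult\<close>)
  also have "\<bar>y' \<bullet> sgn (y t)\<bar> \<le> cmod y'"
    using Cauchy_Schwarz_ineq2[of y' "sgn (y t)"] False by (simp add: norm_sgn)
  also have "cmod (y t) * (s * cmod (y t) powr (s - 1) * cmod y') = s * cmod (y t) powr s * cmod y'"
    using False by (simp add: powr_diff)
  finally have "cmod ?V \<le> (1 + s) * cmod (y t) powr s * cmod y'"
    using s False by (simp add: algebra_simps mult_left_mono)
  then show ?thesis using has_vector_derivative_mult[OF c p'] by blast
qed

text \<open>Write \<open>\<bar>y\<bar> powr (s + 2)\<close> as \<open>y\<close> times \<open>cnj y * \<bar>y\<bar> powr s\<close> and integrate the first factor: the
  boundary terms cancel by periodicity.\<close>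

lemma integral_by_parts_power:
  fixes u y v :: "real \<Rightarrow> complex"
  assumes T: "T \<ge> 0"
    and u: "\<And>t. (u has_vector_derivative y t) (at t)" and y: "\<And>t. (y has_vector_derivative v t) (at t)"
    and v: "continuous_on UNIV v" and per: "u T = u 0" "y T = y 0" and s: "s > 0"
  shows "integral {0..T} (\<lambda>t. cmod (y t) powr (s + 2))
    \<le> integral {0..T} (\<lambda>t. (1 + s) * (cmod (u t) * cmod (y t) powr s * cmod (v t)))"
proof -
  have cu: "continuous_on A u" for A
    by (rule continuous_at_imp_continuous_on) (use u in \<open>blast intro: has_vector_derivative_continuous\<close>)
  have cy: "continuous_on A y" for A
    by (rule continuous_at_imp_continuous_on) (use y in \<open>blast intro: has_vector_derivative_continuous\<close>)
  have cv: "continuous_on A v" for A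
    by (rule continuous_on_subset[OF v]) simp
  obtain V where V: "\<And>t. ((\<lambda>t. cnj (y t) * of_real (cmod (y t) powr s)) has_vector_derivative V t) (at t)"
    "\<And>t. cmod (V t) \<le> (1 + s) * cmod (y t) powr s * cmod (v t)"
    using has_vector_derivative_cnj_powr[OF y s] by metis
  \<comment> \<open>the left-hand side; the integral of \<open>u * V\<close> turns out to be \<open>- J\<close>\<close>
  define J where "J = integral {0..T} (\<lambda>t. cmod (y t) powr (s + 2))"
  have "continuous_on {0..T} (\<lambda>t. cmod (y t) powr (s + 2))"
    by (intro continuous_on_powr' continuous_intros cy) (use s in auto)
  then have "((\<lambda>t. cmod (y t) powr (s + 2)) has_integral J) {0..T}"
    unfolding J_def by (intro integrable_integral integrable_continuous_real)
  then have J: "((\<lambda>t. complex_of_real (cmod (y t) powr (s + 2))) has_integral of_real J) {0..T}"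
    by (rule has_integral_of_real)
  have "((\<lambda>t. u t * V t + y t * (cnj (y t) * of_real (cmod (y t) powr s))) has_integral
      u T * (cnj (y T) * of_real (cmod (y T) powr s)) - u 0 * (cnj (y 0) * of_real (cmod (y 0) powr s))) {0..T}"
    by (rule fundamental_theorem_of_calculus[OF T])
       (rule has_vector_derivative_at_within, rule has_vector_derivative_mult[OF u V(1)])
  also have "(\<lambda>t. u t * V t + y t * (cnj (y t) * of_real (cmod (y t) powr s)))
     = (\<lambda>t. u t * V t + complex_of_real (cmod (y t) powr (s + 2)))"
  proof
    fix t
    have "y t * (cnj (y t) * of_real (cmod (y t) powr s)) = of_real (cmod (y t) ^ 2 * cmod (y t) powr s)"
      by (simp add: complex_norm_square[symmetric] mult.assoc[symmetric] flip: of_real_power)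
    also have "cmod (y t) ^ 2 * cmod (y t) powr s = cmod (y t) powr (s + 2)"
      by (cases "y t = 0") (auto simp: powr_add)
    finally show "u t * V t + y t * (cnj (y t) * of_real (cmod (y t) powr s))
      = u t * V t + complex_of_real (cmod (y t) powr (s + 2))" by simp
  qed
  finally have "((\<lambda>t. u t * V t + complex_of_real (cmod (y t) powr (s + 2))) has_integral 0) {0..T}"
    using per by simp
  from has_integral_diff[OF this J]
  have uV: "((\<lambda>t. u t * V t) has_integral - of_real J) {0..T}" by simp
  have "J \<le> norm (integral {0..T} (\<lambda>t. u t * V t))"
    using integral_unique[OF uV] by simp
  also have "\<dots> \<le> integral {0..T} (\<lambda>t. (1 + s) * (cmod (u t) * cmod (y t) powr s * cmod (v t)))"
  proof (rule integral_norm_bound_integral)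
    show "(\<lambda>t. (1 + s) * (cmod (u t) * cmod (y t) powr s * cmod (v t))) integrable_on {0..T}"
      by (intro integrable_continuous_real continuous_on_powr' continuous_intros cu cy cv) (use s in auto)
    fix t
    show "cmod (u t * V t) \<le> (1 + s) * (cmod (u t) * cmod (y t) powr s * cmod (v t))"
      using mult_left_mono[OF V(2)[of t] norm_ge_zero[of "u t"]] by (simp add: norm_mult mult_ac)
  qed (use uV in auto)
  finally show ?thesis by (simp add: J_def)
qed

text \<open>Both sides are homogeneous of degree \<open>2 * N\<close> in \<open>(x, y, z)\<close>. If \<open>z\<close> is small compared to
  \<open>max x y\<close>, the factor \<open>z ^ (b + 1)\<close> makes the product a small multiple of \<open>max x y ^ (2 * N)\<close>;
  otherwise all three variables are dominated by a multiple of \<open>z\<close>.\<close>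

lemma weighted_product_bound:
  fixes c \<delta> :: real
  assumes "1 \<le> b" "b < N" "c \<ge> 0" "\<delta> > 0"
  shows "\<exists>K\<ge>0. \<forall>x\<ge>0. \<forall>y\<ge>0. \<forall>z\<ge>0. c * (x ^ (b - 1) * y ^ (2 * N - 2 * b) * z ^ (b + 1))
     \<le> \<delta> * x ^ (2 * N) + y ^ (2 * N) / 4 + K * z ^ (2 * N)"
proof -
  \<comment> \<open>the ratio separating the two cases, small enough for \<open>c * \<eta> \<le> min \<delta> (1/4)\<close>\<close>
  define \<eta> where "\<eta> = min 1 (min \<delta> (1/4) / (c + 1))"
  have \<eta>: "\<eta> > 0" "\<eta> \<le> 1" using assms by (auto simp: \<eta>_def)
  have c\<eta>: "c * \<eta> \<le> min \<delta> (1/4)"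
  proof -
    have "c * \<eta> \<le> (c + 1) * (min \<delta> (1/4) / (c + 1))"
      using assms \<eta> by (intro mult_mono) (auto simp: \<eta>_def)
    then show ?thesis using assms by simp
  qed
  have deg: "(b - 1) + (2 * N - 2 * b) + (b + 1) = 2 * N" using assms by auto
  have "c * (x ^ (b - 1) * y ^ (2 * N - 2 * b) * z ^ (b + 1))
     \<le> \<delta> * x ^ (2 * N) + y ^ (2 * N) / 4 + c / \<eta> ^ (2 * N) * z ^ (2 * N)"
    if nn: "x \<ge> 0" "y \<ge> 0" "z \<ge> 0" for x y z :: real
  proof (cases "z \<le> \<eta> * max x y")
    case True
    define m where "m = max x y"
    have m: "x \<le> m" "y \<le> m" "m \<ge> 0" using nn by (auto simp: m_def)
    have "c * (x ^ (b - 1) * y ^ (2 * N - 2 * b) * z ^ (b + 1))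
      \<le> c * (m ^ (b - 1) * m ^ (2 * N - 2 * b) * (\<eta> * m) ^ (b + 1))"
    proof (intro mult_left_mono mult_mono power_mono mult_nonneg_nonneg zero_le_power)
      show "z \<le> \<eta> * m" using True by (simp add: m_def)
    qed (use nn m assms \<eta> in simp_all)
    also have "\<dots> = (c * \<eta> ^ (b + 1)) * m ^ ((b - 1) + (2 * N - 2 * b) + (b + 1))"
      by (simp only: power_add power_mult_distrib mult_ac)
    also have "\<dots> = (c * \<eta> ^ (b + 1)) * m ^ (2 * N)" by (simp only: deg)
    also have "\<dots> \<le> min \<delta> (1/4) * m ^ (2 * N)"
    proof (rule mult_right_mono)
      have "\<eta> ^ (b + 1) \<le> \<eta> ^ 1" using \<eta> by (intro power_decreasing) auto
      then have "c * \<eta> ^ (b + 1) \<le> c * \<eta>" using assms by (intro mult_left_mono) auto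
      with c\<eta> show "c * \<eta> ^ (b + 1) \<le> min \<delta> (1/4)" by linarith
    qed (use m in auto)
    also have "\<dots> \<le> \<delta> * x ^ (2 * N) + y ^ (2 * N) / 4"
    proof (cases "x \<le> y")
      case True
      then have "m = y" by (simp add: m_def)
      have "min \<delta> (1/4) * y ^ (2 * N) \<le> 1 / 4 * y ^ (2 * N)" by (intro mult_right_mono) auto
      moreover have "0 \<le> \<delta> * x ^ (2 * N)" using assms nn by simp
      ultimately show ?thesis using \<open>m = y\<close> by simp
    next
      case False
      then have "m = x" by (simp add: m_def)
      have "min \<delta> (1/4) * x ^ (2 * N) \<le> \<delta> * x ^ (2 * N)" by (intro mult_right_mono) auto
      moreover have "0 \<le> y ^ (2 * N)" by simp
      ultimately show ?thesis using \<open>m = x\<close> nn by (simp add: add_increasing2)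
    qed
    finally show ?thesis using nn assms \<eta> by (simp add: add_increasing2)
  next
    case False
    define w where "w = z / \<eta>"
    have "z * \<eta> \<le> z * 1" using nn \<eta> by (intro mult_left_mono) auto
    moreover have "\<eta> * x \<le> \<eta> * max x y" "\<eta> * y \<le> \<eta> * max x y" using \<eta> by auto
    then have "\<eta> * x \<le> z" "\<eta> * y \<le> z" using False by linarith+
    ultimately have w: "x \<le> w" "y \<le> w" "z \<le> w" using False \<eta> nn by (auto simp: w_def field_simps)
    have "c * (x ^ (b - 1) * y ^ (2 * N - 2 * b) * z ^ (b + 1))
      \<le> c * (w ^ (b - 1) * w ^ (2 * N - 2 * b) * w ^ (b + 1))"
      by (intro mult_left_mono mult_mono power_mono mult_nonneg_nonneg zero_le_power) (use nn w assms in simp_all)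
    also have "\<dots> = c * w ^ ((b - 1) + (2 * N - 2 * b) + (b + 1))" by (simp only: power_add mult_ac)
    also have "\<dots> = c / \<eta> ^ (2 * N) * z ^ (2 * N)" by (simp only: deg) (simp add: w_def power_divide)
    finally show ?thesis using nn assms \<eta> by (simp add: add_increasing)
  qed
  then show ?thesis using assms \<eta> by (intro exI[of _ "c / \<eta> ^ (2 * N)"]) auto
qed

text \<open>The functions \<open>g n\<close> are the successive derivatives of the bounded periodic function \<open>g 0\<close>.\<close>

locale periodic_jet =
  fixes g :: "nat \<Rightarrow> real \<Rightarrow> complex" and T B :: real
  assumes T: "T \<ge> 0" and B: "B \<ge> 0"
    and deriv: "\<And>n t. (g n has_vector_derivative g (Suc n) t) (at t)"
    and periodic: "\<And>n. g n T = g n 0"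
    and bounded: "\<And>t. cmod (g 0 t) \<le> B"
begin

text \<open>If \<open>t\<close> is rescaled by a factor \<open>\<lambda>\<close>, every \<open>jet_root b\<close> is rescaled by \<open>\<lambda>\<close>, for all \<open>b \<ge> 1\<close>
  alike; this makes the quantities for different orders \<open>b\<close> comparable.\<close>

definition jet_root :: "nat \<Rightarrow> real \<Rightarrow> real" where "jet_root b t = root b (cmod (g b t))"

definition jet_integral :: "nat \<Rightarrow> nat \<Rightarrow> real" where "jet_integral N b = integral {0..T} (\<lambda>t. jet_root b t ^ (2 * N))"

lemma continuous_on_g: "continuous_on S (g n)"
  by (rule continuous_at_imp_continuous_on) (use deriv in \<open>blast intro: has_vector_derivative_continuous\<close>)

lemma jet_root_nonneg [simp]: "jet_root b t \<ge> 0" by (cases "b = 0") (auto simp: jet_root_def)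

lemma jet_root_power: "b \<ge> 1 \<Longrightarrow> jet_root b t ^ b = cmod (g b t)"
  by (simp add: jet_root_def)

lemma continuous_on_jet_root: "continuous_on S (jet_root b)"
  unfolding jet_root_def[abs_def] by (intro continuous_on_real_root continuous_on_norm continuous_on_g)

lemma jet_root_powr:
  assumes "b \<ge> 1" "n > 0"
  shows "cmod (g b t) powr (real n / real b) = jet_root b t ^ n"
proof (cases "jet_root b t = 0")
  case False
  then have pos: "jet_root b t > 0" using jet_root_nonneg[of b t] by linarith
  have "cmod (g b t) = jet_root b t powr real b"
    using jet_root_power[OF assms(1)] powr_realpow[OF pos] by simp
  then have "cmod (g b t) powr (real n / real b) = jet_root b t powr real n"
    using assms by (simp add: powr_powr)
  also have "\<dots> = jet_root b t ^ n" by (rule powr_realpow[OF pos])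
  finally show ?thesis .
next
  case True
  then have "cmod (g b t) = 0" using assms(1) by (simp add: jet_root_def)
  then show ?thesis using True assms by simp
qed

lemma jet_integral_nonneg: "jet_integral N b \<ge> 0"
  unfolding jet_integral_def by (rule integral_nonneg) (auto intro!: integrable_continuous_real continuous_intros continuous_on_jet_root)

lemma has_integral_jet_integral: "((\<lambda>t. jet_root b t ^ (2 * N)) has_integral jet_integral N b) {0..T}"
  unfolding jet_integral_def
  by (intro integrable_integral integrable_continuous_real continuous_intros continuous_on_jet_root)

lemma integrable_product:
  "(\<lambda>t. c * (cmod (g i t) * jet_root j t ^ m * jet_root k t ^ n)) integrable_on {0..T}"
  by (intro integrable_continuous_real continuous_intros continuous_on_g continuous_on_jet_root)

text \<open>Here \<open>s\<close> is chosen such that \<open>\<bar>g b\<bar> powr (s + 2)\<close> is \<open>jet_root b ^ (2 * N)\<close>.\<close>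

lemma jet_integral_by_parts:
  assumes b: "1 \<le> b" "b < N"
  shows "jet_integral N b \<le> integral {0..T} (\<lambda>t. real (2 * N) * (cmod (g (b - 1) t) * jet_root b t ^ (2 * N - 2 * b) * jet_root (b + 1) t ^ (b + 1)))"
proof -
  define s where "s = real (2 * N - 2 * b) / real b"
  have s: "s > 0" using b by (simp add: s_def)
  have s2: "s + 2 = real (2 * N) / real b" using b by (simp add: s_def field_simps of_nat_diff)
  have le: "1 + s \<le> real (2 * N)"
  proof -
    have "s + 2 \<le> real (2 * N)" unfolding s2 using b by (simp add: divide_le_eq)
    then show ?thesis by simp
  qed
  have "jet_integral N b = integral {0..T} (\<lambda>t. cmod (g b t) powr (s + 2))"
    unfolding jet_integral_def s2 using b by (subst jet_root_powr) auto
  also have "\<dots> \<le> integral {0..T} (\<lambda>t. (1 + s) * (cmod (g (b - 1) t) * cmod (g b t) powr s * cmod (g (b + 1) t)))"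
    using deriv[of "b - 1"] deriv[of b] b
    by (intro integral_by_parts_power periodic s T continuous_on_g) auto
  also have "\<dots> \<le> integral {0..T} (\<lambda>t. real (2 * N) * (cmod (g (b - 1) t) * jet_root b t ^ (2 * N - 2 * b) * jet_root (b + 1) t ^ (b + 1)))"
  proof (rule integral_le)
    show "(\<lambda>t. (1 + s) * (cmod (g (b - 1) t) * cmod (g b t) powr s * cmod (g (b + 1) t))) integrable_on {0..T}"
      by (intro integrable_continuous_real continuous_on_powr' continuous_intros continuous_on_g) (use s in auto)
    show "(\<lambda>t. real (2 * N) * (cmod (g (b - 1) t) * jet_root b t ^ (2 * N - 2 * b) * jet_root (b + 1) t ^ (b + 1))) integrable_on {0..T}"
      by (intro integrable_continuous_real continuous_intros continuous_on_g continuous_on_jet_root)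
    fix t
    have "cmod (g b t) powr s = jet_root b t ^ (2 * N - 2 * b)" unfolding s_def using b by (intro jet_root_powr) auto
    then show "(1 + s) * (cmod (g (b - 1) t) * cmod (g b t) powr s * cmod (g (b + 1) t))
      \<le> real (2 * N) * (cmod (g (b - 1) t) * jet_root b t ^ (2 * N - 2 * b) * jet_root (b + 1) t ^ (b + 1))"
      using jet_root_power[of "b + 1" t] mult_right_mono[OF le, of "cmod (g (b - 1) t) * jet_root b t ^ (2 * N - 2 * b) * jet_root (b + 1) t ^ (b + 1)"]
      by simp
  qed
  finally show ?thesis .
qed

end

text \<open>Integration by parts bounds \<open>jet_integral N b\<close> by an integral of a product of the orders
  \<open>b - 1\<close>, \<open>b\<close> and \<open>b + 1\<close>, and \<open>weighted_product_bound\<close> splits that product into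
  \<open>\<delta> * jet_integral N (b - 1) + jet_integral N b / 4 + K * jet_integral N (b + 1)\<close>. Since the
  induction hypothesis bounds \<open>jet_integral N (b - 1)\<close> by a multiple of \<open>jet_integral N b\<close>, the
  first two terms can be absorbed in the left-hand side. The induction starts at \<open>b = 1\<close>, where
  the order \<open>0\<close> factor is simply bounded by \<open>B\<close>. The constant depends on \<open>N\<close>, \<open>b\<close> and \<open>B\<close> only.\<close>

lemma jet_integral_step:
  assumes "1 \<le> b" "b < N"
  shows "\<exists>K\<ge>0. \<forall>g T. periodic_jet g T B \<longrightarrow> periodic_jet.jet_integral g T N b \<le> K * periodic_jet.jet_integral g T N (b + 1)"
  using assms
proof (induction b rule: nat_induct_at_least)
  case base
  \<comment> \<open>used with \<open>x = 0\<close>, which disappears because its exponent is \<open>0\<close>\<close>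
  have "\<exists>K\<ge>0. \<forall>x\<ge>0. \<forall>y\<ge>0. \<forall>z\<ge>0. (real (2 * N) * max 0 B) * (x ^ (1 - 1) * y ^ (2 * N - 2 * 1) * z ^ (1 + 1))
     \<le> 1 * x ^ (2 * N) + y ^ (2 * N) / 4 + K * z ^ (2 * N)"
    by (rule weighted_product_bound[of 1 N "real (2 * N) * max 0 B" 1])
       (use base in simp_all)
  then obtain K where K: "K \<ge> 0" "\<And>x y z. x \<ge> 0 \<Longrightarrow> y \<ge> 0 \<Longrightarrow> z \<ge> 0 \<Longrightarrow>
     (real (2 * N) * max 0 B) * (x ^ (1 - 1) * y ^ (2 * N - 2 * 1) * z ^ (1 + 1)) \<le> 1 * x ^ (2 * N) + y ^ (2 * N) / 4 + K * z ^ (2 * N)"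
    by blast
  show ?case
  proof (rule exI[of _ "2 * K"], intro conjI allI impI)
    fix g T assume "periodic_jet g T B"
    then interpret periodic_jet g T B .
    have "jet_integral N 1 \<le> integral {0..T} (\<lambda>t. real (2 * N) * (cmod (g (1 - 1) t) * jet_root 1 t ^ (2 * N - 2 * 1) * jet_root (1 + 1) t ^ (1 + 1)))"
      by (rule jet_integral_by_parts) (use base in auto)
    also have "\<dots> \<le> jet_integral N 1 / 4 + K * jet_integral N 2"
    proof (rule has_integral_le)
      show "((\<lambda>t. real (2 * N) * (cmod (g (1 - 1) t) * jet_root 1 t ^ (2 * N - 2 * 1) * jet_root (1 + 1) t ^ (1 + 1)))
        has_integral integral {0..T} (\<lambda>t. real (2 * N) * (cmod (g (1 - 1) t) * jet_root 1 t ^ (2 * N - 2 * 1) * jet_root (1 + 1) t ^ (1 + 1)))) {0..T}"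
        by (rule integrable_integral[OF integrable_product])
      show "((\<lambda>t. jet_root 1 t ^ (2 * N) / 4 + K * jet_root 2 t ^ (2 * N)) has_integral jet_integral N 1 / 4 + K * jet_integral N 2) {0..T}"
        by (intro has_integral_add has_integral_mult_right has_integral_divide has_integral_jet_integral)
      fix t
      have "real (2 * N) * (cmod (g (1 - 1) t) * jet_root 1 t ^ (2 * N - 2 * 1) * jet_root (1 + 1) t ^ (1 + 1))
        \<le> real (2 * N) * (max 0 B * jet_root 1 t ^ (2 * N - 2 * 1) * jet_root (1 + 1) t ^ (1 + 1))"
        using bounded[of t] by (intro mult_left_mono mult_right_mono) auto
      also have "\<dots> = (real (2 * N) * max 0 B) * (0 ^ (1 - 1) * jet_root 1 t ^ (2 * N - 2 * 1) * jet_root (1 + 1) t ^ (1 + 1))"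
        by simp
      also have "\<dots> \<le> 1 * 0 ^ (2 * N) + jet_root 1 t ^ (2 * N) / 4 + K * jet_root (1 + 1) t ^ (2 * N)"
        by (rule K(2)) auto
      also have "\<dots> = jet_root 1 t ^ (2 * N) / 4 + K * jet_root 2 t ^ (2 * N)"
        using base by (simp add: numeral_2_eq_2)
      finally show "real (2 * N) * (cmod (g (1 - 1) t) * jet_root 1 t ^ (2 * N - 2 * 1) * jet_root (1 + 1) t ^ (1 + 1))
        \<le> jet_root 1 t ^ (2 * N) / 4 + K * jet_root 2 t ^ (2 * N)" .
    qed
    finally show "jet_integral N 1 \<le> 2 * K * jet_integral N (1 + 1)" using jet_integral_nonneg[of N 1] mult_nonneg_nonneg[OF K(1) jet_integral_nonneg[of N 2]]
      by (simp add: numeral_2_eq_2)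
  qed (use K in auto)
next
  case (Suc b)
  obtain L where L: "L \<ge> 0" "\<And>g T. periodic_jet g T B \<Longrightarrow> periodic_jet.jet_integral g T N b \<le> L * periodic_jet.jet_integral g T N (Suc b)"
    using Suc.IH Suc.prems by auto
  \<comment> \<open>so that \<open>\<delta> * jet_integral N b\<close> is at most a quarter of \<open>jet_integral N (Suc b)\<close>\<close>
  define \<delta> where "\<delta> = 1 / (4 * (L + 1))"
  have \<delta>: "\<delta> > 0" "\<delta> * L \<le> 1 / 4" using L by (auto simp: \<delta>_def field_simps)
  have "\<exists>K\<ge>0. \<forall>x\<ge>0. \<forall>y\<ge>0. \<forall>z\<ge>0. real (2 * N) * (x ^ (Suc b - 1) * y ^ (2 * N - 2 * Suc b) * z ^ (Suc b + 1))
     \<le> \<delta> * x ^ (2 * N) + y ^ (2 * N) / 4 + K * z ^ (2 * N)"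
    by (rule weighted_product_bound[of "Suc b" N "real (2 * N)" \<delta>])
       (use Suc.prems \<delta> in simp_all)
  then obtain K where K: "K \<ge> 0" "\<And>x y z. x \<ge> 0 \<Longrightarrow> y \<ge> 0 \<Longrightarrow> z \<ge> 0 \<Longrightarrow>
     real (2 * N) * (x ^ (Suc b - 1) * y ^ (2 * N - 2 * Suc b) * z ^ (Suc b + 1)) \<le> \<delta> * x ^ (2 * N) + y ^ (2 * N) / 4 + K * z ^ (2 * N)"
    by blast
  show ?case
  proof (rule exI[of _ "2 * K"], intro conjI allI impI)
    fix g T assume pj: "periodic_jet g T B"
    then interpret periodic_jet g T B .
    have "jet_integral N (Suc b) \<le> integral {0..T} (\<lambda>t. real (2 * N) * (cmod (g (Suc b - 1) t) * jet_root (Suc b) t ^ (2 * N - 2 * Suc b) * jet_root (Suc b + 1) t ^ (Suc b + 1)))"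
      by (rule jet_integral_by_parts) (use Suc.prems in auto)
    also have "\<dots> \<le> \<delta> * jet_integral N b + jet_integral N (Suc b) / 4 + K * jet_integral N (Suc b + 1)"
    proof (rule has_integral_le)
      show "((\<lambda>t. real (2 * N) * (cmod (g (Suc b - 1) t) * jet_root (Suc b) t ^ (2 * N - 2 * Suc b) * jet_root (Suc b + 1) t ^ (Suc b + 1)))
        has_integral integral {0..T} (\<lambda>t. real (2 * N) * (cmod (g (Suc b - 1) t) * jet_root (Suc b) t ^ (2 * N - 2 * Suc b) * jet_root (Suc b + 1) t ^ (Suc b + 1)))) {0..T}"
        by (rule integrable_integral[OF integrable_product])
      show "((\<lambda>t. \<delta> * jet_root b t ^ (2 * N) + jet_root (Suc b) t ^ (2 * N) / 4 + K * jet_root (Suc b + 1) t ^ (2 * N))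
        has_integral \<delta> * jet_integral N b + jet_integral N (Suc b) / 4 + K * jet_integral N (Suc b + 1)) {0..T}"
        by (intro has_integral_add has_integral_mult_right has_integral_divide has_integral_jet_integral)
      fix t
      show "real (2 * N) * (cmod (g (Suc b - 1) t) * jet_root (Suc b) t ^ (2 * N - 2 * Suc b) * jet_root (Suc b + 1) t ^ (Suc b + 1))
        \<le> \<delta> * jet_root b t ^ (2 * N) + jet_root (Suc b) t ^ (2 * N) / 4 + K * jet_root (Suc b + 1) t ^ (2 * N)"
        using K(2)[of "jet_root b t" "jet_root (Suc b) t" "jet_root (Suc b + 1) t"] jet_root_power[OF Suc.hyps, of t] by simp
    qed
    finally have 1: "jet_integral N (Suc b) \<le> \<delta> * jet_integral N b + jet_integral N (Suc b) / 4 + K * jet_integral N (Suc b + 1)" .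
    have "\<delta> * jet_integral N b \<le> \<delta> * (L * jet_integral N (Suc b))" using L(2)[OF pj] \<delta> by (intro mult_left_mono) auto
    also have "\<dots> = (\<delta> * L) * jet_integral N (Suc b)" by simp
    also have "\<dots> \<le> 1 / 4 * jet_integral N (Suc b)" by (rule mult_right_mono[OF \<delta>(2) jet_integral_nonneg])
    finally have "jet_integral N (Suc b) / 2 \<le> K * jet_integral N (Suc b + 1)" using 1 by linarith
    then show "jet_integral N (Suc b) \<le> 2 * K * jet_integral N (Suc b + 1)" by linarith
  qed (use K in auto)
qed

text \<open>Iterating \<open>jet_integral_step\<close> upwards from \<open>b\<close> to \<open>N\<close>. This is the Gagliardo--Nirenberg
  inequality: for a bounded periodic function, the \<open>b\<close>-th derivative lies in \<open>L\<^sup>p\<close> with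
  \<open>p = 2 * N / b\<close> as soon as the \<open>N\<close>-th derivative lies in \<open>L\<^sup>2\<close>.\<close>

lemma Gagliardo_Nirenberg_periodic:
  assumes "1 \<le> b" "b \<le> N"
  shows "\<exists>K\<ge>0. \<forall>g T. periodic_jet g T B \<longrightarrow>
    integral {0..T} (\<lambda>t. root b (cmod (g b t)) ^ (2 * N)) \<le> K * integral {0..T} (\<lambda>t. (cmod (g N t))\<^sup>2)"
proof -
  have "\<exists>K\<ge>0. \<forall>g T. periodic_jet g T B \<longrightarrow> periodic_jet.jet_integral g T N b \<le> K * periodic_jet.jet_integral g T N N"
    using assms(2,1)
  proof (induction rule: inc_induct)
    case base
    then show ?case by (intro exI[of _ 1]) auto
  next
    case (step n)
    then obtain K L where K: "K \<ge> 0" "\<And>g T. periodic_jet g T B \<Longrightarrow> periodic_jet.jet_integral g T N (Suc n) \<le> K * periodic_jet.jet_integral g T N N"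
      and L: "L \<ge> 0" "\<And>g T. periodic_jet g T B \<Longrightarrow> periodic_jet.jet_integral g T N n \<le> L * periodic_jet.jet_integral g T N (Suc n)"
      using jet_integral_step[of n N B] by auto
    show ?case
    proof (intro exI[of _ "L * K"] conjI allI impI)
      fix g T assume pj: "periodic_jet g T B"
      have "periodic_jet.jet_integral g T N n \<le> L * periodic_jet.jet_integral g T N (Suc n)" by (rule L(2)[OF pj])
      also have "\<dots> \<le> L * (K * periodic_jet.jet_integral g T N N)" by (intro mult_left_mono K(2) pj L)
      finally show "periodic_jet.jet_integral g T N n \<le> L * K * periodic_jet.jet_integral g T N N" by simp
    qed (use K L in auto)
  qed
  then obtain K where K: "K \<ge> 0" "\<And>g T. periodic_jet g T B \<Longrightarrow> periodic_jet.jet_integral g T N b \<le> K * periodic_jet.jet_integral g T N N"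
    by auto
  show ?thesis
  proof (intro exI[of _ K] conjI allI impI K(1))
    fix g T assume pj: "periodic_jet g T B"
    then interpret periodic_jet g T B .
    have "jet_root N t ^ (2 * N) = (cmod (g N t))\<^sup>2" for t
      using assms jet_root_power[of N t] by (simp add: mult.commute[of 2] power_mult)
    then show "integral {0..T} (\<lambda>t. root b (cmod (g b t)) ^ (2 * N)) \<le> K * integral {0..T} (\<lambda>t. (cmod (g N t))\<^sup>2)"
      using K(2)[OF pj] by (simp add: jet_integral_def jet_root_def)
  qed
qed

section \<open>Square means over circles\<close>

lemma integral_periodic_shift:
  fixes h :: "real \<Rightarrow> 'a::banach"
  assumes h: "continuous_on UNIV h" and per: "\<And>x. h (x + P) = h x" and a: "0 \<le> a" "a \<le> P"
  shows "integral {0..P} (\<lambda>x. h (x + a)) = integral {0..P} h"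
proof -
  have int: "h integrable_on {x..y}" for x y
    by (intro integrable_continuous_real continuous_on_subset[OF h]) auto
  have shift: "integral {x..y} (\<lambda>t. h (t + c)) = integral {x+c..y+c} h" for x y c
    using integral_shift_Icc_real[of x y h c] by (simp add: o_def add.commute)
  have "integral {0..P} (\<lambda>x. h (x + a)) = integral {a..P+a} h" using shift[of 0 P a] by simp
  also have "\<dots> = integral {a..P} h + integral {P..P+a} h"
    using a by (intro Henstock_Kurzweil_Integration.integral_combine[symmetric] int) auto
  also have "integral {P..P+a} h = integral {0..a} h"
    using shift[of 0 a P] by (simp add: per add.commute)
  also have "integral {a..P} h + integral {0..a} h = integral {0..P} h"
    using a by (subst add.commute) (intro Henstock_Kurzweil_Integration.integral_combine int, auto)
  finally show ?thesis .
qed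

text \<open>The correlation \<open>p l\<close> of \<open>g\<close> on the circle of radius \<open>\<bar>l\<bar>\<close> with \<open>g\<close> on the circle of radius \<open>r\<close>
  is holomorphic in \<open>l\<close>. For \<open>\<bar>l\<bar> = 1\<close> it is at most the average of the two square means, so by
  the maximum principle this also bounds its value at \<open>l = r\<close>, which is the square mean for radius
  \<open>r\<close> itself; this forces the latter to be the smaller one.\<close>

lemma circle_mean_square_mono:
  fixes r R :: real
  assumes g: "g holomorphic_on ball 0 R" and R: "R > 1" and r: "0 \<le> r" "r \<le> 1"
  shows "integral {0..2*pi} (\<lambda>\<theta>. (cmod (g (r * cis \<theta>)))\<^sup>2) \<le> integral {0..2*pi} (\<lambda>\<theta>. (cmod (g (cis \<theta>)))\<^sup>2)"
proof -
  define I where "I = (\<lambda>r. integral {0..2*pi} (\<lambda>\<theta>. (cmod (g (complex_of_real r * cis \<theta>)))\<^sup>2))"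
  \<comment> \<open>the correlation; only its first factor depends on \<open>l\<close>\<close>
  define p where "p = (\<lambda>l. integral (cbox 0 (2*pi)) (\<lambda>\<theta>. g (l * cis \<theta>) * cnj (g (r * cis \<theta>))))"
  have cg: "continuous_on (ball 0 R) g" using g by (rule holomorphic_on_imp_continuous_on)
  have cg': "continuous_on (ball 0 R) (deriv g)"
    by (intro holomorphic_on_imp_continuous_on holomorphic_deriv g) auto
  have in_ball: "l * cis \<theta> \<in> ball 0 R" if "cmod l < R" for l \<theta> using that by (simp add: norm_mult)
  have cont1: "continuous_on S (\<lambda>\<theta>. g (l * cis \<theta>))" if "cmod l < R" for l S
    by (rule continuous_on_compose2[OF cg]) (use in_ball that in \<open>auto intro!: continuous_intros\<close>)
  have rR: "cmod (of_real r) < R" using r R by simp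
  have cont2: "continuous_on (ball 0 R \<times> cbox 0 (2*pi)) (\<lambda>(x, t). deriv g (x * cis t) * cis t * cnj (g (r * cis t)))"
    unfolding split_beta
  proof (intro continuous_on_mult continuous_on_cnj)
    show "continuous_on (ball 0 R \<times> cbox 0 (2*pi)) (\<lambda>x. deriv g (fst x * cis (snd x)))"
      by (rule continuous_on_compose2[OF cg']) (use in_ball in \<open>auto intro!: continuous_intros\<close>)
    show "continuous_on (ball 0 R \<times> cbox 0 (2*pi)) (\<lambda>x. g (of_real r * cis (snd x)))"
      by (rule continuous_on_compose2[OF cg]) (use in_ball rR in \<open>auto intro!: continuous_intros\<close>)
  qed (intro continuous_intros)
  have hol: "p holomorphic_on ball 0 R"
    unfolding p_def
  proof (rule leibniz_rule_holomorphic[where fx = "\<lambda>x t. deriv g (x * cis t) * cis t * cnj (g (r * cis t))"])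
    fix x t assume x: "x \<in> ball (0::complex) R"
    then have "x * cis t \<in> ball 0 R" using in_ball by auto
    then have "(g has_field_derivative deriv g (x * cis t)) (at (x * cis t))"
      using g holomorphic_derivI by blast
    moreover have "((\<lambda>x. x * cis t) has_field_derivative 1 * cis t) (at x)"
      by (rule DERIV_cmult_right[OF DERIV_ident])
    ultimately have "((\<lambda>x. g (x * cis t)) has_field_derivative deriv g (x * cis t) * (1 * cis t)) (at x)"
      by (rule DERIV_chain2)
    from has_field_derivative_at_within[OF DERIV_cmult_right[OF this, of "cnj (g (r * cis t))"]]
    show "((\<lambda>x. g (x * cis t) * cnj (g (r * cis t))) has_field_derivative
        deriv g (x * cis t) * cis t * cnj (g (r * cis t))) (at x within ball 0 R)"
      by simp
  next
    fix x assume "x \<in> ball (0::complex) R"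
    then show "(\<lambda>\<theta>. g (x * cis \<theta>) * cnj (g (r * cis \<theta>))) integrable_on cbox 0 (2*pi)"
      using rR by (intro integrable_continuous continuous_intros cont1) auto
  qed (use cont2 in auto)
  have sq: "((\<lambda>\<theta>. (cmod (g (of_real r * cis \<theta>)))\<^sup>2) has_integral I r) {0..2*pi}"
    unfolding I_def using rR by (intro integrable_integral integrable_continuous_real continuous_intros cont1)
  \<comment> \<open>arithmetic and geometric mean; rotating the circle by \<open>l\<close> does not change the integral \<open>I 1\<close>\<close>
  have bd: "cmod (p l) \<le> (I 1 + I r) / 2" if l: "cmod l = 1" for l
  proof -
    define a where "a = Arg2pi l"
    have a: "0 \<le> a" "a \<le> 2*pi" "l = cis a" using l Arg2pi[of l] by (auto simp: a_def cis_conv_exp is_Arg_def)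
    have per: "(cmod (g (cis (x + 2*pi))))\<^sup>2 = (cmod (g (cis x)))\<^sup>2" for x by (simp add: cis_mult[symmetric])
    have cont: "continuous_on UNIV (\<lambda>\<theta>. (cmod (g (cis \<theta>)))\<^sup>2)" using cont1[of 1 UNIV] R by (auto intro!: continuous_intros)
    have "integral {0..2*pi} (\<lambda>\<theta>. (cmod (g (l * cis \<theta>)))\<^sup>2) = integral {0..2*pi} (\<lambda>\<theta>. (cmod (g (cis (\<theta> + a))))\<^sup>2)"
      by (simp add: a cis_mult add.commute)
    also have "\<dots> = I 1" unfolding I_def using integral_periodic_shift[OF cont per a(1,2)] by simp
    finally have "integral {0..2*pi} (\<lambda>\<theta>. (cmod (g (l * cis \<theta>)))\<^sup>2) = I 1" .
    moreover have "(\<lambda>\<theta>. (cmod (g (l * cis \<theta>)))\<^sup>2) integrable_on {0..2*pi}"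
      using l R by (intro integrable_continuous_real continuous_intros cont1) auto
    ultimately have sq1: "((\<lambda>\<theta>. (cmod (g (l * cis \<theta>)))\<^sup>2) has_integral I 1) {0..2*pi}"
      by (metis integrable_integral)
    show ?thesis unfolding p_def box_real
    proof (rule order_trans[OF integral_norm_bound_integral])
      show "(\<lambda>\<theta>. g (l * cis \<theta>) * cnj (g (r * cis \<theta>))) integrable_on {0..2*pi}"
        using l R rR by (intro integrable_continuous_real continuous_intros cont1) auto
      have "((\<lambda>\<theta>. ((cmod (g (l * cis \<theta>)))\<^sup>2 + (cmod (g (r * cis \<theta>)))\<^sup>2) / 2) has_integral (I 1 + I r) / 2) {0..2*pi}"
        by (intro has_integral_divide has_integral_add sq sq1)
      note int = this
      show "(\<lambda>\<theta>. ((cmod (g (l * cis \<theta>)))\<^sup>2 + (cmod (g (r * cis \<theta>)))\<^sup>2) / 2) integrable_on {0..2*pi}"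
        "integral {0..2*pi} (\<lambda>\<theta>. ((cmod (g (l * cis \<theta>)))\<^sup>2 + (cmod (g (r * cis \<theta>)))\<^sup>2) / 2) \<le> (I 1 + I r) / 2"
        using int by (auto simp only: integral_unique[OF int] order_refl)
      fix \<theta>
      show "cmod (g (l * cis \<theta>) * cnj (g (r * cis \<theta>))) \<le> ((cmod (g (l * cis \<theta>)))\<^sup>2 + (cmod (g (r * cis \<theta>)))\<^sup>2) / 2"
        using sum_squares_bound[of "cmod (g (l * cis \<theta>))" "cmod (g (r * cis \<theta>))"] by (simp add: norm_mult)
    qed
  qed
  have "cmod (p (of_real r)) \<le> (I 1 + I r) / 2"
  proof (rule maximum_modulus_frontier[where S = "cball 0 1" and f = p])
    have sub: "cball 0 1 \<subseteq> ball (0::complex) R" using R by auto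
    show "p holomorphic_on interior (cball 0 1)"
      by (rule holomorphic_on_subset[OF hol]) (use sub in auto)
    show "continuous_on (closure (cball 0 1)) p"
      using holomorphic_on_imp_continuous_on[OF hol] sub by (auto intro: continuous_on_subset)
  qed (use bd r in auto)
  moreover have "p (of_real r) = of_real (I r)"
    unfolding p_def box_real complex_norm_square[symmetric]
    by (rule integral_unique) (rule has_integral_of_real[OF sq])
  moreover have "I r \<ge> 0" using sq by (rule has_integral_nonneg) simp
  ultimately have "I r \<le> I 1" by simp
  then show ?thesis by (simp add: I_def)
qed

section \<open>Rotation invariant measures and means over spheres\<close>

lemma orthogonal_transformation_cis: "orthogonal_transformation (\<lambda>z :: complex ^ 'd. cis \<theta> *s z)"
  unfolding orthogonal_transformation
  by (auto simp: norm_vector_smult intro!: bounded_linear.linear[OF bounded_linear_smult_left])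

lemma borel_measurable_smult [measurable]: "(\<lambda>z :: complex ^ 'd. c *s z) \<in> borel_measurable borel"
  by (intro borel_measurable_continuous_onI continuous_intros)

definition rotation_invariant :: "(complex ^ 'd) measure \<Rightarrow> bool" where
  "rotation_invariant M \<longleftrightarrow> sets M = sets borel \<and> sigma_finite_measure M \<and> (\<forall>\<theta>. distr M borel (\<lambda>z. cis \<theta> *s z) = M)"

lemma rotation_invariant_lborel: "rotation_invariant lborel"
  unfolding rotation_invariant_def
  using lborel_distr_orthogonal[OF orthogonal_transformation_cis] lborel.sigma_finite_measure_axioms by auto

lemma sets_sphere_measure [measurable_cong, simp]: "sets sphere_measure = sets borel"
  by (simp add: sphere_measure_def)

lemma space_sphere_measure [simp]: "space sphere_measure = UNIV"
  by (simp add: sphere_measure_def)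

lemma finite_measure_sphere_measure: "finite_measure (sphere_measure :: 'a::euclidean_space measure)"
  by (rule finite_measureI) (simp add: emeasure_sphere_measure_UNIV)

lemma rotation_invariant_sphere_measure: "rotation_invariant sphere_measure"
proof -
  interpret finite_measure "sphere_measure :: (complex ^ 'd) measure" by (rule finite_measure_sphere_measure)
  show ?thesis unfolding rotation_invariant_def
    using sphere_measure_orthogonal_invariant[OF orthogonal_transformation_cis] sigma_finite_measure_axioms by auto
qed

text \<open>The transfer principle for everything below that is proved on circles: by invariance, an
  integral over \<open>M\<close> equals the integral over \<open>M\<close> of the averages over the circles \<open>cis \<theta> *s z\<close>.\<close>

lemma rotation_invariant_compare:
  fixes a b :: "complex ^ 'd \<Rightarrow> ennreal"
  assumes M: "rotation_invariant M" and a [measurable]: "a \<in> borel_measurable borel" and b [measurable]: "b \<in> borel_measurable borel"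
    and le: "\<And>z. (\<integral>\<^sup>+\<theta>\<in>{0..2*pi}. a (cis \<theta> *s z) \<partial>lborel) \<le> C * (\<integral>\<^sup>+\<theta>\<in>{0..2*pi}. b (cis \<theta> *s z) \<partial>lborel)"
  shows "(\<integral>\<^sup>+z. a z \<partial>M) \<le> C * (\<integral>\<^sup>+z. b z \<partial>M)"
proof -
  have [measurable_cong, simp]: "sets M = sets borel" and inv: "\<And>\<theta>. distr M borel (\<lambda>z. cis \<theta> *s z) = M"
    using M by (auto simp: rotation_invariant_def)
  interpret sigma_finite_measure M using M by (simp add: rotation_invariant_def)
  interpret P: pair_sigma_finite M lborel
    by (simp add: pair_sigma_finite_def sigma_finite_lborel sigma_finite_measure_axioms)
  have [measurable]: "(\<lambda>x :: (complex ^ 'd) \<times> real. cis (snd x) *s fst x) \<in> borel_measurable (borel \<Otimes>\<^sub>M borel)"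
    by (subst borel_prod) (intro borel_measurable_continuous_onI continuous_intros)
  have avg: "(\<integral>\<^sup>+z. (\<integral>\<^sup>+\<theta>\<in>{0..2*pi}. f (cis \<theta> *s z) \<partial>lborel) \<partial>M) = ennreal (2*pi) * (\<integral>\<^sup>+z. f z \<partial>M)"
    if [measurable]: "f \<in> borel_measurable borel" for f :: "complex ^ 'd \<Rightarrow> ennreal"
  proof -
    have "(\<integral>\<^sup>+z. (\<integral>\<^sup>+\<theta>\<in>{0..2*pi}. f (cis \<theta> *s z) \<partial>lborel) \<partial>M)
      = (\<integral>\<^sup>+\<theta>. (\<integral>\<^sup>+z. f (cis \<theta> *s z) * indicator {0..2*pi} \<theta> \<partial>M) \<partial>lborel)"
    proof (rule P.Fubini'[symmetric])
      have "(\<lambda>x. f (cis (snd x) *s fst x) * indicator {0..2*pi} (snd x)) \<in> borel_measurable (borel \<Otimes>\<^sub>M borel)"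
        by measurable
      then show "(\<lambda>(x, y). f (cis y *s x) * indicator {0..2*pi} y) \<in> borel_measurable (M \<Otimes>\<^sub>M lborel)"
        by (simp add: split_beta cong: measurable_cong_sets sets_pair_measure_cong)
    qed
    also have "\<dots> = (\<integral>\<^sup>+\<theta>. (\<integral>\<^sup>+z. f z \<partial>M) * indicator {0..2*pi} \<theta> \<partial>lborel)"
    proof (rule nn_integral_cong)
      fix \<theta>
      have "(\<integral>\<^sup>+z. f (cis \<theta> *s z) \<partial>M) = (\<integral>\<^sup>+z. f z \<partial>distr M borel (\<lambda>z. cis \<theta> *s z))"
        by (subst nn_integral_distr) auto
      then show "(\<integral>\<^sup>+z. f (cis \<theta> *s z) * indicator {0..2*pi} \<theta> \<partial>M) = (\<integral>\<^sup>+z. f z \<partial>M) * indicator {0..2*pi} \<theta>"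
        by (simp add: nn_integral_multc inv)
    qed
    also have "\<dots> = (\<integral>\<^sup>+z. f z \<partial>M) * ennreal (2*pi)"
      by (subst nn_integral_cmult_indicator) auto
    finally show ?thesis by (simp add: mult.commute)
  qed
  have [measurable]: "(\<lambda>z. \<integral>\<^sup>+\<theta>\<in>{0..2*pi}. b (cis \<theta> *s z) \<partial>lborel) \<in> borel_measurable M"
  proof -
    have "(\<lambda>x. b (cis (snd x) *s fst x) * indicator {0..2*pi} (snd x)) \<in> borel_measurable (borel \<Otimes>\<^sub>M borel)"
      by measurable
    then have "(\<lambda>(x, y). b (cis y *s x) * indicator {0..2*pi} y) \<in> borel_measurable (M \<Otimes>\<^sub>M lborel)"
      by (simp add: split_beta cong: measurable_cong_sets sets_pair_measure_cong)
    then show ?thesis by (rule lborel.borel_measurable_nn_integral)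
  qed
  have "ennreal (2*pi) * (\<integral>\<^sup>+z. a z \<partial>M) \<le> (\<integral>\<^sup>+z. C * (\<integral>\<^sup>+\<theta>\<in>{0..2*pi}. b (cis \<theta> *s z) \<partial>lborel) \<partial>M)"
    unfolding avg[OF a, symmetric] by (intro nn_integral_mono le)
  also have "\<dots> = C * (ennreal (2*pi) * (\<integral>\<^sup>+z. b z \<partial>M))"
    by (subst nn_integral_cmult) (auto simp: avg[OF b])
  also have "\<dots> = ennreal (2*pi) * (C * (\<integral>\<^sup>+z. b z \<partial>M))" by (simp add: mult_ac)
  finally show ?thesis
    by (subst (asm) ennreal_mult_le_mult_iff) auto
qed

lemma AE_sphere_measure: "AE w in (sphere_measure :: 'a::euclidean_space measure). norm w = 1"
proof (rule AE_I[where N = "- sphere 0 1"])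
  interpret finite_measure "sphere_measure :: 'a measure" by (rule finite_measure_sphere_measure)
  show "emeasure (sphere_measure :: 'a measure) (- sphere 0 1) = 0"
    using emeasure_compl[of "sphere 0 1" "sphere_measure :: 'a measure"]
    by (simp add: emeasure_sphere_measure_UNIV emeasure_sphere_measure_sphere Compl_eq_Diff_UNIV)
qed auto

text \<open>The cut-off to the ball makes the integrand Borel measurable for every \<open>t\<close> whenever \<open>A\<close> is
  continuous on the ball. For \<open>\<bar>t\<bar> < 1\<close> it does not change the value; for \<open>t = 1\<close> the value is
  \<open>0\<close>, which accounts for the integral in \<open>L2_norm2\<close> extending over the open ball only.\<close>

definition smean :: "(complex ^ 'd \<Rightarrow> real) \<Rightarrow> real \<Rightarrow> ennreal" where
  "smean A t = (\<integral>\<^sup>+w. ennreal (indicator uball (t *\<^sub>R w) * A (t *\<^sub>R w)) \<partial>sphere_measure)"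

abbreviation sq_mean :: "(complex ^ 'd \<Rightarrow> complex) \<Rightarrow> real \<Rightarrow> ennreal" where
  "sq_mean F \<equiv> smean (\<lambda>z. (cmod (F z))\<^sup>2)"

lemma borel_measurable_cutoff:
  assumes "continuous_on uball A"
  shows "(\<lambda>z :: complex ^ 'd. indicator uball z * A z :: real) \<in> borel_measurable borel"
  using borel_measurable_continuous_on_indicator[OF _ assms] by simp

lemma borel_measurable_cutoff_scaleR:
  assumes "continuous_on uball A"
  shows "(\<lambda>w :: complex ^ 'd. indicator uball (t *\<^sub>R w) * A (t *\<^sub>R w) :: real) \<in> borel_measurable borel"
  by (rule measurable_compose[OF _ borel_measurable_cutoff[OF assms], of "\<lambda>w. t *\<^sub>R w"]) measurable

lemma borel_measurable_cutoff_sphere: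
  assumes "continuous_on uball A"
  shows "(\<lambda>w :: complex ^ 'd. ennreal (indicator uball (t *\<^sub>R w) * A (t *\<^sub>R w))) \<in> borel_measurable sphere_measure"
  using borel_measurable_cutoff_scaleR[OF assms] by (simp cong: measurable_cong_sets)

lemma smean_eq:
  assumes "\<bar>t\<bar> < 1" shows "smean A t = (\<integral>\<^sup>+w. ennreal (A (t *\<^sub>R w)) \<partial>sphere_measure)"
  unfolding smean_def
  by (rule nn_integral_cong_AE, use AE_sphere_measure in eventually_elim) (use assms in auto)

lemma smean_mono: "(\<And>z. z \<in> uball \<Longrightarrow> A z \<le> B z) \<Longrightarrow> smean A t \<le> smean B t"
  unfolding smean_def by (rule nn_integral_mono) (auto simp: indicator_def intro!: ennreal_leI)

lemma smean_cong: "(\<And>z. z \<in> uball \<Longrightarrow> A z = B z) \<Longrightarrow> smean A t = smean B t"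
  by (intro antisym smean_mono) auto

lemma smean_add:
  assumes "continuous_on uball A" "continuous_on uball B"
    and "\<And>z. z \<in> uball \<Longrightarrow> A z \<ge> 0" "\<And>z. z \<in> uball \<Longrightarrow> B z \<ge> 0"
  shows "smean (\<lambda>z. A z + B z) t = smean A t + smean B t"
  unfolding smean_def
proof (subst nn_integral_add[symmetric])
  show "(\<integral>\<^sup>+w. ennreal (indicator uball (t *\<^sub>R w) * (A (t *\<^sub>R w) + B (t *\<^sub>R w))) \<partial>sphere_measure) =
    (\<integral>\<^sup>+w. ennreal (indicator uball (t *\<^sub>R w) * A (t *\<^sub>R w)) + ennreal (indicator uball (t *\<^sub>R w) * B (t *\<^sub>R w)) \<partial>sphere_measure)"
    by (rule nn_integral_cong) (use assms in \<open>auto simp: indicator_def ennreal_plus[symmetric] simp del: ennreal_plus\<close>)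
qed (intro borel_measurable_cutoff_sphere assms)+

lemma smean_cmult:
  assumes "continuous_on uball A" "c \<ge> 0"
  shows "smean (\<lambda>z. c * A z) t = ennreal c * smean A t"
proof -
  have "ennreal (indicator uball (t *\<^sub>R w) * (c * A (t *\<^sub>R w))) = ennreal c * ennreal (indicator uball (t *\<^sub>R w) * A (t *\<^sub>R w))"
    for w using assms(2) by (subst ennreal_mult'[symmetric]) (auto simp: mult.left_commute)
  then show ?thesis unfolding smean_def
    by (simp add: nn_integral_cmult borel_measurable_cutoff_sphere[OF assms(1)])
qed

lemma smean_sum:
  assumes "finite I" "\<And>i. i \<in> I \<Longrightarrow> continuous_on uball (A i)" "\<And>i z. i \<in> I \<Longrightarrow> z \<in> uball \<Longrightarrow> A i z \<ge> 0"
  shows "smean (\<lambda>z. \<Sum>i\<in>I. A i z) t = (\<Sum>i\<in>I. smean (A i) t)"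
  using assms
proof induction
  case empty
  then show ?case by (simp add: smean_def)
next
  case (insert i I)
  have "smean (\<lambda>z. A i z + (\<Sum>i\<in>I. A i z)) t = smean (A i) t + smean (\<lambda>z. \<Sum>i\<in>I. A i z) t"
    by (rule smean_add) (use insert.prems in \<open>auto intro!: continuous_on_sum sum_nonneg\<close>)
  then show ?case using insert by simp
qed

lemma smean_const: "c \<ge> 0 \<Longrightarrow> smean (\<lambda>z :: complex ^ 'd. c) t \<le> ennreal c"
proof -
  assume c: "c \<ge> 0"
  have "smean (\<lambda>z :: complex ^ 'd. c) t \<le> (\<integral>\<^sup>+w. ennreal c \<partial>(sphere_measure :: (complex ^ 'd) measure))"
    unfolding smean_def by (rule nn_integral_mono) (use c in \<open>simp add: indicator_def\<close>)
  then show ?thesis by (simp add: emeasure_sphere_measure_UNIV)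
qed

lemma smean_scaleR: "\<bar>t\<bar> < 1 \<Longrightarrow> \<bar>r\<bar> \<le> 1 \<Longrightarrow> smean (\<lambda>z. A (r *\<^sub>R z)) t = smean A (r * t)"
proof -
  assume t: "\<bar>t\<bar> < 1" and r: "\<bar>r\<bar> \<le> 1"
  have "\<bar>r\<bar> * \<bar>t\<bar> \<le> 1 * \<bar>t\<bar>" using r by (intro mult_right_mono) auto
  then have "\<bar>r * t\<bar> < 1" using t by (simp add: abs_mult)
  with t show ?thesis by (simp add: smean_eq)
qed

lemma norm_cis_smult [simp]: "norm (cis \<theta> *s z) = norm z"
  by (simp add: norm_vector_smult)

lemma cis_smult_in_ball [simp]: "cis \<theta> *s z \<in> uball \<longleftrightarrow> z \<in> uball"
  by (simp add: norm_vector_smult)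

lemma nn_integral_Icc_continuous:
  fixes h :: "real \<Rightarrow> real"
  assumes "continuous_on {a..b} h" "\<And>s. s \<in> {a..b} \<Longrightarrow> h s \<ge> 0"
  shows "(\<integral>\<^sup>+s\<in>{a..b}. ennreal (h s) \<partial>lborel) = ennreal (integral {a..b} h)"
proof -
  have "(h has_integral integral {a..b} h) {a..b}"
    by (intro integrable_integral integrable_continuous_real assms)
  then have "(\<integral>\<^sup>+s. ennreal (indicator {a..b} s * h s) \<partial>lborel) = ennreal (integral {a..b} h)"
    by (intro nn_integral_has_integral_lebesgue assms)
  moreover have "(\<integral>\<^sup>+s. ennreal (indicator {a..b} s * h s) \<partial>lborel) = (\<integral>\<^sup>+s\<in>{a..b}. ennreal (h s) \<partial>lborel)"
    by (rule nn_integral_cong) (simp add: indicator_def)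
  ultimately show ?thesis by simp
qed

lemma nn_integral_circle:
  fixes A :: "complex ^ 'd \<Rightarrow> real"
  assumes "continuous_on uball A" "\<And>z. z \<in> uball \<Longrightarrow> A z \<ge> 0" "z \<in> uball"
  shows "(\<integral>\<^sup>+\<theta>\<in>{0..2*pi}. ennreal (A (cis \<theta> *s z)) \<partial>lborel) = ennreal (integral {0..2*pi} (\<lambda>\<theta>. A (cis \<theta> *s z)))"
proof (rule nn_integral_Icc_continuous)
  show "continuous_on {0..2*pi} (\<lambda>\<theta>. A (cis \<theta> *s z))"
    by (rule continuous_on_compose2[OF assms(1)]) (use assms(3) in \<open>auto intro!: continuous_intros\<close>)
  show "A (cis \<theta> *s z) \<ge> 0" for \<theta>
    using assms(2)[of "cis \<theta> *s z"] assms(3) by (simp del: mem_ball_0)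
qed

lemma smean_circle_compare:
  fixes A B :: "complex ^ 'd \<Rightarrow> real"
  assumes A: "continuous_on uball A" "\<And>z. z \<in> uball \<Longrightarrow> A z \<ge> 0"
    and B: "continuous_on uball B" "\<And>z. z \<in> uball \<Longrightarrow> B z \<ge> 0" and C: "C \<ge> 0"
    and le: "\<And>z. z \<in> uball \<Longrightarrow> integral {0..2*pi} (\<lambda>\<theta>. A (cis \<theta> *s z)) \<le> C * integral {0..2*pi} (\<lambda>\<theta>. B (cis \<theta> *s z))"
  shows "smean A t \<le> ennreal C * smean B t"
  unfolding smean_def
proof (rule rotation_invariant_compare[OF rotation_invariant_sphere_measure])
  fix w :: "complex ^ 'd"
  define z where "z = t *\<^sub>R w"
  have z: "t *\<^sub>R (cis \<theta> *s w) = cis \<theta> *s z" for \<theta>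
    by (simp add: z_def scaleR_eq_smult vector_smult_assoc mult.commute)
  show "(\<integral>\<^sup>+\<theta>\<in>{0..2*pi}. ennreal (indicator uball (t *\<^sub>R (cis \<theta> *s w)) * A (t *\<^sub>R (cis \<theta> *s w))) \<partial>lborel)
    \<le> ennreal C * (\<integral>\<^sup>+\<theta>\<in>{0..2*pi}. ennreal (indicator uball (t *\<^sub>R (cis \<theta> *s w)) * B (t *\<^sub>R (cis \<theta> *s w))) \<partial>lborel)"
  proof (cases "z \<in> uball")
    case True
    then have ind: "indicator uball (cis \<theta> *s z) = (1::real)" for \<theta> by (simp add: indicator_def)
    have "(\<integral>\<^sup>+\<theta>\<in>{0..2*pi}. ennreal (A (cis \<theta> *s z)) \<partial>lborel) \<le> ennreal C * (\<integral>\<^sup>+\<theta>\<in>{0..2*pi}. ennreal (B (cis \<theta> *s z)) \<partial>lborel)"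
    proof -
      have "(\<integral>\<^sup>+\<theta>\<in>{0..2*pi}. ennreal (A (cis \<theta> *s z)) \<partial>lborel) = ennreal (integral {0..2*pi} (\<lambda>\<theta>. A (cis \<theta> *s z)))"
        by (rule nn_integral_circle[OF A True])
      also have "\<dots> \<le> ennreal (C * integral {0..2*pi} (\<lambda>\<theta>. B (cis \<theta> *s z)))"
        by (rule ennreal_leI[OF le[OF True]])
      also have "\<dots> = ennreal C * ennreal (integral {0..2*pi} (\<lambda>\<theta>. B (cis \<theta> *s z)))"
        by (rule ennreal_mult'[OF C])
      also have "ennreal (integral {0..2*pi} (\<lambda>\<theta>. B (cis \<theta> *s z))) = (\<integral>\<^sup>+\<theta>\<in>{0..2*pi}. ennreal (B (cis \<theta> *s z)) \<partial>lborel)"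
        by (rule nn_integral_circle[OF B True, symmetric])
      finally show ?thesis .
    qed
    then show ?thesis unfolding z ind by simp
  next
    case False
    then have "indicator uball (cis \<theta> *s z) = (0::real)" for \<theta> by (simp add: indicator_def)
    then show ?thesis unfolding z by simp
  qed
qed (use borel_measurable_cutoff_scaleR[OF A(1)] borel_measurable_cutoff_scaleR[OF B(1)] in simp_all)

lemma continuous_on_cmod_square: "f \<in> Hol \<Longrightarrow> continuous_on uball (\<lambda>z. (cmod (f z))\<^sup>2)"
  by (intro continuous_intros hol_on_imp_continuous_on)

lemma Hol_line_holomorphic:
  assumes f: "f \<in> Hol" and S: "open S" "\<And>t. t \<in> S \<Longrightarrow> t *s v + z \<in> uball"
  shows "(\<lambda>t. f (t *s v + z)) holomorphic_on S"
  unfolding holomorphic_on_open[OF S(1)]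
  using hol_on_curve[OF f, of "\<lambda>t. t" _ v z 1] S(2) by (auto intro: DERIV_ident)

text \<open>Circle by circle this is \<open>circle_mean_square_mono\<close>.\<close>

lemma smean_square_mono:
  fixes f :: "complex ^ 'd \<Rightarrow> complex"
  assumes f: "f \<in> Hol" and st: "0 \<le> s" "s \<le> t" "t < 1"
  shows "sq_mean f s \<le> sq_mean f t"
proof -
  define r where "r = (if t = 0 then 0 else s / t)"
  have r: "0 \<le> r" "r \<le> 1" "r * t = s" using st by (auto simp: r_def)
  have "sq_mean (\<lambda>z. f (r *\<^sub>R z)) t \<le> ennreal 1 * sq_mean f t"
  proof (rule smean_circle_compare)
    fix z :: "complex ^ 'd" assume z: "z \<in> uball"
    define R where "R = (if z = 0 then 2 else 1 / norm z)"
    have R: "R > 1" using z by (auto simp: R_def)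
    have "(\<lambda>l. f (l *s z + 0)) holomorphic_on ball 0 R"
      by (rule Hol_line_holomorphic[OF f]) (auto simp: norm_vector_smult R_def field_simps split: if_splits)
    from circle_mean_square_mono[OF this R r(1,2)]
    show "integral {0..2*pi} (\<lambda>\<theta>. (cmod (f (r *\<^sub>R (cis \<theta> *s z))))\<^sup>2)
        \<le> 1 * integral {0..2*pi} (\<lambda>\<theta>. (cmod (f (cis \<theta> *s z)))\<^sup>2)"
      by (simp add: scaleR_eq_smult vector_smult_assoc)
  qed (use r in \<open>auto intro!: continuous_on_cmod_square f Hol_scaleR\<close>)
  then show ?thesis using r st smean_scaleR[of t r "\<lambda>z. (cmod (f z))\<^sup>2"] by simp
qed

section \<open>The norm as an integral of spherical means\<close>

text \<open>The value at \<open>s = 1\<close> makes the boundary term of \<open>L2_norm2\<close> the contribution of the point \<open>1\<close> to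
  a single integral with respect to \<open>\<mu>\<close>.\<close>

definition Imean :: "(complex ^ 'd \<Rightarrow> complex) \<Rightarrow> real \<Rightarrow> ennreal" where
  "Imean F s = (if s < 1 then sq_mean F s else H2_norm2 F)"

lemma H2_norm2_eq: "H2_norm2 F = (SUP r\<in>{0<..<1}. sq_mean F r)"
  unfolding H2_norm2_def by (rule SUP_cong) (auto simp: smean_eq)

lemma borel_measurable_smean:
  assumes A: "continuous_on uball A" and \<mu>: "sets \<mu> = sets (restrict_space borel {0..1})"
  shows "smean A \<in> borel_measurable \<mu>"
    and "(\<lambda>(s, w). ennreal (indicator uball (s *\<^sub>R w) * A (s *\<^sub>R w))) \<in> borel_measurable (\<mu> \<Otimes>\<^sub>M sphere_measure)"
proof -
  interpret finite_measure "sphere_measure :: (complex ^ 'a) measure" by (rule finite_measure_sphere_measure)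
  have id: "(\<lambda>x. x) \<in> \<mu> \<rightarrow>\<^sub>M borel"
    using measurable_restrict_space1[of "\<lambda>x. x" borel borel "{0..1::real}"] by (simp cong: measurable_cong_sets add: \<mu>)
  have "(\<lambda>p :: real \<times> (complex ^ 'a). fst p *\<^sub>R snd p) \<in> borel_measurable (\<mu> \<Otimes>\<^sub>M sphere_measure)"
    by (intro borel_measurable_scaleR measurable_compose[OF measurable_fst id]) (auto intro!: measurable_compose[OF measurable_snd])
  from measurable_compose[OF this borel_measurable_cutoff[OF A]]
  show 1: "(\<lambda>(s, w). ennreal (indicator uball (s *\<^sub>R w) * A (s *\<^sub>R w))) \<in> borel_measurable (\<mu> \<Otimes>\<^sub>M sphere_measure)"
    by (simp add: split_beta)
  then show "smean A \<in> borel_measurable \<mu>"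
    unfolding smean_def[abs_def] by (rule borel_measurable_nn_integral)
qed

lemma borel_measurable_Imean:
  assumes F: "continuous_on uball F" and \<mu>: "sets \<mu> = sets (restrict_space borel {0..1})"
  shows "Imean F \<in> borel_measurable \<mu>"
proof -
  have id: "(\<lambda>x. x) \<in> \<mu> \<rightarrow>\<^sub>M borel"
    using measurable_restrict_space1[of "\<lambda>x. x" borel borel "{0..1::real}"] by (simp cong: measurable_cong_sets add: \<mu>)
  have "{x \<in> space \<mu>. x < 1} \<in> sets \<mu>"
    using measurable_sets[OF id, of "{..<1}"] by (simp add: vimage_def Int_def conj_commute)
  then show ?thesis
    unfolding Imean_def[abs_def]
    by (intro measurable_If borel_measurable_smean(1)[OF _ \<mu>] continuous_intros F) auto
qed

lemma L2_norm2_eq: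
  fixes F :: "complex ^ 'd \<Rightarrow> complex"
  assumes F: "continuous_on uball F" and "admissible \<mu>"
  shows "L2_norm2 \<mu> F = (\<integral>\<^sup>+s. Imean F s \<partial>\<mu>)"
proof -
  have \<mu>: "sets \<mu> = sets (restrict_space borel {0..1})" and fin: "finite_measure \<mu>"
    using assms(2) by (auto simp: admissible_def)
  interpret finite_measure "sphere_measure :: (complex ^ 'd) measure" by (rule finite_measure_sphere_measure)
  let ?A = "\<lambda>z. (cmod (F z))\<^sup>2"
  have A: "continuous_on uball ?A" by (intro continuous_intros F)
  have space: "space \<mu> = {0..1}" using sets_eq_imp_space_eq[OF \<mu>] by (simp add: space_restrict_space)
  have id: "(\<lambda>x. x) \<in> \<mu> \<rightarrow>\<^sub>M borel"
    using measurable_restrict_space1[of "\<lambda>x. x" borel borel "{0..1::real}"] by (simp cong: measurable_cong_sets add: \<mu>)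
  have m: "(\<lambda>(s, w). s *\<^sub>R w) \<in> borel_measurable (\<mu> \<Otimes>\<^sub>M (sphere_measure :: (complex ^ 'd) measure))"
    unfolding split_beta
    by (intro borel_measurable_scaleR measurable_compose[OF measurable_fst id]) (auto intro!: measurable_compose[OF measurable_snd])
  have one: "{1} \<in> sets \<mu>"
  proof -
    have "(\<lambda>x. x) -` {1} \<inter> space \<mu> = {1}" by (auto simp: space)
    then show ?thesis using measurable_sets[OF id, of "{1}"] by simp
  qed
  have "(\<integral>\<^sup>+z\<in>ball 0 1. ennreal (?A z) \<partial>radial_measure \<mu>) = (\<integral>\<^sup>+z. ennreal (indicator uball z * ?A z) \<partial>radial_measure \<mu>)"
    by (rule nn_integral_cong) (simp add: indicator_def)
  also have "\<dots> = (\<integral>\<^sup>+p. ennreal (indicator uball (fst p *\<^sub>R snd p) * ?A (fst p *\<^sub>R snd p)) \<partial>(\<mu> \<Otimes>\<^sub>M sphere_measure))"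
    unfolding radial_measure_def
    by (subst nn_integral_distr[OF m]) (use borel_measurable_cutoff[OF A] in \<open>auto simp: split_beta\<close>)
  also have "\<dots> = (\<integral>\<^sup>+s. smean ?A s \<partial>\<mu>)"
    using nn_integral_fst[OF borel_measurable_smean(2)[OF A \<mu>]] by (simp add: smean_def case_prod_unfold)
  finally have 1: "(\<integral>\<^sup>+z\<in>ball 0 1. ennreal (?A z) \<partial>radial_measure \<mu>) = (\<integral>\<^sup>+s. smean ?A s \<partial>\<mu>)" .
  have s1: "smean ?A 1 = 0"
  proof -
    have "smean ?A 1 = (\<integral>\<^sup>+w. 0 \<partial>(sphere_measure :: (complex ^ 'd) measure))"
      unfolding smean_def by (rule nn_integral_cong_AE, use AE_sphere_measure in eventually_elim) auto
    then show ?thesis by simp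
  qed
  have "(\<integral>\<^sup>+s. Imean F s \<partial>\<mu>) = (\<integral>\<^sup>+s. smean ?A s + H2_norm2 F * indicator {1} s \<partial>\<mu>)"
    by (rule nn_integral_cong) (auto simp: Imean_def space s1 indicator_def)
  also have "\<dots> = (\<integral>\<^sup>+s. smean ?A s \<partial>\<mu>) + H2_norm2 F * emeasure \<mu> {1}"
    using one by (subst nn_integral_add) (auto intro: borel_measurable_smean(1)[OF A \<mu>] simp: nn_integral_cmult_indicator)
  finally show ?thesis unfolding L2_norm2_def 1 by (simp add: mult.commute)
qed

text \<open>All comparisons of norms reduce to comparisons of means over spheres inside the ball; the Hardy
  norm at the boundary is covered because it is a supremum of such means.\<close>

lemma L2_norm2_le_sum:
  fixes F :: "complex ^ 'd \<Rightarrow> complex"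
  assumes \<mu>: "admissible \<mu>" and F: "continuous_on uball F" and G: "finite I" "\<And>i. i \<in> I \<Longrightarrow> continuous_on uball (G i)"
    and le: "\<And>t. 0 \<le> t \<Longrightarrow> t < 1 \<Longrightarrow> sq_mean F t \<le> c * (\<Sum>i\<in>I. sq_mean (G i) t)"
  shows "L2_norm2 \<mu> F \<le> c * (\<Sum>i\<in>I. L2_norm2 \<mu> (G i))"
proof -
  have s: "sets \<mu> = sets (restrict_space borel {0..1})" using \<mu> by (auto simp: admissible_def)
  have space: "space \<mu> = {0..1}" using sets_eq_imp_space_eq[OF s] by (simp add: space_restrict_space)
  have "Imean F s \<le> c * (\<Sum>i\<in>I. Imean (G i) s)" if "s \<in> space \<mu>" for s
  proof (cases "s < 1")
    case True
    then show ?thesis using that le by (simp add: space Imean_def)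
  next
    case False
    have "sq_mean F r \<le> c * (\<Sum>i\<in>I. H2_norm2 (G i))" if "r \<in> {0<..<1}" for r
      by (rule order_trans[OF le])
         (use that in \<open>auto simp: H2_norm2_eq intro!: mult_left_mono sum_mono SUP_upper2[of r]\<close>)
    then show ?thesis using False by (auto simp: Imean_def H2_norm2_eq[of F] intro!: SUP_least)
  qed
  then have "(\<integral>\<^sup>+s. Imean F s \<partial>\<mu>) \<le> (\<integral>\<^sup>+s. c * (\<Sum>i\<in>I. Imean (G i) s) \<partial>\<mu>)"
    by (rule nn_integral_mono)
  also have "\<dots> = c * (\<Sum>i\<in>I. \<integral>\<^sup>+s. Imean (G i) s \<partial>\<mu>)"
    using G by (subst nn_integral_cmult) (auto simp: nn_integral_sum borel_measurable_Imean[OF _ s] intro!: borel_measurable_sum)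
  finally show ?thesis using F G \<mu> by (simp add: L2_norm2_eq)
qed

text \<open>For each radius inside the ball this is the parallelogram identity. At the boundary the sum of
  the two suprema is the supremum of the sums, because square means increase with the radius.\<close>

lemma L2_norm2_parallelogram:
  fixes F G :: "complex ^ 'd \<Rightarrow> complex"
  assumes \<mu>: "admissible \<mu>" and F: "F \<in> Hol" and G: "G \<in> Hol"
  shows "L2_norm2 \<mu> (\<lambda>z. F z + G z) + L2_norm2 \<mu> (\<lambda>z. F z - G z) \<le> 2 * L2_norm2 \<mu> F + 2 * L2_norm2 \<mu> G"
proof -
  have s: "sets \<mu> = sets (restrict_space borel {0..1})" using \<mu> by (auto simp: admissible_def)
  have space: "space \<mu> = {0..1}" using sets_eq_imp_space_eq[OF s] by (simp add: space_restrict_space)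
  have c: "continuous_on uball F" "continuous_on uball G" "continuous_on uball (\<lambda>z. F z + G z)" "continuous_on uball (\<lambda>z. F z - G z)"
    using F G by (auto intro!: hol_on_imp_continuous_on)
  have par: "(cmod (a + b))\<^sup>2 + (cmod (a - b))\<^sup>2 = 2 * (cmod a)\<^sup>2 + 2 * (cmod b)\<^sup>2" for a b
    by (simp add: cmod_power2) (simp add: power2_eq_square algebra_simps)
  have eq: "sq_mean (\<lambda>z. F z + G z) t + sq_mean (\<lambda>z. F z - G z) t = 2 * sq_mean F t + 2 * sq_mean G t" for t
  proof -
    have "sq_mean (\<lambda>z. F z + G z) t + sq_mean (\<lambda>z. F z - G z) t = smean (\<lambda>z. 2 * (cmod (F z))\<^sup>2 + 2 * (cmod (G z))\<^sup>2) t"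
      unfolding par[symmetric] by (rule smean_add[symmetric]) (auto intro!: continuous_intros c)
    also have "\<dots> = smean (\<lambda>z. 2 * (cmod (F z))\<^sup>2) t + smean (\<lambda>z. 2 * (cmod (G z))\<^sup>2) t"
      by (rule smean_add) (auto intro!: continuous_intros c)
    also have "\<dots> = 2 * sq_mean F t + 2 * sq_mean G t"
      by (subst (1 2) smean_cmult) (auto intro!: continuous_intros c)
    finally show ?thesis .
  qed
  have "Imean (\<lambda>z. F z + G z) s + Imean (\<lambda>z. F z - G z) s \<le> 2 * Imean F s + 2 * Imean G s" for s
  proof (cases "s < 1")
    case True
    then show ?thesis by (simp add: Imean_def eq)
  next
    case False
    have "H2_norm2 (\<lambda>z. F z + G z) + H2_norm2 (\<lambda>z. F z - G z)
       = (SUP r\<in>{0<..<1}. sq_mean (\<lambda>z. F z + G z) r + sq_mean (\<lambda>z. F z - G z) r)"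
      unfolding H2_norm2_eq
    proof (rule SUP_add_directed_ennreal[symmetric])
      fix i j :: real assume "i \<in> {0<..<1}" "j \<in> {0<..<1}"
      then show "\<exists>k\<in>{0<..<1}. sq_mean (\<lambda>z. F z + G z) i + sq_mean (\<lambda>z. F z - G z) j \<le> sq_mean (\<lambda>z. F z + G z) k + sq_mean (\<lambda>z. F z - G z) k"
        by (intro bexI[of _ "max i j"] add_mono smean_square_mono Hol_add Hol_diff F G) auto
    qed
    also have "\<dots> \<le> 2 * H2_norm2 F + 2 * H2_norm2 G"
      unfolding eq by (rule SUP_least) (auto simp: H2_norm2_eq intro!: add_mono mult_left_mono SUP_upper)
    finally show ?thesis using False by (simp add: Imean_def)
  qed
  then have "(\<integral>\<^sup>+s. Imean (\<lambda>z. F z + G z) s + Imean (\<lambda>z. F z - G z) s \<partial>\<mu>) \<le> (\<integral>\<^sup>+s. 2 * Imean F s + 2 * Imean G s \<partial>\<mu>)"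
    by (intro nn_integral_mono)
  also have "(\<integral>\<^sup>+s. Imean (\<lambda>z. F z + G z) s + Imean (\<lambda>z. F z - G z) s \<partial>\<mu>) = L2_norm2 \<mu> (\<lambda>z. F z + G z) + L2_norm2 \<mu> (\<lambda>z. F z - G z)"
    using c \<mu> by (subst nn_integral_add) (auto simp: L2_norm2_eq intro: borel_measurable_Imean[OF _ s])
  also have "(\<integral>\<^sup>+s. 2 * Imean F s + 2 * Imean G s \<partial>\<mu>) = (\<integral>\<^sup>+s. 2 * Imean F s \<partial>\<mu>) + (\<integral>\<^sup>+s. 2 * Imean G s \<partial>\<mu>)"
    by (rule nn_integral_add) (use borel_measurable_Imean[OF c(1) s] borel_measurable_Imean[OF c(2) s] in auto)
  also have "\<dots> = 2 * L2_norm2 \<mu> F + 2 * L2_norm2 \<mu> G"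
    using c \<mu> borel_measurable_Imean[OF c(1) s] borel_measurable_Imean[OF c(2) s] by (simp add: nn_integral_cmult L2_norm2_eq)
  finally show ?thesis .
qed

lemma L2_norm2_Fatou:
  fixes F :: "complex ^ 'd \<Rightarrow> complex"
  assumes \<mu>: "admissible \<mu>" and F: "continuous_on uball F" and G: "\<And>n. continuous_on uball (G n)"
    and lim: "\<And>z. z \<in> uball \<Longrightarrow> (\<lambda>n. G n z) \<longlonglongrightarrow> F z"
  shows "L2_norm2 \<mu> F \<le> liminf (\<lambda>n. L2_norm2 \<mu> (G n))"
proof -
  have s: "sets \<mu> = sets (restrict_space borel {0..1})" using \<mu> by (auto simp: admissible_def)
  have space: "space \<mu> = {0..1}" using sets_eq_imp_space_eq[OF s] by (simp add: space_restrict_space)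
  \<comment> \<open>Fatou's lemma on each sphere\<close>
  have m: "sq_mean F t \<le> liminf (\<lambda>n. sq_mean (G n) t)" for t
  proof -
    have "ennreal (indicator uball (t *\<^sub>R w) * (cmod (F (t *\<^sub>R w)))\<^sup>2) =
       liminf (\<lambda>n. ennreal (indicator uball (t *\<^sub>R w) * (cmod (G n (t *\<^sub>R w)))\<^sup>2))" for w
    proof (cases "t *\<^sub>R w \<in> uball")
      case True
      from lim[OF True] have "(\<lambda>n. ennreal (indicator uball (t *\<^sub>R w) * (cmod (G n (t *\<^sub>R w)))\<^sup>2)) \<longlonglongrightarrow>
        ennreal (indicator uball (t *\<^sub>R w) * (cmod (F (t *\<^sub>R w)))\<^sup>2)"
        by (intro tendsto_intros)
      then show ?thesis by (intro lim_imp_Liminf[symmetric]) auto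
    next
      case False
      then show ?thesis by (simp add: indicator_def Liminf_const)
    qed
    then have "sq_mean F t = (\<integral>\<^sup>+w. liminf (\<lambda>n. ennreal (indicator uball (t *\<^sub>R w) * (cmod (G n (t *\<^sub>R w)))\<^sup>2)) \<partial>sphere_measure)"
      by (simp only: smean_def)
    also have "\<dots> \<le> liminf (\<lambda>n. sq_mean (G n) t)"
      unfolding smean_def by (intro nn_integral_liminf borel_measurable_cutoff_sphere continuous_intros G)
    finally show ?thesis .
  qed
  \<comment> \<open>and hence for the supremum over the spheres\<close>
  have "Imean F s \<le> liminf (\<lambda>n. Imean (G n) s)" for s
  proof (cases "s < 1")
    case True
    then show ?thesis using m by (simp add: Imean_def)
  next
    case False
    have "sq_mean F r \<le> liminf (\<lambda>n. H2_norm2 (G n))" if "r \<in> {0<..<1}" for r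
      by (rule order_trans[OF m], rule Liminf_mono)
         (use that in \<open>auto simp: H2_norm2_eq intro!: always_eventually SUP_upper\<close>)
    then have "H2_norm2 F \<le> liminf (\<lambda>n. H2_norm2 (G n))" unfolding H2_norm2_eq[of F] by (rule SUP_least)
    then show ?thesis using False by (simp add: Imean_def)
  qed
  then have "(\<integral>\<^sup>+s. Imean F s \<partial>\<mu>) \<le> (\<integral>\<^sup>+s. liminf (\<lambda>n. Imean (G n) s) \<partial>\<mu>)"
    by (intro nn_integral_mono)
  also have "\<dots> \<le> liminf (\<lambda>n. \<integral>\<^sup>+s. Imean (G n) s \<partial>\<mu>)"
    by (intro nn_integral_liminf borel_measurable_Imean[OF _ s] G)
  finally show ?thesis using F G \<mu> by (simp add: L2_norm2_eq)
qed

section \<open>Gagliardo--Nirenberg and dilation estimates on spheres\<close>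

text \<open>On the circle through \<open>z\<close>, differentiation in the angle is \<open>\<i>\<close> times \<open>radial_deriv\<close>.\<close>

lemma circle_jet_deriv:
  fixes f :: "complex ^ 'd \<Rightarrow> complex"
  assumes f: "f \<in> Hol" and z: "z \<in> uball"
  shows "((\<lambda>\<theta>. \<i> ^ n * (radial_deriv ^^ n) f (cis \<theta> *s z)) has_vector_derivative
     \<i> ^ Suc n * (radial_deriv ^^ Suc n) f (cis t *s z)) (at t)"
proof -
  have i: "((\<lambda>\<theta>. \<i> * of_real \<theta>) has_vector_derivative \<i> * 1) (at t)"
    by (rule has_vector_derivative_mult_right) (auto intro!: derivative_eq_intros)
  have "\<i> * of_real t \<in> edom z"
    using z cis_smult_in_ball[of t z] by (simp only: cis_conv_exp mem_Collect_eq)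
  from eslice_deriv[OF Hol_radial_deriv_pow[OF f] this, of n]
  have "((\<lambda>\<theta>. eslice ((radial_deriv ^^ n) f) z (\<i> * of_real \<theta>)) has_vector_derivative
      \<i> * 1 * eslice (radial_deriv ((radial_deriv ^^ n) f)) z (\<i> * of_real t)) (at t)"
    using field_vector_diff_chain_at[OF i] by (simp add: o_def)
  from has_vector_derivative_mult_right[OF this, of "\<i> ^ n"]
  show ?thesis by (simp add: eslice_def cis_conv_exp mult_ac)
qed

text \<open>The periodic inequality applied on each circle \<open>cis \<theta> *s z\<close> and averaged over the sphere. Its
  constant does not depend on the circle, since \<open>f\<close> is bounded by \<open>B\<close> on all of them.\<close>

lemma smean_Gagliardo_Nirenberg:
  assumes "1 \<le> b" "b \<le> N"
  shows "\<exists>K\<ge>0. \<forall>f\<in>Hol. (\<forall>z\<in>uball. cmod (f (z :: complex ^ 'd)) \<le> B) \<longrightarrow> (\<forall>t.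
    smean (\<lambda>z. root b (cmod ((radial_deriv ^^ b) f z)) ^ (2 * N)) t \<le> ennreal K * sq_mean ((radial_deriv ^^ N) f) t)"
proof -
  obtain K where K: "K \<ge> 0" "\<And>g T. periodic_jet g T B \<Longrightarrow>
    integral {0..T} (\<lambda>t. root b (cmod (g b t)) ^ (2 * N)) \<le> K * integral {0..T} (\<lambda>t. (cmod (g N t))\<^sup>2)"
    using Gagliardo_Nirenberg_periodic[OF assms, of B] by blast
  show ?thesis
  proof (rule exI[of _ K], intro conjI ballI impI allI K(1))
    fix f t assume f: "f \<in> Hol" and B: "\<forall>z\<in>uball. cmod (f (z :: complex ^ 'd)) \<le> B"
    show "smean (\<lambda>z. root b (cmod ((radial_deriv ^^ b) f z)) ^ (2 * N)) t \<le> ennreal K * sq_mean ((radial_deriv ^^ N) f) t"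
    proof (rule smean_circle_compare)
      fix z :: "complex ^ 'd" assume z: "z \<in> uball"
      define g where "g = (\<lambda>n \<theta>. \<i> ^ n * (radial_deriv ^^ n) f (cis \<theta> *s z))"
      have "periodic_jet g (2 * pi) B"
      proof
        show "B \<ge> 0" using order_trans[OF norm_ge_zero] B z by blast
        show "(g n has_vector_derivative g (Suc n) t) (at t)" for n t
          unfolding g_def by (rule circle_jet_deriv[OF f z])
        show "cmod (g 0 t) \<le> B" for t
          using B cis_smult_in_ball[of t z] z by (simp add: g_def)
      qed (auto simp: g_def)
      from K(2)[OF this] show "integral {0..2*pi} (\<lambda>\<theta>. root b (cmod ((radial_deriv ^^ b) f (cis \<theta> *s z))) ^ (2 * N))
        \<le> K * integral {0..2*pi} (\<lambda>\<theta>. (cmod ((radial_deriv ^^ N) f (cis \<theta> *s z)))\<^sup>2)"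
        by (simp add: g_def norm_mult norm_power)
    qed (use f K assms in \<open>auto intro!: continuous_intros continuous_on_real_root hol_on_imp_continuous_on\<close>)
  qed
qed

text \<open>The graph of the convex function \<open>x ^ p\<close> lies above its tangent at \<open>c\<close>; after division by
  \<open>c ^ p\<close> this is Bernoulli's inequality.\<close>

lemma power_tangent_le:
  fixes x c :: real assumes "x \<ge> 0" "c \<ge> 0" "p \<ge> 1"
  shows "c ^ p + p * c ^ (p - 1) * (x - c) \<le> x ^ p"
proof (cases "c = 0")
  case True
  then show ?thesis using assms by (cases "p = 1") (auto simp: power_0_left)
next
  case False
  then have c: "c > 0" using assms by simp
  have "1 + real p * (x / c - 1) \<le> (1 + (x / c - 1)) ^ p"
    by (rule Bernoulli_inequality) (use assms c in simp)
  then have "c ^ p * (1 + real p * (x / c - 1)) \<le> c ^ p * (x / c) ^ p"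
    using c by (intro mult_left_mono) auto
  also have "c ^ p * (x / c) ^ p = x ^ p" using c by (simp add: power_divide)
  also have "c ^ p * (1 + real p * (x / c - 1)) = c ^ p + p * c ^ (p - 1) * (x - c)"
  proof -
    obtain q where q: "p = Suc q" using assms by (cases p) auto
    show ?thesis using c unfolding q by (simp add: field_simps)
  qed
  finally show ?thesis .
qed

text \<open>Integrate the tangent inequality for \<open>h s\<close> at the mean value \<open>c\<close> of \<open>h\<close>: the linear term
  vanishes.\<close>

lemma Jensen_power_interval:
  fixes h :: "real \<Rightarrow> real"
  assumes h: "continuous_on {-a..0} h" "\<And>s. s \<in> {-a..0} \<Longrightarrow> h s \<ge> 0" and a: "a > 0" and p: "p \<ge> 1"
  shows "(integral {-a..0} h) ^ p \<le> a ^ (p - 1) * integral {-a..0} (\<lambda>s. h s ^ p)"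
proof -
  define I where "I = integral {-a..0} h"
  define c where "c = I / a"
  have I: "(h has_integral I) {-a..0}" unfolding I_def
    by (intro integrable_integral integrable_continuous_real h)
  have c: "c \<ge> 0" using has_integral_nonneg[OF I h(2)] a by (simp add: c_def)
  have const: "((\<lambda>s. k) has_integral a * k) {-a..0}" for k :: real
    using has_integral_const_real[of k "-a" 0] a by simp
  have "((\<lambda>s. c ^ p + p * c ^ (p - 1) * (h s - c)) has_integral
      a * c ^ p + p * c ^ (p - 1) * (I - a * c)) {-a..0}"
    by (intro has_integral_add has_integral_mult_right has_integral_diff I const)
  moreover have "((\<lambda>s. h s ^ p) has_integral integral {-a..0} (\<lambda>s. h s ^ p)) {-a..0}"
    by (intro integrable_integral integrable_continuous_real continuous_intros h)
  ultimately have "a * c ^ p + p * c ^ (p - 1) * (I - a * c) \<le> integral {-a..0} (\<lambda>s. h s ^ p)"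
    by (rule has_integral_le) (use power_tangent_le h c p in auto)
  then have "a * c ^ p \<le> integral {-a..0} (\<lambda>s. h s ^ p)" using a by (simp add: c_def)
  then have "a ^ (p - 1) * (a * c ^ p) \<le> a ^ (p - 1) * integral {-a..0} (\<lambda>s. h s ^ p)"
    using a by (intro mult_left_mono) auto
  also have "a ^ (p - 1) * (a * c ^ p) = I ^ p"
    using a p by (cases p) (auto simp: c_def power_divide)
  finally show ?thesis by (simp add: I_def)
qed

lemma exp_scaleR_in_ball: "s \<le> 0 \<Longrightarrow> z \<in> uball \<Longrightarrow> exp s *\<^sub>R (z :: complex ^ 'd) \<in> uball"
  using mult_mono[of "exp s" 1 "norm z" "norm z"] by auto

text \<open>The difference is the integral of \<open>radial_deriv f\<close> along the radius, in the logarithmic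
  coordinate \<open>s\<close>.\<close>

lemma radial_difference_power:
  fixes f :: "complex ^ 'd \<Rightarrow> complex"
  assumes f: "f \<in> Hol" and z: "z \<in> uball" and a: "a > 0" and p: "p \<ge> 1"
  shows "cmod (f z - f (exp (-a) *\<^sub>R z)) ^ p \<le> a ^ (p - 1) * integral {-a..0} (\<lambda>s. cmod (radial_deriv f (exp s *\<^sub>R z)) ^ p)"
proof -
  have "((\<lambda>s. radial_deriv f (exp s *\<^sub>R z)) has_integral f (exp 0 *\<^sub>R z) - f (exp (-a) *\<^sub>R z)) {-a..0}"
  proof (rule fundamental_theorem_of_calculus)
    fix s :: real assume s: "s \<in> {-a..0}"
    have "of_real s \<in> edom z" using exp_scaleR_in_ball[of s z] s z
      by (simp add: scaleR_eq_smult exp_of_real)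
    from has_vector_derivative_real_field[OF eslice_deriv[OF f this]]
    show "((\<lambda>s. f (exp s *\<^sub>R z)) has_vector_derivative radial_deriv f (exp s *\<^sub>R z)) (at s within {-a..0})"
      by (simp add: eslice_def scaleR_eq_smult exp_of_real)
  qed (use a in auto)
  then have int: "((\<lambda>s. radial_deriv f (exp s *\<^sub>R z)) has_integral f z - f (exp (-a) *\<^sub>R z)) {-a..0}" by simp
  have cont: "continuous_on {-a..0} (\<lambda>s. cmod (radial_deriv f (exp s *\<^sub>R z)))"
    by (intro continuous_on_norm continuous_on_compose2[OF hol_on_imp_continuous_on[OF Hol_radial_deriv[OF f]]] continuous_intros)
       (use exp_scaleR_in_ball[OF _ z] in force)
  have "cmod (f z - f (exp (-a) *\<^sub>R z)) \<le> integral {-a..0} (\<lambda>s. cmod (radial_deriv f (exp s *\<^sub>R z)))"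
    unfolding integral_unique[OF int, symmetric]
    by (rule integral_norm_bound_integral) (use int cont in \<open>auto intro: integrable_continuous_real\<close>)
  then have "cmod (f z - f (exp (-a) *\<^sub>R z)) ^ p \<le> (integral {-a..0} (\<lambda>s. cmod (radial_deriv f (exp s *\<^sub>R z)))) ^ p"
    by (intro power_mono) auto
  also have "\<dots> \<le> a ^ (p - 1) * integral {-a..0} (\<lambda>s. cmod (radial_deriv f (exp s *\<^sub>R z)) ^ p)"
    by (rule Jensen_power_interval[OF cont _ a p]) auto
  finally show ?thesis .
qed

text \<open>In the mean of order \<open>p\<close>, the difference between \<open>f\<close> and its dilation by \<open>exp (-a)\<close> is at most
  \<open>a\<close> times the largest mean of \<open>radial_deriv f\<close> over smaller spheres: take the mean of
  \<open>radial_difference_power\<close> and interchange the integrals over the sphere and over the radius.\<close>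

lemma smean_radial_difference:
  fixes f :: "complex ^ 'd \<Rightarrow> complex"
  assumes f: "f \<in> Hol" and a: "a > 0" and p: "p \<ge> 1" and t: "0 \<le> t" "t < 1"
    and M: "\<And>t'. 0 \<le> t' \<Longrightarrow> t' \<le> t \<Longrightarrow> smean (\<lambda>z. cmod (radial_deriv f z) ^ p) t' \<le> M"
  shows "smean (\<lambda>z. cmod (f z - f (exp (-a) *\<^sub>R z)) ^ p) t \<le> ennreal (a ^ p) * M"
proof -
  let ?h = "\<lambda>z. cmod (radial_deriv f z) ^ p"
  let ?H = "\<lambda>z. ennreal (indicator uball z * ?h z)"
  interpret finite_measure "sphere_measure :: (complex ^ 'd) measure" by (rule finite_measure_sphere_measure)
  interpret P: pair_sigma_finite "sphere_measure :: (complex ^ 'd) measure" lborel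
    by (simp add: pair_sigma_finite_def sigma_finite_lborel sigma_finite_measure_axioms)
  have ch: "continuous_on uball ?h" by (intro continuous_intros hol_on_imp_continuous_on Hol_radial_deriv f)
  have m: "(\<lambda>x :: (complex ^ 'd) \<times> real. ?H (exp (snd x) *\<^sub>R t *\<^sub>R fst x) * indicator {-a..0} (snd x)) \<in> borel_measurable (borel \<Otimes>\<^sub>M borel)"
  proof -
    have "(\<lambda>x :: (complex ^ 'd) \<times> real. exp (snd x) *\<^sub>R t *\<^sub>R fst x) \<in> borel_measurable (borel \<Otimes>\<^sub>M borel)" by measurable
    from measurable_compose[OF this borel_measurable_cutoff[OF ch]]
    show ?thesis by measurable
  qed
  have "smean (\<lambda>z. cmod (f z - f (exp (-a) *\<^sub>R z)) ^ p) t
    \<le> (\<integral>\<^sup>+w. ennreal (a ^ (p - 1)) * (\<integral>\<^sup>+s\<in>{-a..0}. ?H (exp s *\<^sub>R t *\<^sub>R w) \<partial>lborel) \<partial>sphere_measure)"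
    unfolding smean_def
  proof (rule nn_integral_mono)
    fix w :: "complex ^ 'd"
    define z where "z = t *\<^sub>R w"
    show "ennreal (indicator uball (t *\<^sub>R w) * cmod (f (t *\<^sub>R w) - f (exp (-a) *\<^sub>R t *\<^sub>R w)) ^ p)
      \<le> ennreal (a ^ (p - 1)) * (\<integral>\<^sup>+s\<in>{-a..0}. ?H (exp s *\<^sub>R t *\<^sub>R w) \<partial>lborel)"
      unfolding z_def[symmetric]
    proof (cases "z \<in> uball")
      case True
      have "continuous_on {-a..0} (\<lambda>s. ?h (exp s *\<^sub>R z))"
        by (rule continuous_on_compose2[OF ch]) (use exp_scaleR_in_ball[OF _ True] in \<open>force intro!: continuous_intros\<close>)+
      then have "((\<lambda>s. ?h (exp s *\<^sub>R z)) has_integral integral {-a..0} (\<lambda>s. ?h (exp s *\<^sub>R z))) {-a..0}"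
        by (intro integrable_integral integrable_continuous_real)
      then have "(\<integral>\<^sup>+s. ennreal (indicator {-a..0} s * ?h (exp s *\<^sub>R z)) \<partial>lborel) = ennreal (integral {-a..0} (\<lambda>s. ?h (exp s *\<^sub>R z)))"
        by (intro nn_integral_has_integral_lebesgue) auto
      also have "(\<integral>\<^sup>+s. ennreal (indicator {-a..0} s * ?h (exp s *\<^sub>R z)) \<partial>lborel) = (\<integral>\<^sup>+s\<in>{-a..0}. ?H (exp s *\<^sub>R z) \<partial>lborel)"
        by (rule nn_integral_cong) (use exp_scaleR_in_ball[OF _ True] in \<open>auto simp: indicator_def\<close>)
      finally have "ennreal (a ^ (p - 1)) * (\<integral>\<^sup>+s\<in>{-a..0}. ?H (exp s *\<^sub>R z) \<partial>lborel)
        = ennreal (a ^ (p - 1) * integral {-a..0} (\<lambda>s. ?h (exp s *\<^sub>R z)))"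
        using a by (simp add: ennreal_mult')
      then show "ennreal (indicator uball z * cmod (f z - f (exp (-a) *\<^sub>R z)) ^ p)
        \<le> ennreal (a ^ (p - 1)) * (\<integral>\<^sup>+s\<in>{-a..0}. ?H (exp s *\<^sub>R z) \<partial>lborel)"
        using radial_difference_power[OF f True a p] by (simp add: indicator_def ennreal_leI)
    qed (simp add: indicator_def)
  qed
  also have "\<dots> = ennreal (a ^ (p - 1)) * (\<integral>\<^sup>+w. (\<integral>\<^sup>+s\<in>{-a..0}. ?H (exp s *\<^sub>R t *\<^sub>R w) \<partial>lborel) \<partial>sphere_measure)"
  proof (rule nn_integral_cmult)
    have "(\<lambda>(x, s). ?H (exp s *\<^sub>R t *\<^sub>R x) * indicator {-a..0} s) \<in> borel_measurable (sphere_measure \<Otimes>\<^sub>M lborel)"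
      using m by (simp add: case_prod_unfold cong: measurable_cong_sets sets_pair_measure_cong)
    then show "(\<lambda>w. \<integral>\<^sup>+s\<in>{-a..0}. ?H (exp s *\<^sub>R t *\<^sub>R w) \<partial>lborel) \<in> borel_measurable sphere_measure"
      by (rule lborel.borel_measurable_nn_integral)
  qed
  finally have outer: "smean (\<lambda>z. cmod (f z - f (exp (-a) *\<^sub>R z)) ^ p) t
    \<le> ennreal (a ^ (p - 1)) * (\<integral>\<^sup>+w. (\<integral>\<^sup>+s\<in>{-a..0}. ?H (exp s *\<^sub>R t *\<^sub>R w) \<partial>lborel) \<partial>sphere_measure)" .
  have "(\<integral>\<^sup>+w. (\<integral>\<^sup>+s\<in>{-a..0}. ?H (exp s *\<^sub>R t *\<^sub>R w) \<partial>lborel) \<partial>sphere_measure)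
    = (\<integral>\<^sup>+s. (\<integral>\<^sup>+w. ?H (exp s *\<^sub>R t *\<^sub>R w) * indicator {-a..0} s \<partial>sphere_measure) \<partial>lborel)"
    by (rule P.Fubini'[symmetric])
       (use m in \<open>simp add: case_prod_unfold cong: measurable_cong_sets sets_pair_measure_cong\<close>)
  also have "\<dots> \<le> (\<integral>\<^sup>+s. M * indicator {-a..0} s \<partial>lborel)"
  proof (rule nn_integral_mono)
    fix s :: real
    show "(\<integral>\<^sup>+w. ?H (exp s *\<^sub>R t *\<^sub>R w) * indicator {-a..0} s \<partial>sphere_measure) \<le> M * indicator {-a..0} s"
    proof (cases "s \<in> {-a..0}")
      case True
      then have "exp s * t \<le> 1 * t" using t by (intro mult_right_mono) auto
      then have "smean ?h (exp s * t) \<le> M" using t by (intro M) auto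
      then have "(\<integral>\<^sup>+w. ?H (exp s *\<^sub>R t *\<^sub>R w) \<partial>sphere_measure) \<le> M"
        unfolding smean_def scaleR_scaleR .
      then show ?thesis using True by simp
    qed simp
  qed
  also have "\<dots> = M * ennreal a" using a by (subst nn_integral_cmult_indicator) simp_all
  finally have "ennreal (a ^ (p - 1)) * (\<integral>\<^sup>+w. (\<integral>\<^sup>+s\<in>{-a..0}. ?H (exp s *\<^sub>R t *\<^sub>R w) \<partial>lborel) \<partial>sphere_measure)
    \<le> ennreal (a ^ (p - 1)) * (M * ennreal a)"
    by (rule mult_left_mono) simp
  moreover have "ennreal (a ^ (p - 1)) * (M * ennreal a) = ennreal (a ^ p) * M"
  proof -
    obtain q where q: "p = Suc q" using p by (cases p) auto
    have "ennreal (a ^ p) = ennreal a * ennreal (a ^ (p - 1))"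
      unfolding q using a by (simp add: ennreal_mult')
    then show ?thesis by (simp add: mult_ac)
  qed
  ultimately show ?thesis using outer by simp
qed

section \<open>Dilations are multipliers\<close>

lemma radial_deriv_pow_scaleR:
  assumes "f \<in> Hol" "0 \<le> r" "r \<le> 1" "z \<in> uball"
  shows "(radial_deriv ^^ n) (\<lambda>z. f (r *\<^sub>R z)) z = (radial_deriv ^^ n) f (r *\<^sub>R z)"
  unfolding scaleR_eq_smult by (rule radial_deriv_pow_smult) (use assms in auto)

lemma scaleR_in_ball: "0 \<le> r \<Longrightarrow> r \<le> 1 \<Longrightarrow> z \<in> uball \<Longrightarrow> r *\<^sub>R z \<in> uball"
  unfolding scaleR_eq_smult by (rule smult_in_ball) auto

lemma L2_norm2_const_finite:
  assumes \<mu>: "admissible \<mu>" shows "L2_norm2 \<mu> (\<lambda>z :: complex ^ 'd. c) < \<infinity>"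
proof -
  interpret finite_measure \<mu> using \<mu> by (simp add: admissible_def)
  have "Imean (\<lambda>z :: complex ^ 'd. c) s \<le> ennreal ((cmod c)\<^sup>2)" for s
    unfolding Imean_def H2_norm2_eq by (auto intro!: smean_const SUP_least)
  then have "(\<integral>\<^sup>+s. Imean (\<lambda>z :: complex ^ 'd. c) s \<partial>\<mu>) \<le> (\<integral>\<^sup>+s. ennreal ((cmod c)\<^sup>2) \<partial>\<mu>)"
    by (intro nn_integral_mono)
  also have "\<dots> < \<infinity>" by (auto simp: ennreal_mult_eq_top_iff less_top[symmetric] emeasure_finite)
  finally show ?thesis using \<mu> by (simp add: L2_norm2_eq)
qed

lemma L2_norm2_le:
  fixes F G :: "complex ^ 'd \<Rightarrow> complex"
  assumes "admissible \<mu>" "continuous_on uball F" "continuous_on uball G"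
    and "\<And>t. 0 \<le> t \<Longrightarrow> t < 1 \<Longrightarrow> sq_mean F t \<le> c * sq_mean G t"
  shows "L2_norm2 \<mu> F \<le> c * L2_norm2 \<mu> G"
  using L2_norm2_le_sum[of \<mu> F "{()}" "\<lambda>_. G" c] assms by simp

lemma L2_norm2_finite_sum:
  fixes F :: "complex ^ 'd \<Rightarrow> complex"
  assumes \<mu>: "admissible \<mu>" and F: "continuous_on uball F" and I: "finite I"
    and G: "\<And>i. i \<in> I \<Longrightarrow> continuous_on uball (G i)" "\<And>i. i \<in> I \<Longrightarrow> L2_norm2 \<mu> (G i) < \<infinity>"
    and le: "\<And>z. z \<in> uball \<Longrightarrow> cmod (F z) \<le> c * (\<Sum>i\<in>I. cmod (G i z))"
  shows "L2_norm2 \<mu> F < \<infinity>"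
proof -
  have "L2_norm2 \<mu> F \<le> ennreal (c\<^sup>2 * card I) * (\<Sum>i\<in>I. L2_norm2 \<mu> (G i))"
  proof (rule L2_norm2_le_sum[OF \<mu> F I G(1)])
    fix t :: real
    have "sq_mean F t \<le> smean (\<lambda>z. (c\<^sup>2 * card I) * (\<Sum>i\<in>I. (cmod (G i z))\<^sup>2)) t"
    proof (rule smean_mono)
      fix z :: "complex ^ 'd" assume z: "z \<in> uball"
      have "(cmod (F z))\<^sup>2 \<le> (c * (\<Sum>i\<in>I. cmod (G i z)))\<^sup>2"
        using le[OF z] by (intro power_mono) auto
      also have "\<dots> = c\<^sup>2 * (\<Sum>i\<in>I. cmod (G i z))\<^sup>2" by (simp add: power_mult_distrib)
      also have "\<dots> \<le> c\<^sup>2 * ((\<Sum>i\<in>I. (cmod (G i z))\<^sup>2) * card I)"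
        by (intro mult_left_mono sum_squared_le_sum_of_squares I) auto
      finally show "(cmod (F z))\<^sup>2 \<le> (c\<^sup>2 * card I) * (\<Sum>i\<in>I. (cmod (G i z))\<^sup>2)" by (simp add: mult_ac)
    qed
    also have "\<dots> = ennreal (c\<^sup>2 * card I) * smean (\<lambda>z. \<Sum>i\<in>I. (cmod (G i z))\<^sup>2) t"
      by (rule smean_cmult) (auto intro!: continuous_intros G)
    also have "smean (\<lambda>z. \<Sum>i\<in>I. (cmod (G i z))\<^sup>2) t = (\<Sum>i\<in>I. sq_mean (G i) t)"
      by (rule smean_sum[OF I]) (auto intro!: continuous_intros G)
    finally show "sq_mean F t \<le> ennreal (c\<^sup>2 * card I) * (\<Sum>i\<in>I. sq_mean (G i) t)" .
  qed
  also have "\<dots> < \<infinity>"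
    using G(2) I by (auto simp: ennreal_mult_less_top)
  finally show ?thesis .
qed

lemma bounded_on_smaller_ball:
  fixes f :: "complex ^ 'd \<Rightarrow> complex"
  assumes f: "f \<in> Hol" and r: "0 \<le> r" "r < 1"
  obtains C where "C \<ge> 0" "\<And>z. norm z \<le> r \<Longrightarrow> cmod (f z) \<le> C"
proof -
  have "compact (f ` cball 0 r)"
    using r by (intro compact_continuous_image continuous_on_subset[OF hol_on_imp_continuous_on[OF f]]) auto
  then obtain C where C: "\<And>z. z \<in> cball 0 r \<Longrightarrow> cmod (f z) \<le> C"
    using compact_imp_bounded bounded_iff by (metis imageI)
  show ?thesis
    by (rule that[of "max 0 C"]) (use C in \<open>auto simp: le_max_iff_disj\<close>)
qed

text \<open>Split \<open>f\<close> into the difference with its dilation by \<open>exp (-1)\<close>, which is controlled by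
  \<open>radial_deriv f\<close>, and the dilation itself, which is bounded.\<close>

lemma L2_norm2_radial_antiderivative:
  fixes f :: "complex ^ 'd \<Rightarrow> complex"
  assumes \<mu>: "admissible \<mu>" and f: "f \<in> Hol" and fin: "L2_norm2 \<mu> (radial_deriv f) < \<infinity>"
  shows "L2_norm2 \<mu> f < \<infinity>"
proof -
  define D where "D = (\<lambda>z. f z - f (exp (-1) *\<^sub>R z))"
  have e: "0 \<le> exp (-1::real)" "exp (-1::real) < 1" by auto
  have D: "D \<in> Hol" unfolding D_def using e by (intro Hol_diff f Hol_scaleR) auto
  obtain C where C: "C \<ge> 0" "\<And>z. norm z \<le> exp (-1) \<Longrightarrow> cmod (f z) \<le> C"
    using bounded_on_smaller_ball[OF f e] by blast
  have "L2_norm2 \<mu> D \<le> 1 * L2_norm2 \<mu> (radial_deriv f)"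
  proof (rule L2_norm2_le[OF \<mu>])
    fix t :: real assume t: "0 \<le> t" "t < 1"
    have "smean (\<lambda>z. cmod (f z - f (exp (-1) *\<^sub>R z)) ^ 2) t \<le> ennreal (1 ^ 2) * sq_mean (radial_deriv f) t"
      by (rule smean_radial_difference[OF f _ _ t]) (use t in \<open>auto intro: smean_square_mono Hol_radial_deriv f\<close>)
    then show "sq_mean D t \<le> 1 * sq_mean (radial_deriv f) t"
      by (simp add: D_def)
  qed (auto intro: hol_on_imp_continuous_on D Hol_radial_deriv f)
  then have D2: "L2_norm2 \<mu> D < \<infinity>" using fin by simp
  show ?thesis
  proof (rule L2_norm2_finite_sum[OF \<mu> hol_on_imp_continuous_on[OF f], of "{True, False}" "\<lambda>b z. if b then D z else of_real C" 1])
    fix z :: "complex ^ 'd" assume z: "z \<in> uball"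
    have "norm (exp (-1) *\<^sub>R z) \<le> exp (-1)" using z by simp
    then have "cmod (f (exp (-1) *\<^sub>R z)) \<le> C" by (rule C(2))
    then show "cmod (f z) \<le> 1 * (\<Sum>b\<in>{True, False}. cmod (if b then D z else of_real C))"
      using norm_triangle_ineq[of "D z" "f (exp (-1) *\<^sub>R z)"] C by (simp add: D_def)
  next
    fix b :: bool
    show "continuous_on uball (\<lambda>z. if b then D z else of_real C)"
      using hol_on_imp_continuous_on[OF D] by (cases b) auto
    show "L2_norm2 \<mu> (\<lambda>z :: complex ^ 'd. if b then D z else of_real C) < \<infinity>"
      using D2 L2_norm2_const_finite[OF \<mu>] by (cases b) auto
  qed auto
qed

lemma Besov_L2_radial_deriv:
  assumes \<mu>: "admissible \<mu>" and f: "f \<in> Besov \<mu> N" and "j \<le> N"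
  shows "L2_norm2 \<mu> ((radial_deriv ^^ j) f) < \<infinity>"
  using \<open>j \<le> N\<close>
proof (induction rule: inc_induct)
  case base
  then show ?case using f by (simp add: Besov_def)
next
  case (step n)
  show ?case
    by (rule L2_norm2_radial_antiderivative[OF \<mu>])
       (use step f in \<open>auto simp: Besov_def intro: Hol_radial_deriv_pow\<close>)
qed

text \<open>By Leibniz' rule, since the lower radial derivatives of a function in the Besov space are square
  integrable as well.\<close>

lemma Mult_bounded_radial_derivs:
  fixes g :: "complex ^ 'd \<Rightarrow> complex"
  assumes \<mu>: "admissible \<mu>" and g: "g \<in> Hol"
    and C: "\<And>j z. j \<le> N \<Longrightarrow> z \<in> uball \<Longrightarrow> cmod ((radial_deriv ^^ j) g z) \<le> C"
  shows "g \<in> Mult (Besov \<mu> N)"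
  unfolding Mult_def
proof (intro CollectI ballI)
  fix f :: "complex ^ 'd \<Rightarrow> complex" assume f: "f \<in> Besov \<mu> N"
  then have fH: "f \<in> Hol" by (simp add: Besov_def)
  have "L2_norm2 \<mu> ((radial_deriv ^^ N) (\<lambda>z. g z * f z)) < \<infinity>"
  proof (rule L2_norm2_finite_sum[OF \<mu>, of _ "{0..N}" "\<lambda>i. (radial_deriv ^^ (N - i)) f" "2 ^ N * C"])
    fix z :: "complex ^ 'd" assume z: "z \<in> uball"
    have "C \<ge> 0" using order_trans[OF norm_ge_zero C[of 0 z]] z by simp
    have "cmod ((radial_deriv ^^ N) (\<lambda>z. g z * f z) z)
       \<le> (\<Sum>i = 0..N. cmod (of_nat (N choose i) * (radial_deriv ^^ i) g z * (radial_deriv ^^ (N - i)) f z))"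
      unfolding radial_deriv_pow_mult[OF g fH z] by (rule norm_sum)
    also have "\<dots> \<le> (\<Sum>i = 0..N. 2 ^ N * C * cmod ((radial_deriv ^^ (N - i)) f z))"
    proof (rule sum_mono)
      fix i assume "i \<in> {0..N}"
      then have Ci: "cmod ((radial_deriv ^^ i) g z) \<le> C" using C z by simp
      have "real (N choose i) \<le> real (2 ^ N)" by (rule of_nat_mono[OF binomial_le_pow2])
      then have "real (N choose i) * cmod ((radial_deriv ^^ i) g z) \<le> 2 ^ N * C"
        by (intro mult_mono Ci) auto
      then show "cmod (of_nat (N choose i) * (radial_deriv ^^ i) g z * (radial_deriv ^^ (N - i)) f z)
        \<le> 2 ^ N * C * cmod ((radial_deriv ^^ (N - i)) f z)"
        by (simp add: norm_mult mult_right_mono)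
    qed
    finally show "cmod ((radial_deriv ^^ N) (\<lambda>z. g z * f z) z) \<le> 2 ^ N * C * (\<Sum>i = 0..N. cmod ((radial_deriv ^^ (N - i)) f z))"
      by (simp add: sum_distrib_left)
  qed (use Besov_L2_radial_deriv[OF \<mu> f] fH g in \<open>auto intro!: hol_on_imp_continuous_on\<close>)
  then show "(\<lambda>z. g z * f z) \<in> Besov \<mu> N" using fH g by (auto simp: Besov_def)
qed

lemma Mult_dilation:
  fixes g :: "complex ^ 'd \<Rightarrow> complex"
  assumes \<mu>: "admissible \<mu>" and g: "g \<in> Hol" and r: "0 \<le> r" "r < 1"
  shows "(\<lambda>z. g (r *\<^sub>R z)) \<in> Mult (Besov \<mu> N)"
proof -
  have "\<exists>C. \<forall>z. norm z \<le> r \<longrightarrow> cmod ((radial_deriv ^^ j) g z) \<le> C" for j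
    using bounded_on_smaller_ball[OF Hol_radial_deriv_pow[OF g] r] by metis
  then obtain C where C: "\<And>j z. norm z \<le> r \<Longrightarrow> cmod ((radial_deriv ^^ j) g z) \<le> C j" by metis
  show ?thesis
  proof (rule Mult_bounded_radial_derivs[OF \<mu>, of _ _ "\<Sum>j\<le>N. \<bar>C j\<bar>"])
    show "(\<lambda>z. g (r *\<^sub>R z)) \<in> Hol" using r by (intro Hol_scaleR g) auto
    fix j and z :: "complex ^ 'd" assume j: "j \<le> N" and z: "z \<in> uball"
    have "norm (r *\<^sub>R z) \<le> r" using z r by (auto intro: mult_left_le)
    then have "cmod ((radial_deriv ^^ j) (\<lambda>z. g (r *\<^sub>R z)) z) \<le> \<bar>C j\<bar>"
      using r z C[of "r *\<^sub>R z" j] by (subst radial_deriv_pow_scaleR[OF g]) auto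
    also have "\<dots> \<le> (\<Sum>j\<le>N. \<bar>C j\<bar>)" using j by (intro member_le_sum) auto
    finally show "cmod ((radial_deriv ^^ j) (\<lambda>z. g (r *\<^sub>R z)) z) \<le> (\<Sum>j\<le>N. \<bar>C j\<bar>)" .
  qed
qed

section \<open>Uniform bounds for products with dilations\<close>

text \<open>With \<open>K\<close> as the price of one derivative, such bounds multiply under products: by Leibniz' rule
  only \<open>M\<close> changes. The estimate of a long product is thus reduced to choosing one \<open>K\<close> for all
  factors.\<close>

definition jet_le :: "nat \<Rightarrow> real \<Rightarrow> real \<Rightarrow> (complex ^ 'd \<Rightarrow> complex) \<Rightarrow> complex ^ 'd \<Rightarrow> bool" where
  "jet_le N K M F z \<longleftrightarrow> F \<in> Hol \<and> z \<in> uball \<and> K \<ge> 0 \<and> M \<ge> 0 \<and> (\<forall>j\<le>N. cmod ((radial_deriv ^^ j) F z) \<le> M * K ^ j)"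

lemma jet_le_mult:
  assumes F: "jet_le N K M F z" and G: "jet_le N K L G z"
  shows "jet_le N K (2 ^ N * M * L) (\<lambda>z. F z * G z) z"
  unfolding jet_le_def
proof (intro conjI allI impI)
  have nn: "K \<ge> 0" "M \<ge> 0" "L \<ge> 0" and z: "z \<in> uball" and H: "F \<in> Hol" "G \<in> Hol"
    using F G by (auto simp: jet_le_def)
  then show "(\<lambda>z. F z * G z) \<in> Hol" "z \<in> uball" "K \<ge> 0" "2 ^ N * M * L \<ge> 0" by auto
  fix j assume j: "j \<le> N"
  have "cmod ((radial_deriv ^^ j) (\<lambda>z. F z * G z) z)
     \<le> (\<Sum>i = 0..j. cmod (of_nat (j choose i) * (radial_deriv ^^ i) F z * (radial_deriv ^^ (j - i)) G z))"
    unfolding radial_deriv_pow_mult[OF H z] by (rule norm_sum)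
  also have "\<dots> \<le> (\<Sum>i = 0..j. real (j choose i) * (M * L * K ^ j))"
  proof (rule sum_mono)
    fix i assume i: "i \<in> {0..j}"
    have "cmod ((radial_deriv ^^ i) F z) * cmod ((radial_deriv ^^ (j - i)) G z) \<le> (M * K ^ i) * (L * K ^ (j - i))"
      using F G i j nn by (intro mult_mono) (auto simp: jet_le_def)
    also have "\<dots> = M * L * (K ^ i * K ^ (j - i))" by (simp add: mult_ac)
    also have "K ^ i * K ^ (j - i) = K ^ j" using i by (simp add: power_add[symmetric])
    finally show "cmod (of_nat (j choose i) * (radial_deriv ^^ i) F z * (radial_deriv ^^ (j - i)) G z) \<le> real (j choose i) * (M * L * K ^ j)"
      by (simp add: norm_mult mult.assoc mult_left_mono)
  qed
  also have "\<dots> = real (\<Sum>i = 0..j. j choose i) * (M * L * K ^ j)" by (simp add: sum_distrib_right)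
  also have "(\<Sum>i = 0..j. j choose i) = 2 ^ j" using choose_row_sum[of j] by (simp add: atLeast0AtMost)
  also have "real (2 ^ j) * (M * L * K ^ j) \<le> 2 ^ N * (M * L * K ^ j)"
    using j nn by (intro mult_right_mono) (auto intro: power_increasing)
  finally show "cmod ((radial_deriv ^^ j) (\<lambda>z. F z * G z) z) \<le> 2 ^ N * M * L * K ^ j" by (simp add: mult_ac)
qed

lemma jet_le_one: "z \<in> uball \<Longrightarrow> K \<ge> 0 \<Longrightarrow> jet_le N K 1 (\<lambda>z. 1) z"
  unfolding jet_le_def
proof (intro conjI allI impI)
  fix j assume "z \<in> uball" "K \<ge> 0"
  then show "cmod ((radial_deriv ^^ j) (\<lambda>z. 1) z) \<le> 1 * K ^ j"
    by (cases "j = 0") (auto simp: radial_deriv_pow_const)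
qed auto

lemma jet_le_power:
  assumes F: "jet_le N K M F z"
  shows "jet_le N K ((2 ^ N * M) ^ n) (\<lambda>z. F z ^ n) z"
proof (induction n)
  case 0
  then show ?case using F jet_le_one[of z K N] by (simp add: jet_le_def)
next
  case (Suc n)
  show ?case using jet_le_mult[OF F Suc] by (simp add: mult_ac)
qed

text \<open>Cauchy's estimate on the disc of radius \<open>a\<close> in the logarithmic coordinate: around the dilated
  point \<open>exp (-a) *\<^sub>R z\<close> the function \<open>H\<close> is still defined there. A bounded function of which
  nothing else is known thus pays \<open>1 / a\<close> for each derivative of its dilation.\<close>

lemma jet_le_dilation:
  fixes H :: "complex ^ 'd \<Rightarrow> complex"
  assumes H: "H \<in> Hol" and B: "\<And>z. z \<in> uball \<Longrightarrow> cmod (H z) \<le> B" and a: "a > 0" and z: "z \<in> uball"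
  shows "jet_le N (1 / a) (fact N * B) (\<lambda>z. H (exp (-a) *\<^sub>R z)) z"
proof -
  have B0': "B \<ge> 0" by (rule order_trans[OF norm_ge_zero B[OF z]])
  define w where "w = exp (-a) *\<^sub>R z"
  have w: "w \<in> uball" unfolding w_def using a z by (intro scaleR_in_ball) auto
  \<comment> \<open>\<open>exp \<zeta> * exp (-a)\<close> has absolute value at most \<open>1\<close>\<close>
  have dom: "\<zeta> \<in> edom w" if "cmod \<zeta> \<le> a" for \<zeta>
  proof -
    have "norm (exp \<zeta> *s w) = exp (Re \<zeta>) * exp (-a) * norm z"
      by (simp add: norm_vector_smult w_def norm_exp_eq_Re)
    also have "exp (Re \<zeta>) * exp (-a) \<le> 1"
      using complex_Re_le_cmod[of \<zeta>] that by (simp flip: exp_add)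
    then have "exp (Re \<zeta>) * exp (-a) * norm z \<le> 1 * norm z" by (rule mult_right_mono) auto
    finally show ?thesis using z by simp
  qed
  have hol: "eslice H w holomorphic_on edom w" by (rule eslice_holomorphic[OF H])
  have main: "cmod ((radial_deriv ^^ j) (\<lambda>z. H (exp (-a) *\<^sub>R z)) z) \<le> fact N * B * (1 / a) ^ j" if j: "j \<le> N" for j
  proof -
    have 1: "cmod ((deriv ^^ j) (eslice H w) 0) \<le> fact j * B / a ^ j"
    proof (rule Cauchy_inequality)
      show "eslice H w holomorphic_on ball 0 a" by (rule holomorphic_on_subset[OF hol]) (use dom in auto)
      show "continuous_on (cball 0 a) (eslice H w)"
        by (rule continuous_on_subset[OF holomorphic_on_imp_continuous_on[OF hol]]) (use dom in auto)
      show "cmod (eslice H w x) \<le> B" if "cmod (0 - x) = a" for x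
        unfolding eslice_def by (rule B) (use dom[of x] that in auto)
    qed (rule a)
    have 2: "fact j * B / a ^ j \<le> fact N * B / a ^ j"
      by (intro divide_right_mono mult_right_mono fact_mono) (use j B0' a in auto)
    have 3: "(deriv ^^ j) (eslice H w) 0 = (radial_deriv ^^ j) H w"
      by (rule radial_deriv_pow_eq_deriv[OF H w, symmetric])
    have 4: "(radial_deriv ^^ j) (\<lambda>z. H (exp (-a) *\<^sub>R z)) z = (radial_deriv ^^ j) H w"
      unfolding w_def by (rule radial_deriv_pow_scaleR[OF H _ _ z]) (use a in auto)
    have "fact N * B * (1 / a) ^ j = fact N * B / a ^ j" by (simp add: power_divide)
    then show ?thesis unfolding 4 using 1 2 unfolding 3 by linarith
  qed
  have "(\<lambda>z. H (exp (-a) *\<^sub>R z)) \<in> Hol" using a by (intro Hol_scaleR H) auto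
  moreover have "0 \<le> 1 / a" "0 \<le> fact N * B" using a B0' by simp_all
  ultimately show ?thesis unfolding jet_le_def using main z by blast
qed

lemma radial_deriv_pow_diff:
  assumes "f \<in> Hol" "g \<in> Hol" "z \<in> uball"
  shows "(radial_deriv ^^ n) (\<lambda>z. f z - g z) z = (radial_deriv ^^ n) f z - (radial_deriv ^^ n) g z"
proof -
  have "(radial_deriv ^^ n) (\<lambda>z. f z + (-1) * g z) z = (radial_deriv ^^ n) f z + (radial_deriv ^^ n) (\<lambda>z. (-1) * g z) z"
    by (intro radial_deriv_pow_add Hol_cmult assms)
  also have "(radial_deriv ^^ n) (\<lambda>z. (-1) * g z) z = (-1) * (radial_deriv ^^ n) g z"
    by (rule radial_deriv_pow_cmult) (use assms in auto)
  finally show ?thesis by simp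
qed

lemma jet_le_weaken:
  assumes "jet_le N K M F z" "K \<le> K'" "M \<le> M'"
  shows "jet_le N K' M' F z"
proof -
  have "cmod ((radial_deriv ^^ j) F z) \<le> M' * K' ^ j" if "j \<le> N" for j
  proof -
    have "cmod ((radial_deriv ^^ j) F z) \<le> M * K ^ j" using assms(1) that by (simp add: jet_le_def)
    also have "\<dots> \<le> M' * K' ^ j"
      using assms by (intro mult_mono power_mono) (auto simp: jet_le_def)
    finally show ?thesis .
  qed
  then show ?thesis using assms unfolding jet_le_def by (meson order_trans)
qed

lemma sum_power_le:
  fixes x :: "'i \<Rightarrow> real"
  assumes "finite I" "\<And>i. i \<in> I \<Longrightarrow> x i \<ge> 0" "p \<ge> 1"
  shows "(\<Sum>i\<in>I. x i) ^ p \<le> real (card I) ^ p * (\<Sum>i\<in>I. x i ^ p)"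
proof (cases "I = {}")
  case True
  then show ?thesis using assms(3) by (simp add: power_0_left)
next
  case False
  define m where "m = Max (x ` I)"
  have "m \<in> x ` I" unfolding m_def using assms(1) False by (intro Max_in) auto
  then obtain i0 where i0: "i0 \<in> I" "m = x i0" by auto
  have "(\<Sum>i\<in>I. x i) \<le> real (card I) * m"
    using sum_bounded_above[of I x m] assms(1) by (simp add: m_def)
  then have "(\<Sum>i\<in>I. x i) ^ p \<le> (real (card I) * m) ^ p"
    using assms by (intro power_mono sum_nonneg) auto
  also have "\<dots> = real (card I) ^ p * x i0 ^ p" by (simp add: power_mult_distrib i0)
  also have "\<dots> \<le> real (card I) ^ p * (\<Sum>i\<in>I. x i ^ p)"
    using assms i0 by (intro mult_left_mono member_le_sum) auto
  finally show ?thesis .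
qed

lemma add3_power_le:
  fixes x y v :: real
  assumes "x \<ge> 0" "y \<ge> 0" "v \<ge> 0" "p \<ge> 1"
  shows "(x + y + v) ^ p \<le> 3 ^ p * (x ^ p + y ^ p + v ^ p)"
  using sum_power_le[of "{0, 1, 2::nat}" "\<lambda>i. if i = 0 then x else if i = 1 then y else v" p] assms
  by (simp add: add.assoc)

text \<open>The roots give every term the same scaling behaviour as one derivative, so \<open>jet_size\<close> can serve
  as the parameter \<open>K\<close> of \<open>jet_le\<close>, see \<open>radial_deriv_le_jet_size\<close>.\<close>

definition jet_size :: "nat \<Rightarrow> (complex ^ 'd \<Rightarrow> complex) \<Rightarrow> complex ^ 'd \<Rightarrow> real" where
  "jet_size N f z = (\<Sum>b = 1..N. root b (cmod ((radial_deriv ^^ b) f z)))"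

lemma jet_size_nonneg [simp]: "jet_size N f z \<ge> 0"
  unfolding jet_size_def by (intro sum_nonneg) auto

lemma radial_deriv_le_jet_size:
  assumes "1 \<le> j" "j \<le> N"
  shows "cmod ((radial_deriv ^^ j) f z) \<le> jet_size N f z ^ j"
proof -
  have "root j (cmod ((radial_deriv ^^ j) f z)) \<le> jet_size N f z"
    unfolding jet_size_def using assms
    by (intro member_le_sum[of j "{1..N}" "\<lambda>b. root b (cmod ((radial_deriv ^^ b) f z))"]) auto
  then have "root j (cmod ((radial_deriv ^^ j) f z)) ^ j \<le> jet_size N f z ^ j"
    using assms by (intro power_mono) auto
  then show ?thesis using assms by simp
qed

text \<open>These are the terms of the binomial expansion of the dilation of \<open>H * \<psi> ^ m\<close> around \<open>\<psi>\<close>.\<close>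

abbreviation dilation_product ::
  "(complex ^ 'd \<Rightarrow> complex) \<Rightarrow> (complex ^ 'd \<Rightarrow> complex) \<Rightarrow> real \<Rightarrow> nat \<Rightarrow> nat \<Rightarrow> complex ^ 'd \<Rightarrow> complex" where
  "dilation_product H \<psi> a i n \<equiv> (\<lambda>z. H (exp (-a) *\<^sub>R z) * (\<psi> z ^ i * (\<psi> (exp (-a) *\<^sub>R z) - \<psi> z) ^ n))"

text \<open>The heart of the proof. The factor \<open>H (exp (-a) *\<^sub>R z)\<close> has derivatives as large as powers of
  \<open>1 / a\<close>, and each of \<open>N\<close> differences \<open>u\<close> has to compensate one factor \<open>1 / a\<close>. Let \<open>X\<close> be the
  sum that is raised to the power \<open>N\<close> on the right-hand side. With \<open>K = max X (1 / a)\<close> as the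
  price of a derivative, every factor of the product has a jet bound with a constant; but \<open>u\<close>
  satisfies it even with a constant multiple of \<open>s = X / K \<le> 1\<close>, because \<open>\<bar>u z\<bar> \<le> a * X\<close> and
  because the derivatives of \<open>\<psi>\<close> of order \<open>j \<ge> 1\<close> are at most \<open>X ^ j = s ^ j * K ^ j\<close>. So \<open>N\<close>
  derivatives of the product cost \<open>K ^ N\<close>, of which \<open>N\<close> factors \<open>u\<close> give back \<open>s ^ N\<close>, and
  \<open>s * K = X\<close>. The numerical constant is the one accumulated by \<open>jet_le_mult\<close> and \<open>jet_le_power\<close>.\<close>

lemma jet_product_bound:
  fixes \<psi> H :: "complex ^ 'd \<Rightarrow> complex"
  assumes \<psi>: "\<psi> \<in> Hol" "\<And>z. z \<in> uball \<Longrightarrow> cmod (\<psi> z) \<le> B" and B: "B \<ge> 1"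
    and H: "H \<in> Hol" "\<And>z. z \<in> uball \<Longrightarrow> cmod (H z) \<le> L"
    and a: "a > 0" and z: "z \<in> uball" and n: "N \<le> n"
  shows "cmod ((radial_deriv ^^ N) (dilation_product H \<psi> a i n) z)
    \<le> (2 ^ N * (fact N * L) * (2 ^ N * (2 ^ N * B) ^ i * (2 ^ N * (2 ^ N * (2 * B)) ^ N * (2 ^ N * (2 * B)) ^ (n - N))))
      * (jet_size N \<psi> z + jet_size N \<psi> (exp (-a) *\<^sub>R z) + cmod (\<psi> z - \<psi> (exp (-a) *\<^sub>R z)) / a) ^ N"
proof -
  define w where "w = exp (-a) *\<^sub>R z"
  define u where "u = (\<lambda>z. \<psi> (exp (-a) *\<^sub>R z) - \<psi> z)"
  define X where "X = jet_size N \<psi> z + jet_size N \<psi> w + cmod (\<psi> z - \<psi> w) / a"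
  define K where "K = max X (1 / a)"
  define s where "s = X / K"
  have w: "w \<in> uball" unfolding w_def using a z by (intro scaleR_in_ball) auto
  have X: "X \<ge> 0" using a by (auto simp: X_def)
  have K: "K > 0" "X \<le> K" "1 / a \<le> K" using a by (auto simp: K_def less_max_iff_disj)
  have s: "s \<ge> 0" "s \<le> 1" "s * K = X" using X K by (auto simp: s_def)
  have dil: "(\<lambda>z. \<psi> (exp (-a) *\<^sub>R z)) \<in> Hol" using a by (intro Hol_scaleR \<psi>) auto
  have jH: "jet_le N K (fact N * L) (\<lambda>z. H (exp (-a) *\<^sub>R z)) z"
    by (rule jet_le_weaken[OF jet_le_dilation[OF H a z]]) (use K in auto)
  \<comment> \<open>\<open>X\<close> dominates the jets at both points\<close>
  have jz: "cmod ((radial_deriv ^^ j) \<psi> z) \<le> X ^ j" "cmod ((radial_deriv ^^ j) \<psi> w) \<le> X ^ j" if "1 \<le> j" "j \<le> N" for j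
  proof -
    have "jet_size N \<psi> z ^ j \<le> X ^ j" "jet_size N \<psi> w ^ j \<le> X ^ j"
      using a by (auto simp: X_def intro!: power_mono)
    then show "cmod ((radial_deriv ^^ j) \<psi> z) \<le> X ^ j" "cmod ((radial_deriv ^^ j) \<psi> w) \<le> X ^ j"
      using radial_deriv_le_jet_size[OF that, of \<psi>] order_trans by blast+
  qed
  have j\<psi>: "jet_le N K B \<psi> z"
    unfolding jet_le_def
  proof (intro conjI allI impI)
    fix j assume j: "j \<le> N"
    show "cmod ((radial_deriv ^^ j) \<psi> z) \<le> B * K ^ j"
    proof (cases "j = 0")
      case True
      then show ?thesis using \<psi>(2)[OF z] by simp
    next
      case False
      then have "cmod ((radial_deriv ^^ j) \<psi> z) \<le> X ^ j" using j by (intro jz) auto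
      also have "\<dots> \<le> K ^ j" using X K by (intro power_mono) auto
      also have "\<dots> \<le> B * K ^ j" using mult_right_mono[OF B, of "K ^ j"] K by simp
      finally show ?thesis .
    qed
  qed (use \<psi> z K B in auto)
  have ju: "jet_le N K (2 * B * s) u z"
    unfolding jet_le_def
  proof (intro conjI allI impI)
    show "u \<in> Hol" unfolding u_def by (intro Hol_diff dil \<psi>)
    fix j assume j: "j \<le> N"
    have Ru: "(radial_deriv ^^ j) u z = (radial_deriv ^^ j) \<psi> w - (radial_deriv ^^ j) \<psi> z"
      unfolding u_def w_def using a
      by (subst radial_deriv_pow_diff[OF dil \<psi>(1) z], subst radial_deriv_pow_scaleR[OF \<psi>(1) _ _ z]) auto
    show "cmod ((radial_deriv ^^ j) u z) \<le> 2 * B * s * K ^ j"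
    proof (cases "j = 0")
      case True
      have "cmod (\<psi> w - \<psi> z) \<le> 2 * B * s"
      \<comment> \<open>If \<open>X \<le> 1 / a\<close> then \<open>s = a * X\<close> and the difference quotient in \<open>X\<close> decides; otherwise \<open>s = 1\<close>
        and the bound of \<open>\<psi>\<close> suffices.\<close>
      proof (cases "X \<le> 1 / a")
        case True
        then have "s = X * a" using a by (simp add: s_def K_def max_def)
        have "cmod (\<psi> w - \<psi> z) / a \<le> X" by (simp add: X_def norm_minus_commute)
        then have "cmod (\<psi> w - \<psi> z) \<le> s" using a \<open>s = X * a\<close> by (simp add: field_simps)
        also have "\<dots> \<le> 2 * B * s" using mult_right_mono[of 1 "2 * B" s] B s by simp
        finally show ?thesis .
      next
        case False
        then have "X > 0" using a X by (smt (verit) divide_pos_pos)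
        then have "s = 1" using False by (simp add: s_def K_def max_def)
        then show ?thesis using norm_triangle_ineq4[of "\<psi> w" "\<psi> z"] \<psi>(2)[OF z] \<psi>(2)[OF w] by simp
      qed
      then show ?thesis using True Ru by simp
    next
      case False
      then have "cmod ((radial_deriv ^^ j) u z) \<le> 2 * X ^ j"
        unfolding Ru using norm_triangle_ineq4[of "(radial_deriv ^^ j) \<psi> w" "(radial_deriv ^^ j) \<psi> z"] jz[of j] j by auto
      also have "X ^ j = s ^ j * K ^ j" unfolding s(3)[symmetric] by (rule power_mult_distrib)
      also have "2 * (s ^ j * K ^ j) \<le> 2 * B * s * K ^ j"
      proof -
        have "s ^ j \<le> s ^ 1" using s False by (intro power_decreasing) auto
        also have "\<dots> \<le> B * s" using mult_right_mono[OF B s(1)] by simp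
        finally have "s ^ j * K ^ j \<le> (B * s) * K ^ j" using K by (intro mult_right_mono) auto
        then show ?thesis by simp
      qed
      finally show ?thesis .
    qed
  qed (use z K B s in auto)
  \<comment> \<open>for the factors \<open>u\<close> in excess of \<open>N\<close>\<close>
  have ju2: "jet_le N K (2 * B) u z"
  proof (rule jet_le_weaken[OF ju order_refl])
    show "2 * B * s \<le> 2 * B" using mult_left_mono[OF s(2), of "2 * B"] B by simp
  qed
  have un: "u x ^ N * u x ^ (n - N) = u x ^ n" for x using n by (simp flip: power_add)
  have "jet_le N K (2 ^ N * (fact N * L) * (2 ^ N * (2 ^ N * B) ^ i * (2 ^ N * (2 ^ N * (2 * B * s)) ^ N * (2 ^ N * (2 * B)) ^ (n - N))))
     (\<lambda>z. H (exp (-a) *\<^sub>R z) * (\<psi> z ^ i * (u z ^ N * u z ^ (n - N)))) z"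
    by (intro jet_le_mult jet_le_power jH j\<psi> ju ju2)
  then have "cmod ((radial_deriv ^^ N) (\<lambda>z. H (exp (-a) *\<^sub>R z) * (\<psi> z ^ i * u z ^ n)) z)
    \<le> (2 ^ N * (fact N * L) * (2 ^ N * (2 ^ N * B) ^ i * (2 ^ N * (2 ^ N * (2 * B * s)) ^ N * (2 ^ N * (2 * B)) ^ (n - N)))) * K ^ N"
    unfolding un jet_le_def by blast
  also have "\<dots> = (2 ^ N * (fact N * L) * (2 ^ N * (2 ^ N * B) ^ i * (2 ^ N * (2 ^ N * (2 * B)) ^ N * (2 ^ N * (2 * B)) ^ (n - N)))) * (s * K) ^ N"
    by (simp add: power_mult_distrib mult_ac)
  finally show ?thesis unfolding s(3) unfolding X_def w_def u_def .
qed

text \<open>Square \<open>jet_product_bound\<close>. The three parts of its right-hand side, raised to the power \<open>2 * N\<close>,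
  have means over the sphere of radius \<open>t\<close> that are bounded by the square mean of
  \<open>(radial_deriv ^^ N) \<psi>\<close>: the jets of \<open>\<psi>\<close> at \<open>z\<close> and at the dilated point by the
  Gagliardo--Nirenberg inequality, and the difference quotient by \<open>smean_radial_difference\<close> and
  that inequality for \<open>b = 1\<close>. Smaller spheres are harmless by \<open>smean_square_mono\<close>. The constant
  does not depend on \<open>a\<close>.\<close>

lemma smean_jet_product_bound:
  fixes B L :: real
  assumes N: "N \<ge> 1" and n: "N \<le> n" and B: "B \<ge> 1"
  shows "\<exists>C\<ge>0. \<forall>\<psi>\<in>Hol. \<forall>H\<in>Hol. (\<forall>z\<in>uball. cmod (\<psi> (z :: complex ^ 'd)) \<le> B) \<longrightarrow> (\<forall>z\<in>uball. cmod (H z) \<le> L) \<longrightarrow>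
    (\<forall>a>0. \<forall>t. 0 \<le> t \<longrightarrow> t < 1 \<longrightarrow>
    sq_mean ((radial_deriv ^^ N) (dilation_product H \<psi> a i n)) t
      \<le> ennreal C * sq_mean ((radial_deriv ^^ N) \<psi>) t)"
proof -
  have "\<forall>b. \<exists>K\<ge>0. b \<in> {1..N} \<longrightarrow> (\<forall>f\<in>Hol. (\<forall>z\<in>uball. cmod (f (z :: complex ^ 'd)) \<le> B) \<longrightarrow> (\<forall>t.
    smean (\<lambda>z. root b (cmod ((radial_deriv ^^ b) f z)) ^ (2 * N)) t \<le> ennreal K * sq_mean ((radial_deriv ^^ N) f) t))"
  proof
    fix b
    show "\<exists>K\<ge>0. b \<in> {1..N} \<longrightarrow> (\<forall>f\<in>Hol. (\<forall>z\<in>uball. cmod (f (z :: complex ^ 'd)) \<le> B) \<longrightarrow> (\<forall>t.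
      smean (\<lambda>z. root b (cmod ((radial_deriv ^^ b) f z)) ^ (2 * N)) t \<le> ennreal K * sq_mean ((radial_deriv ^^ N) f) t))"
    proof (cases "b \<in> {1..N}")
      case True
      then show ?thesis using smean_Gagliardo_Nirenberg[of b N B] by auto
    qed auto
  qed
  then obtain K where K: "\<And>b. K b \<ge> 0" "\<And>b f t. b \<in> {1..N} \<Longrightarrow> f \<in> Hol \<Longrightarrow> (\<And>z. z \<in> uball \<Longrightarrow> cmod (f (z :: complex ^ 'd)) \<le> B) \<Longrightarrow>
    smean (\<lambda>z. root b (cmod ((radial_deriv ^^ b) f z)) ^ (2 * N)) t \<le> ennreal (K b) * sq_mean ((radial_deriv ^^ N) f) t"
    by metis
  define C1 where "C1 = 2 ^ N * (fact N * L) * (2 ^ N * (2 ^ N * B) ^ i * (2 ^ N * (2 ^ N * (2 * B)) ^ N * (2 ^ N * (2 * B)) ^ (n - N)))"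
  define p where "p = 2 * N"
  define C2 where "C2 = C1\<^sup>2 * (3 ^ p * real N ^ p)"
  define KS where "KS = (\<Sum>b = 1..N. K b)"
  have C2: "C2 \<ge> 0" by (simp add: C2_def)
  have KS: "KS \<ge> 0" unfolding KS_def by (intro sum_nonneg K)
  show ?thesis
  proof (rule exI[of _ "C2 * (KS + KS + K 1)"], intro conjI ballI impI allI)
    show "0 \<le> C2 * (KS + KS + K 1)" using C2 KS K(1)[of 1] by simp
    fix \<psi> H :: "complex ^ 'd \<Rightarrow> complex" and a t :: real
    assume \<psi>: "\<psi> \<in> Hol" and H: "H \<in> Hol" and \<psi>B: "\<forall>z\<in>uball. cmod (\<psi> z) \<le> B" and HL: "\<forall>z\<in>uball. cmod (H z) \<le> L"
      and a: "a > 0" and t: "0 \<le> t" "t < 1"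
    define r where "r = exp (-a)"
    have r: "0 \<le> r" "r \<le> 1" using a by (auto simp: r_def)
    define Y where "Y = (\<lambda>b z. root b (cmod ((radial_deriv ^^ b) \<psi> z)) ^ p)"
    define V where "V = (\<lambda>z. cmod (\<psi> z - \<psi> (r *\<^sub>R z)) ^ p)"
    define D where "D = sq_mean ((radial_deriv ^^ N) \<psi>)"
    have p: "p \<ge> 1" using N by (simp add: p_def)
    have cY: "continuous_on uball (Y b)" for b
      unfolding Y_def by (intro continuous_on_power continuous_on_real_root continuous_on_norm hol_on_imp_continuous_on Hol_radial_deriv_pow \<psi>)
    have cYr: "continuous_on uball (\<lambda>z. Y b (r *\<^sub>R z))" for b
      by (rule continuous_on_compose2[OF cY]) (use scaleR_in_ball[OF r] in \<open>auto intro!: continuous_intros simp del: mem_ball_0\<close>)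
    have cV: "continuous_on uball V"
      unfolding V_def by (intro continuous_on_power continuous_on_norm hol_on_imp_continuous_on Hol_diff \<psi> Hol_scaleR r)
    have Y0: "Y b z \<ge> 0" for b z by (simp add: Y_def p_def)
    have V0: "V z \<ge> 0" for z by (simp add: V_def)
    have Dmono: "D t' \<le> D t" if "0 \<le> t'" "t' \<le> t" for t'
      unfolding D_def by (rule smean_square_mono[OF Hol_radial_deriv_pow[OF \<psi>] that t(2)])
    have YD: "smean (Y b) t' \<le> ennreal (K b) * D t" if "b \<in> {1..N}" "0 \<le> t'" "t' \<le> t" for b t'
    proof -
      have "smean (Y b) t' \<le> ennreal (K b) * D t'"
        unfolding Y_def D_def p_def by (rule K(2)[OF that(1) \<psi>]) (use \<psi>B in blast)
      also have "\<dots> \<le> ennreal (K b) * D t" by (intro mult_left_mono Dmono that) auto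
      finally show ?thesis .
    qed
    have sY: "smean (\<lambda>z. \<Sum>b = 1..N. Y b z) t \<le> ennreal KS * D t"
    proof -
      have "smean (\<lambda>z. \<Sum>b = 1..N. Y b z) t = (\<Sum>b = 1..N. smean (Y b) t)"
        by (rule smean_sum) (use cY Y0 in auto)
      also have "\<dots> \<le> (\<Sum>b = 1..N. ennreal (K b) * D t)" by (intro sum_mono YD) (use t in auto)
      also have "\<dots> = ennreal KS * D t" unfolding KS_def using K(1) by (simp add: sum_distrib_right[symmetric] sum_ennreal)
      finally show ?thesis .
    qed
    have sYr: "smean (\<lambda>z. \<Sum>b = 1..N. Y b (r *\<^sub>R z)) t \<le> ennreal KS * D t"
    proof -
      have rt: "0 \<le> r * t" "r * t \<le> t" using r t by (auto intro: mult_left_le_one_le)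
      have "smean (\<lambda>z. \<Sum>b = 1..N. Y b (r *\<^sub>R z)) t = (\<Sum>b = 1..N. smean (\<lambda>z. Y b (r *\<^sub>R z)) t)"
        by (rule smean_sum) (use cYr Y0 in auto)
      also have "\<dots> = (\<Sum>b = 1..N. smean (Y b) (r * t))" using r t by (simp add: smean_scaleR)
      also have "\<dots> \<le> (\<Sum>b = 1..N. ennreal (K b) * D t)" by (intro sum_mono YD rt) auto
      also have "\<dots> = ennreal KS * D t" unfolding KS_def using K(1) by (simp add: sum_distrib_right[symmetric] sum_ennreal)
      finally show ?thesis .
    qed
    \<comment> \<open>the difference quotient \<open>\<bar>\<psi> z - \<psi> (r *\<^sub>R z)\<bar> / a\<close>; here the factor \<open>a ^ p\<close> cancels\<close>
    have sV: "smean (\<lambda>z. inverse (a ^ p) * V z) t \<le> ennreal (K 1) * D t"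
    proof -
      have "smean V t \<le> ennreal (a ^ p) * (ennreal (K 1) * D t)"
        unfolding V_def r_def
      proof (rule smean_radial_difference[OF \<psi> a p t])
        fix t' assume "0 \<le> t'" "t' \<le> t"
        then show "smean (\<lambda>z. cmod (radial_deriv \<psi> z) ^ p) t' \<le> ennreal (K 1) * D t"
          using YD[of 1 t'] N by (simp add: Y_def)
      qed
      then have "ennreal (inverse (a ^ p)) * smean V t \<le> ennreal (inverse (a ^ p)) * (ennreal (a ^ p) * (ennreal (K 1) * D t))"
        by (rule mult_left_mono) simp
      also have "\<dots> = (ennreal (inverse (a ^ p)) * ennreal (a ^ p)) * (ennreal (K 1) * D t)" by (simp only: mult.assoc)
      also have "ennreal (inverse (a ^ p)) * ennreal (a ^ p) = 1"
        using a by (subst ennreal_mult'[symmetric]) auto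
      also have "ennreal (inverse (a ^ p)) * smean V t = smean (\<lambda>z. inverse (a ^ p) * V z) t"
        by (rule smean_cmult[OF cV, symmetric]) (use a in auto)
      finally show ?thesis by simp
    qed
    have pw: "(cmod ((radial_deriv ^^ N) (dilation_product H \<psi> a i n) z))\<^sup>2
       \<le> C2 * ((\<Sum>b = 1..N. Y b z) + (\<Sum>b = 1..N. Y b (r *\<^sub>R z)) + inverse (a ^ p) * V z)" if z: "z \<in> uball" for z
    proof -
      define x1 where "x1 = jet_size N \<psi> z"
      define x2 where "x2 = jet_size N \<psi> (r *\<^sub>R z)"
      define x3 where "x3 = cmod (\<psi> z - \<psi> (r *\<^sub>R z)) / a"
      have x: "x1 \<ge> 0" "x2 \<ge> 0" "x3 \<ge> 0" using a by (auto simp: x1_def x2_def x3_def)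
      have "cmod ((radial_deriv ^^ N) (dilation_product H \<psi> a i n) z)
        \<le> C1 * (x1 + x2 + x3) ^ N"
        unfolding C1_def x1_def x2_def x3_def r_def
        by (rule jet_product_bound[OF \<psi> _ B H _ a z n]) (use \<psi>B HL in blast)+
      then have "(cmod ((radial_deriv ^^ N) (dilation_product H \<psi> a i n) z))\<^sup>2
        \<le> (C1 * (x1 + x2 + x3) ^ N)\<^sup>2" by (rule power_mono) simp
      also have "\<dots> = C1\<^sup>2 * (x1 + x2 + x3) ^ p"
        by (simp add: power_mult_distrib p_def mult.commute[of 2] power_mult)
      also have "\<dots> \<le> C1\<^sup>2 * (3 ^ p * (x1 ^ p + x2 ^ p + x3 ^ p))"
        by (intro mult_left_mono add3_power_le x p) auto
      also have "\<dots> \<le> C1\<^sup>2 * (3 ^ p * (real N ^ p * (\<Sum>b = 1..N. Y b z) + real N ^ p * (\<Sum>b = 1..N. Y b (r *\<^sub>R z)) + real N ^ p * x3 ^ p))"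
      proof (intro mult_left_mono add_mono)
        show "x1 ^ p \<le> real N ^ p * (\<Sum>b = 1..N. Y b z)"
          using sum_power_le[of "{1..N}" "\<lambda>b. root b (cmod ((radial_deriv ^^ b) \<psi> z))" p] p by (simp add: x1_def jet_size_def Y_def)
        show "x2 ^ p \<le> real N ^ p * (\<Sum>b = 1..N. Y b (r *\<^sub>R z))"
          using sum_power_le[of "{1..N}" "\<lambda>b. root b (cmod ((radial_deriv ^^ b) \<psi> (r *\<^sub>R z)))" p] p by (simp add: x2_def jet_size_def Y_def)
        have "1 \<le> real N ^ p" using N by simp
        then show "x3 ^ p \<le> real N ^ p * x3 ^ p" using mult_right_mono[of 1 "real N ^ p" "x3 ^ p"] x by simp
      qed auto
      also have "\<dots> = C2 * ((\<Sum>b = 1..N. Y b z) + (\<Sum>b = 1..N. Y b (r *\<^sub>R z)) + x3 ^ p)"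
        by (simp add: C2_def algebra_simps)
      also have "x3 ^ p = inverse (a ^ p) * V z" by (simp add: x3_def V_def power_mult_distrib power_inverse divide_inverse mult.commute)
      finally show ?thesis .
    qed
    have "sq_mean ((radial_deriv ^^ N) (dilation_product H \<psi> a i n)) t
      \<le> smean (\<lambda>z. C2 * ((\<Sum>b = 1..N. Y b z) + (\<Sum>b = 1..N. Y b (r *\<^sub>R z)) + inverse (a ^ p) * V z)) t"
      by (rule smean_mono[OF pw])
    also have "\<dots> = ennreal C2 * smean (\<lambda>z. (\<Sum>b = 1..N. Y b z) + (\<Sum>b = 1..N. Y b (r *\<^sub>R z)) + inverse (a ^ p) * V z) t"
      by (intro smean_cmult continuous_on_add continuous_on_sum continuous_on_mult_left cY cYr cV C2)
    also have "smean (\<lambda>z. (\<Sum>b = 1..N. Y b z) + (\<Sum>b = 1..N. Y b (r *\<^sub>R z)) + inverse (a ^ p) * V z) t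
      = smean (\<lambda>z. \<Sum>b = 1..N. Y b z) t + smean (\<lambda>z. \<Sum>b = 1..N. Y b (r *\<^sub>R z)) t + smean (\<lambda>z. inverse (a ^ p) * V z) t"
    proof -
      have "smean (\<lambda>z. ((\<Sum>b = 1..N. Y b z) + (\<Sum>b = 1..N. Y b (r *\<^sub>R z))) + inverse (a ^ p) * V z) t
        = smean (\<lambda>z. (\<Sum>b = 1..N. Y b z) + (\<Sum>b = 1..N. Y b (r *\<^sub>R z))) t + smean (\<lambda>z. inverse (a ^ p) * V z) t"
        by (rule smean_add; (intro continuous_on_add continuous_on_sum continuous_on_mult_left cY cYr cV add_nonneg_nonneg sum_nonneg Y0 mult_nonneg_nonneg V0)?) (use a in auto)
      moreover have "smean (\<lambda>z. (\<Sum>b = 1..N. Y b z) + (\<Sum>b = 1..N. Y b (r *\<^sub>R z))) t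
        = smean (\<lambda>z. \<Sum>b = 1..N. Y b z) t + smean (\<lambda>z. \<Sum>b = 1..N. Y b (r *\<^sub>R z)) t"
        by (rule smean_add; intro continuous_on_sum cY cYr sum_nonneg Y0)
      ultimately show ?thesis by simp
    qed
    also have "ennreal C2 * (smean (\<lambda>z. \<Sum>b = 1..N. Y b z) t + smean (\<lambda>z. \<Sum>b = 1..N. Y b (r *\<^sub>R z)) t + smean (\<lambda>z. inverse (a ^ p) * V z) t)
      \<le> ennreal C2 * (ennreal KS * D t + ennreal KS * D t + ennreal (K 1) * D t)"
      by (intro mult_left_mono add_mono sY sYr sV) auto
    also have "\<dots> = ennreal (C2 * (KS + KS + K 1)) * D t"
      by (simp only: ennreal_mult'[OF C2] ennreal_plus KS K(1) add_nonneg_nonneg distrib_right mult.assoc)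
    finally show "sq_mean ((radial_deriv ^^ N) (dilation_product H \<psi> a i n)) t
      \<le> ennreal (C2 * (KS + KS + K 1)) * sq_mean ((radial_deriv ^^ N) \<psi>) t"
      by (simp add: D_def)
  qed
qed

lemma L2_norm2_jet_product_bound:
  fixes B L :: real
  assumes \<mu>: "admissible \<mu>" and N: "N \<ge> 1" and n: "N \<le> n"
    and \<psi>: "\<psi> \<in> Hol" "\<And>z. z \<in> uball \<Longrightarrow> cmod (\<psi> (z :: complex ^ 'd)) \<le> B"
    and H: "H \<in> Hol" "\<And>z. z \<in> uball \<Longrightarrow> cmod (H z) \<le> L"
  shows "\<exists>C\<ge>0. \<forall>a>0. L2_norm2 \<mu> ((radial_deriv ^^ N) (dilation_product H \<psi> a i n))
      \<le> ennreal C * L2_norm2 \<mu> ((radial_deriv ^^ N) \<psi>)"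
proof -
  obtain C where C: "C \<ge> 0" "\<And>a t. a > 0 \<Longrightarrow> 0 \<le> t \<Longrightarrow> t < 1 \<Longrightarrow>
    sq_mean ((radial_deriv ^^ N) (dilation_product H \<psi> a i n)) t
      \<le> ennreal C * sq_mean ((radial_deriv ^^ N) \<psi>) t"
  proof -
    have \<psi>B: "\<forall>z\<in>uball. cmod (\<psi> z) \<le> max 1 B" using \<psi>(2) by (auto simp: le_max_iff_disj)
    have HL: "\<forall>z\<in>uball. cmod (H z) \<le> L" using H(2) by auto
    show thesis
      using smean_jet_product_bound[OF N n max.cobounded1, of B L i]
    proof (elim exE conjE)
      fix C :: real
      assume "0 \<le> C" and *: "\<forall>\<psi>\<in>Hol. \<forall>H\<in>Hol. (\<forall>z\<in>uball. cmod (\<psi> (z :: complex ^ 'd)) \<le> max 1 B) \<longrightarrow> (\<forall>z\<in>uball. cmod (H z) \<le> L) \<longrightarrow>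
        (\<forall>a>0. \<forall>t. 0 \<le> t \<longrightarrow> t < 1 \<longrightarrow>
        sq_mean ((radial_deriv ^^ N) (dilation_product H \<psi> a i n)) t
          \<le> ennreal C * sq_mean ((radial_deriv ^^ N) \<psi>) t)"
      from *[rule_format, OF \<psi>(1) H(1)] \<psi>B HL show thesis
        by (intro that[OF \<open>0 \<le> C\<close>]) simp
    qed
  qed
  show ?thesis
  proof (rule exI[of _ C], intro conjI allI impI C(1))
    fix a :: real assume a: "a > 0"
    show "L2_norm2 \<mu> ((radial_deriv ^^ N) (dilation_product H \<psi> a i n))
      \<le> ennreal C * L2_norm2 \<mu> ((radial_deriv ^^ N) \<psi>)"
    proof (rule L2_norm2_le[OF \<mu> _ _ C(2)[OF a]])
      have "(\<lambda>z. H (exp (-a) *\<^sub>R z)) \<in> Hol" "(\<lambda>z. \<psi> (exp (-a) *\<^sub>R z)) \<in> Hol"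
        using a by (intro Hol_scaleR H \<psi>; simp)+
      then show "continuous_on uball ((radial_deriv ^^ N) (dilation_product H \<psi> a i n))"
        by (intro hol_on_imp_continuous_on Hol_radial_deriv_pow Hol_mult Hol_power Hol_diff \<psi>)
      show "continuous_on uball ((radial_deriv ^^ N) \<psi>)"
        by (intro hol_on_imp_continuous_on Hol_radial_deriv_pow \<psi>)
    qed
  qed
qed

section \<open>Point evaluations\<close>

lemma nn_circle_mean_square_mono:
  fixes r R :: real
  assumes g: "g holomorphic_on ball 0 R" and R: "R > 1" and r: "0 \<le> r" "r \<le> 1"
  shows "(\<integral>\<^sup>+\<theta>\<in>{0..2*pi}. ennreal ((cmod (g (r * cis \<theta>)))\<^sup>2) \<partial>lborel) \<le> (\<integral>\<^sup>+\<theta>\<in>{0..2*pi}. ennreal ((cmod (g (cis \<theta>)))\<^sup>2) \<partial>lborel)"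
proof -
  have cont: "continuous_on S (\<lambda>\<theta>. (cmod (g (complex_of_real s * cis \<theta>)))\<^sup>2)" if "0 \<le> s" "s \<le> 1" for s S
    by (intro continuous_intros continuous_on_compose2[OF holomorphic_on_imp_continuous_on[OF g]])
       (use that R in \<open>auto simp: norm_mult\<close>)
  show ?thesis
    using circle_mean_square_mono[OF assms] cont[OF r] cont[of 1]
    by (simp add: nn_integral_Icc_continuous ennreal_leI)
qed

lemma emeasure_lborel_ball_pos: "r > 0 \<Longrightarrow> emeasure lborel (ball (0 :: 'a :: euclidean_space) r) > 0"
  using open_not_negligible[of "ball (0 :: 'a) r"]
  by (auto simp: negligible_iff_null_sets null_sets_def zero_less_iff_neq_zero)

text \<open>The square of \<open>\<bar>F\<bar>\<close> has the sub-mean value property over Euclidean balls. A ball around \<open>z\<close> is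
  contained in the ball of radius \<open>t\<close> around \<open>0\<close>, and there every point may be moved outwards to
  the sphere of radius \<open>t\<close>, since square means over circles increase. As \<open>sphere_measure\<close> is the
  image of Lebesgue measure under \<open>sgn\<close>, the result is a spherical mean.\<close>

lemma point_evaluation_smean:
  assumes \<rho>: "0 \<le> \<rho>" "\<rho> < t" "t < 1"
  shows "\<exists>C\<ge>0. \<forall>F\<in>Hol. \<forall>z. norm (z :: complex ^ 'd) \<le> \<rho> \<longrightarrow> ennreal ((cmod (F z))\<^sup>2) \<le> ennreal C * sq_mean F t"
proof -
  \<comment> \<open>the ball of radius \<open>t * \<delta>\<close> around \<open>z\<close> lies in the ball of radius \<open>t\<close> around \<open>0\<close>\<close>
  define \<delta> where "\<delta> = 1 - \<rho> / t"
  have \<delta>: "\<delta> > 0" "t * \<delta> = t - \<rho>" using \<rho> by (auto simp: \<delta>_def field_simps)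
  define v where "v = measure lborel (ball (0 :: complex ^ 'd) \<delta>)"
  define w where "w = measure lborel (ball (0 :: complex ^ 'd) 1)"
  have v1: "emeasure lborel (ball (0 :: complex ^ 'd) \<delta>) = ennreal v"
    unfolding v_def by (rule emeasure_eq_ennreal_measure) (use emeasure_lborel_ball_finite[of "0 :: complex ^ 'd" \<delta>] in simp)
  have "v > 0"
    using emeasure_lborel_ball_pos[OF \<delta>(1), where 'a = "complex ^ 'd"] unfolding v1 by simp
  note v = v1 this
  have w1: "emeasure lborel (ball (0 :: complex ^ 'd) 1) = ennreal w"
    unfolding w_def by (rule emeasure_eq_ennreal_measure) (use emeasure_lborel_ball_finite[of "0 :: complex ^ 'd" 1] in simp)
  have "w > 0"
    using emeasure_lborel_ball_pos[OF zero_less_one, where 'a = "complex ^ 'd"] unfolding w1 by simp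
  note w = w1 this
  show ?thesis
  proof (rule exI[of _ "w / v"], intro conjI ballI allI impI)
    show "0 \<le> w / v" using v w by simp
    fix F :: "complex ^ 'd \<Rightarrow> complex" and z :: "complex ^ 'd" assume F: "F \<in> Hol" and z: "norm z \<le> \<rho>"
    define cut where "cut = (\<lambda>z. ennreal (indicator uball z * (cmod (F z))\<^sup>2))"
    have cut_m [measurable]: "cut \<in> borel_measurable borel"
      unfolding cut_def by (intro measurable_compose[OF borel_measurable_cutoff] continuous_on_cmod_square F) simp
    have cut_eq: "cut x = ennreal ((cmod (F x))\<^sup>2)" if "norm x < 1" for x
      using that by (simp add: cut_def)
    have [measurable]: "ball 0 \<delta> \<in> sets (borel :: (complex ^ 'd) measure)" "ball 0 1 \<in> sets (borel :: (complex ^ 'd) measure)"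
      by simp_all
    have sgn_meas [measurable]: "sgn \<in> borel_measurable (borel :: (complex ^ 'd) measure)"
      unfolding sgn_div_norm by measurable
    \<comment> \<open>sub-mean value property; on circles it is \<open>nn_circle_mean_square_mono\<close> with radius \<open>0\<close>\<close>
    have step1: "ennreal ((cmod (F z))\<^sup>2) * ennreal v \<le> (\<integral>\<^sup>+x. cut (z + t *\<^sub>R x) * indicator (ball 0 \<delta>) x \<partial>lborel)"
    proof -
      have "(\<integral>\<^sup>+x. ennreal ((cmod (F z))\<^sup>2) * indicator (ball 0 \<delta>) (x :: complex ^ 'd) \<partial>lborel)
         \<le> 1 * (\<integral>\<^sup>+x. cut (z + t *\<^sub>R x) * indicator (ball 0 \<delta>) x \<partial>lborel)"
      proof (rule rotation_invariant_compare[OF rotation_invariant_lborel,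
          of "\<lambda>x. ennreal ((cmod (F z))\<^sup>2) * indicator (ball 0 \<delta>) x" "\<lambda>x. cut (z + t *\<^sub>R x) * indicator (ball 0 \<delta>) x" 1])
        fix x :: "complex ^ 'd"
        show "(\<integral>\<^sup>+\<theta>\<in>{0..2*pi}. (ennreal ((cmod (F z))\<^sup>2) * indicator (ball 0 \<delta>) (cis \<theta> *s x)) \<partial>lborel)
          \<le> 1 * (\<integral>\<^sup>+\<theta>\<in>{0..2*pi}. (cut (z + t *\<^sub>R (cis \<theta> *s x)) * indicator (ball 0 \<delta>) (cis \<theta> *s x)) \<partial>lborel)"
        proof (cases "norm x < \<delta>")
          case True
          \<comment> \<open>the function on the line extends holomorphically beyond the unit circle\<close>
          define R where "R = (1 - \<rho>) / (t - \<rho>)"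
          have R: "R > 1" using \<rho> by (simp add: R_def)
          have bd: "norm (l *s (t *\<^sub>R x) + z) < 1" if "cmod l < R" for l
          proof -
            have "norm (l *s (t *\<^sub>R x) + z) \<le> cmod l * (t * norm x) + norm z"
              using norm_triangle_ineq[of "l *s (t *\<^sub>R x)" z] \<rho> by (simp add: norm_vector_smult)
            also have "cmod l * (t * norm x) \<le> cmod l * (t - \<rho>)"
              using True \<rho> \<delta>(2) by (intro mult_left_mono) (auto simp flip: \<delta>(2))
            also have "cmod l * (t - \<rho>) < R * (t - \<rho>)" using that \<rho> by (intro mult_strict_right_mono) auto
            also have "R * (t - \<rho>) = 1 - \<rho>" using \<rho> by (simp add: R_def)
            finally show ?thesis using z by simp
          qed
          have "(\<lambda>l. F (l *s (t *\<^sub>R x) + z)) holomorphic_on ball 0 R"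
            by (rule Hol_line_holomorphic[OF F]) (use bd in auto)
          from nn_circle_mean_square_mono[OF this R order_refl zero_le_one]
          have "(\<integral>\<^sup>+\<theta>\<in>{0..2*pi}. ennreal ((cmod (F z))\<^sup>2) \<partial>lborel) \<le> (\<integral>\<^sup>+\<theta>\<in>{0..2*pi}. ennreal ((cmod (F (cis \<theta> *s (t *\<^sub>R x) + z)))\<^sup>2) \<partial>lborel)"
            by simp
          moreover have "cut (z + t *\<^sub>R (cis \<theta> *s x)) = ennreal ((cmod (F (cis \<theta> *s (t *\<^sub>R x) + z)))\<^sup>2)" for \<theta>
          proof -
            have eq: "z + t *\<^sub>R (cis \<theta> *s x) = cis \<theta> *s (t *\<^sub>R x) + z"
              by (simp add: scaleR_eq_smult vector_smult_assoc mult.commute add.commute)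
            have "norm (cis \<theta> *s (t *\<^sub>R x) + z) < 1" by (rule bd) (use R in simp)
            then show ?thesis unfolding eq by (rule cut_eq)
          qed
          ultimately show ?thesis using True by simp
        qed simp
      qed measurable
      then show ?thesis by (simp add: nn_integral_cmult_indicator v)
    qed
    \<comment> \<open>enlarge the domain and recentre it at \<open>0\<close>\<close>
    have step2: "(\<integral>\<^sup>+x. cut (z + t *\<^sub>R x) * indicator (ball 0 \<delta>) x \<partial>lborel) \<le> (\<integral>\<^sup>+y. cut (t *\<^sub>R y) * indicator (ball 0 1) y \<partial>lborel)"
    proof -
      define a where "a = (1 / t) *\<^sub>R z"
      have a: "t *\<^sub>R a = z" "norm a \<le> \<rho> / t" using \<rho> z by (auto simp: a_def field_simps)
      have "(\<integral>\<^sup>+x. cut (z + t *\<^sub>R x) * indicator (ball 0 \<delta>) x \<partial>lborel) \<le> (\<integral>\<^sup>+x. cut (t *\<^sub>R (a + x)) * indicator (ball 0 1) (a + x) \<partial>lborel)"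
      proof (rule nn_integral_mono)
        fix x :: "complex ^ 'd"
        have "norm (a + x) < 1" if "norm x < \<delta>"
          using norm_triangle_ineq[of a x] a(2) that by (simp add: \<delta>_def)
        then show "cut (z + t *\<^sub>R x) * indicator (ball 0 \<delta>) x \<le> cut (t *\<^sub>R (a + x)) * indicator (ball 0 1) (a + x)"
          by (auto simp: indicator_def scaleR_add_right a(1))
      qed
      also have "\<dots> = (\<integral>\<^sup>+y. cut (t *\<^sub>R y) * indicator (ball 0 1) y \<partial>(distr lborel borel ((+) a)))"
        by (subst nn_integral_distr) auto
      also have "\<dots> = (\<integral>\<^sup>+y. cut (t *\<^sub>R y) * indicator (ball 0 1) y \<partial>lborel)"
        by (simp only: lborel_distr_plus)
      finally show ?thesis .
    qed
    \<comment> \<open>push every point \<open>y\<close> out to \<open>sgn y\<close>, circle by circle\<close>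
    have step3: "(\<integral>\<^sup>+y. cut (t *\<^sub>R y) * indicator (ball 0 1) y \<partial>lborel) \<le> 1 * (\<integral>\<^sup>+y. cut (t *\<^sub>R sgn y) * indicator (ball 0 1) y \<partial>lborel)"
    proof (rule rotation_invariant_compare[OF rotation_invariant_lborel,
        of "\<lambda>y. cut (t *\<^sub>R y) * indicator (ball 0 1) y" "\<lambda>y. cut (t *\<^sub>R sgn y) * indicator (ball 0 1) y" 1])
      fix x :: "complex ^ 'd"
      show "(\<integral>\<^sup>+\<theta>\<in>{0..2*pi}. (cut (t *\<^sub>R (cis \<theta> *s x)) * indicator (ball 0 1) (cis \<theta> *s x)) \<partial>lborel)
        \<le> 1 * (\<integral>\<^sup>+\<theta>\<in>{0..2*pi}. (cut (t *\<^sub>R sgn (cis \<theta> *s x)) * indicator (ball 0 1) (cis \<theta> *s x)) \<partial>lborel)"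
      proof (cases "norm x < 1")
        case True
        have t: "0 < t" using \<rho> by simp
        have bd: "norm (l *s (t *\<^sub>R sgn x) + 0) < 1" if "cmod l < 1 / t" for l
          using that t by (simp add: norm_vector_smult norm_sgn field_simps)
        have "(\<lambda>l. F (l *s (t *\<^sub>R sgn x) + 0)) holomorphic_on ball 0 (1 / t)"
          by (rule Hol_line_holomorphic[OF F]) (use bd in auto)
        from nn_circle_mean_square_mono[OF this _ norm_ge_zero less_imp_le[OF True]]
        have "(\<integral>\<^sup>+\<theta>\<in>{0..2*pi}. ennreal ((cmod (F ((of_real (norm x) * cis \<theta>) *s (t *\<^sub>R sgn x) + 0)))\<^sup>2) \<partial>lborel)
          \<le> (\<integral>\<^sup>+\<theta>\<in>{0..2*pi}. ennreal ((cmod (F (cis \<theta> *s (t *\<^sub>R sgn x) + 0)))\<^sup>2) \<partial>lborel)"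
          using \<rho> t by simp
        moreover have "cut (t *\<^sub>R (cis \<theta> *s x)) = ennreal ((cmod (F ((of_real (norm x) * cis \<theta>) *s (t *\<^sub>R sgn x) + 0)))\<^sup>2)" for \<theta>
        proof -
          have "t *\<^sub>R (cis \<theta> *s x) = t *\<^sub>R (cis \<theta> *s (norm x *\<^sub>R sgn x))"
            by (cases "x = 0") (auto simp: sgn_div_norm)
          also have "\<dots> = (of_real (norm x) * cis \<theta>) *s (t *\<^sub>R sgn x) + 0"
            by (simp add: scaleR_eq_smult vector_smult_assoc mult_ac)
          finally have eq: "t *\<^sub>R (cis \<theta> *s x) = (of_real (norm x) * cis \<theta>) *s (t *\<^sub>R sgn x) + 0" .
          have "norm (t *\<^sub>R (cis \<theta> *s x)) < 1"
            using True t \<rho> mult_strict_mono[of t 1 "norm x" 1] by simp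
          then show ?thesis unfolding eq by (rule cut_eq)
        qed
        moreover have "cut (t *\<^sub>R sgn (cis \<theta> *s x)) = ennreal ((cmod (F (cis \<theta> *s (t *\<^sub>R sgn x) + 0)))\<^sup>2)" for \<theta>
        proof -
          have eq: "t *\<^sub>R sgn (cis \<theta> *s x) = cis \<theta> *s (t *\<^sub>R sgn x) + 0"
            by (simp add: sgn_div_norm scaleR_eq_smult vector_smult_assoc mult_ac)
          show ?thesis unfolding eq using bd[of "cis \<theta>"] \<rho> t by (intro cut_eq) auto
        qed
        ultimately show ?thesis using True by simp
      qed simp
    qed measurable
    \<comment> \<open>the definition of \<open>sphere_measure\<close>\<close>
    have step4: "(\<integral>\<^sup>+y. cut (t *\<^sub>R sgn y) * indicator (ball 0 1) y \<partial>lborel) = sq_mean F t * ennreal w"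
    proof -
      have "sq_mean F t = (\<integral>\<^sup>+y. cut (t *\<^sub>R y) \<partial>sphere_measure)"
        by (simp add: smean_def cut_def)
      also have "\<dots> = (\<integral>\<^sup>+y. cut (t *\<^sub>R sgn y) \<partial>uniform_measure lborel (ball 0 1))"
        unfolding sphere_measure_def by (subst nn_integral_distr) auto
      also have "\<dots> = (\<integral>\<^sup>+y. cut (t *\<^sub>R sgn y) * indicator (ball 0 1) y \<partial>lborel) / ennreal w"
        by (subst nn_integral_uniform_measure) (auto simp: w)
      finally have "sq_mean F t * ennreal w = (\<integral>\<^sup>+y. cut (t *\<^sub>R sgn y) * indicator (ball 0 1) y \<partial>lborel) / ennreal w * ennreal w"
        by simp
      also have "\<dots> = (\<integral>\<^sup>+y. cut (t *\<^sub>R sgn y) * indicator (ball 0 1) y \<partial>lborel) * ennreal w / ennreal w"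
        by (simp add: ennreal_times_divide mult.commute)
      also have "\<dots> = (\<integral>\<^sup>+y. cut (t *\<^sub>R sgn y) * indicator (ball 0 1) y \<partial>lborel)"
        by (rule mult_divide_eq_ennreal) (use w in auto)
      finally show ?thesis by simp
    qed
    have "ennreal ((cmod (F z))\<^sup>2) = ennreal (1 / v) * (ennreal ((cmod (F z))\<^sup>2) * ennreal v)"
      using v(2) by (simp add: ennreal_mult'[symmetric])
    also have "\<dots> \<le> ennreal (1 / v) * (sq_mean F t * ennreal w)"
      using step1 step2 step3 step4 by (intro mult_left_mono) auto
    also have "\<dots> = ennreal (w / v) * sq_mean F t"
    proof -
      have "ennreal (w / v) = ennreal (1 / v) * ennreal w" using v(2) w(2) by (simp add: ennreal_mult'[symmetric])
      then show ?thesis by (simp add: mult_ac)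
    qed
    finally show "ennreal ((cmod (F z))\<^sup>2) \<le> ennreal (w / v) * sq_mean F t" .
  qed
qed

text \<open>The spheres of radius larger than \<open>t\<close> have larger square means and, for an admissible \<open>\<mu>\<close>,
  positive total weight.\<close>

lemma smean_le_L2_norm2:
  fixes F :: "complex ^ 'd \<Rightarrow> complex"
  assumes \<mu>: "admissible \<mu>" and F: "F \<in> Hol" and t: "0 < t" "t < 1"
  shows "sq_mean F t * emeasure \<mu> {t<..1} \<le> L2_norm2 \<mu> F"
proof -
  have s: "sets \<mu> = sets (restrict_space borel {0..1})" using \<mu> by (auto simp: admissible_def)
  have space: "space \<mu> = {0..1}" using sets_eq_imp_space_eq[OF s] by (simp add: space_restrict_space)
  have m: "{t<..1} \<in> sets \<mu>" unfolding s using t by (subst sets_restrict_space_iff) auto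
  have "sq_mean F t * indicator {t<..1} s \<le> Imean F s" for s
  proof (cases "s \<in> {t<..1}")
    case True
    then show ?thesis using t F
      by (cases "s < 1") (auto simp: Imean_def H2_norm2_eq intro: smean_square_mono SUP_upper)
  qed simp
  then have "(\<integral>\<^sup>+s. sq_mean F t * indicator {t<..1} s \<partial>\<mu>) \<le> (\<integral>\<^sup>+s. Imean F s \<partial>\<mu>)"
    by (intro nn_integral_mono)
  then show ?thesis
    using m F \<mu> by (simp add: nn_integral_cmult_indicator L2_norm2_eq hol_on_imp_continuous_on)
qed

lemma point_evaluation_L2:
  assumes \<mu>: "admissible \<mu>" and \<rho>: "0 \<le> \<rho>" "\<rho> < 1"
  shows "\<exists>C\<ge>0. \<forall>F\<in>Hol. \<forall>z. norm (z :: complex ^ 'd) \<le> \<rho> \<longrightarrow> ennreal ((cmod (F z))\<^sup>2) \<le> ennreal C * L2_norm2 \<mu> F"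
proof -
  define t where "t = (1 + \<rho>) / 2"
  have t: "\<rho> < t" "0 < t" "t < 1" using \<rho> by (auto simp: t_def)
  interpret finite_measure \<mu> using \<mu> by (simp add: admissible_def)
  define m where "m = measure \<mu> {t<..1}"
  have "emeasure \<mu> {t<..1} > 0" using \<mu> t by (auto simp: admissible_def)
  then have m: "emeasure \<mu> {t<..1} = ennreal m" "m > 0"
    by (auto simp: m_def emeasure_eq_measure)
  obtain C where C: "C \<ge> 0" "\<And>F z. F \<in> Hol \<Longrightarrow> norm (z :: complex ^ 'd) \<le> \<rho> \<Longrightarrow> ennreal ((cmod (F z))\<^sup>2) \<le> ennreal C * sq_mean F t"
    using point_evaluation_smean[OF \<rho>(1) t(1,3), where 'd = 'd] by blast
  show ?thesis
  proof (rule exI[of _ "C / m"], intro conjI ballI allI impI)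
    show "0 \<le> C / m" using C m by simp
    fix F :: "complex ^ 'd \<Rightarrow> complex" and z :: "complex ^ 'd" assume F: "F \<in> Hol" and z: "norm z \<le> \<rho>"
    define S where "S = sq_mean F t"
    have one: "ennreal (1 / m) * ennreal m = 1" using m(2) by (simp add: ennreal_mult'[symmetric])
    have "ennreal ((cmod (F z))\<^sup>2) \<le> ennreal C * S" unfolding S_def by (rule C(2)[OF F z])
    also have "\<dots> = ennreal C * (ennreal (1 / m) * ennreal m) * S" unfolding one by simp
    also have "\<dots> = ennreal C * ennreal (1 / m) * (S * ennreal m)" by (simp only: mult_ac)
    also have "\<dots> \<le> ennreal C * ennreal (1 / m) * L2_norm2 \<mu> F"
      using smean_le_L2_norm2[OF \<mu> F t(2,3)] m by (intro mult_left_mono) (auto simp: S_def)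
    also have "ennreal C * ennreal (1 / m) = ennreal (C / m)"
      using C m by (simp add: ennreal_mult'[symmetric])
    finally show "ennreal ((cmod (F z))\<^sup>2) \<le> ennreal (C / m) * L2_norm2 \<mu> F" .
  qed
qed

text \<open>Along the disc \<open>l *s z\<close> the derivative in \<open>l\<close> has absolute value \<open>\<bar>radial_deriv f\<bar> / \<bar>l\<bar>\<close>. On
  \<open>\<bar>l\<bar> = 1\<close> this is at most \<open>A\<close>, and the maximum principle extends the bound to the whole disc, up
  to the centre.\<close>

lemma radial_antiderivative_sup:
  fixes f :: "complex ^ 'd \<Rightarrow> complex"
  assumes f: "f \<in> Hol" and \<rho>: "\<rho> < 1" and A: "\<And>z. norm z \<le> \<rho> \<Longrightarrow> cmod (radial_deriv f z) \<le> A" and z: "norm z \<le> \<rho>"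
  shows "cmod (f z - f 0) \<le> A"
proof -
  define S where "S = {l. l *s z + 0 \<in> uball}"
  define F where "F = (\<lambda>l. f (l *s z + 0))"
  have S: "open S"
  proof -
    have "open ((\<lambda>l. l *s z + 0) -` uball)" by (rule open_vimage) (auto intro!: continuous_intros)
    then show ?thesis by (simp add: S_def vimage_def)
  qed
  have sub: "cball 0 1 \<subseteq> S"
  proof
    fix l :: complex assume "l \<in> cball 0 1"
    then have "cmod l * norm z \<le> 1 * norm z" by (intro mult_right_mono) auto
    then show "l \<in> S" using z \<rho> by (simp add: S_def norm_vector_smult)
  qed
  have hol: "F holomorphic_on S"
    unfolding F_def by (rule Hol_line_holomorphic[OF f S]) (simp add: S_def)
  have hol': "deriv F holomorphic_on S" by (rule holomorphic_deriv[OF hol S])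
  have dF: "(F has_field_derivative deriv F l) (at l)" if "l \<in> S" for l
    using holomorphic_derivI[OF hol S that] .
  have edge: "cmod (deriv F l) \<le> A" if l: "cmod l = 1" for l
  proof -
    have "l \<in> cball 0 1" using l by simp
    then have "l \<in> S" using sub by blast
    then have lS: "l *s z + 0 \<in> uball" by (simp add: S_def)
    have "(F has_field_derivative cderiv f (l *s z + 0) z * 1) (at l)"
      unfolding F_def by (rule hol_on_curve[OF f, of "\<lambda>t. t" l z 0 1, OF lS DERIV_ident])
    then have "deriv F l = cderiv f (l *s z + 0) z" by (simp add: DERIV_imp_deriv)
    moreover have "radial_deriv f (l *s z + 0) = l * cderiv f (l *s z + 0) z"
      using radial_deriv_eq_cderiv[OF f lS] hol_on_has_derivative_cderiv(2)[OF f lS, of l z] by simp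
    ultimately have "cmod (deriv F l) = cmod (radial_deriv f (l *s z + 0))" using l by (simp add: norm_mult)
    also have "\<dots> \<le> A" by (rule A) (use l z in \<open>simp add: norm_vector_smult\<close>)
    finally show ?thesis .
  qed
  have inner: "cmod (deriv F l) \<le> A" if "l \<in> cball 0 1" for l
  proof (rule maximum_modulus_frontier[of "deriv F" "cball 0 1"])
    show "deriv F holomorphic_on interior (cball 0 1)"
      by (rule holomorphic_on_subset[OF hol']) (use sub in auto)
    show "continuous_on (closure (cball 0 1)) (deriv F)"
      by (rule continuous_on_subset[OF holomorphic_on_imp_continuous_on[OF hol']]) (use sub in auto)
  qed (use that edge in auto)
  have "cmod (F 1 - F 0) \<le> A * cmod (1 - 0)"
    by (rule field_differentiable_bound[of "cball 0 1" F "deriv F" A])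
       (use inner sub in \<open>auto intro!: has_field_derivative_at_within dF\<close>)
  then show ?thesis by (simp add: F_def)
qed

lemma radial_deriv_0: "radial_deriv f 0 = 0"
  by (simp add: radial_deriv_def)

text \<open>Evaluate \<open>(radial_deriv ^^ N) f\<close> by \<open>point_evaluation_L2\<close> and integrate \<open>N\<close> times. The
  intermediate radial derivatives vanish at \<open>0\<close>, so that only the constant \<open>f 0\<close> appears at the
  last step.\<close>

lemma point_evaluation_Besov:
  assumes \<mu>: "admissible \<mu>" and \<rho>: "0 \<le> \<rho>" "\<rho> < 1"
  shows "\<exists>C\<ge>0. \<forall>f\<in>Hol. \<forall>c\<ge>0. Besov_norm2 \<mu> N f \<le> ennreal c \<longrightarrow> (\<forall>z. norm (z :: complex ^ 'd) \<le> \<rho> \<longrightarrow> (cmod (f z))\<^sup>2 \<le> C * c)"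
proof -
  interpret finite_measure \<mu> using \<mu> by (simp add: admissible_def)
  obtain C where C: "C \<ge> 0" "\<And>F z. F \<in> Hol \<Longrightarrow> norm (z :: complex ^ 'd) \<le> \<rho> \<Longrightarrow> ennreal ((cmod (F z))\<^sup>2) \<le> ennreal C * L2_norm2 \<mu> F"
    using point_evaluation_L2[OF \<mu> \<rho>, where 'd = 'd] by blast
  define m where "m = measure \<mu> {0..1}"
  have "emeasure \<mu> {1/2<..1} > 0" using \<mu> by (auto simp: admissible_def)
  also have "emeasure \<mu> {1/2<..1} \<le> emeasure \<mu> {0..1}"
  proof (rule emeasure_mono)
    show "{0..1} \<in> sets \<mu>" using \<mu> by (simp add: admissible_def sets_restrict_space_iff)
  qed auto
  finally have m: "emeasure \<mu> {0..1} = ennreal m" "m > 0"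
    by (auto simp: m_def emeasure_eq_measure)
  show ?thesis
  proof (rule exI[of _ "2 / m + 2 * C"], intro conjI ballI allI impI)
    show "0 \<le> 2 / m + 2 * C" using C m by simp
    fix f :: "complex ^ 'd \<Rightarrow> complex" and c :: real and z :: "complex ^ 'd"
    assume f: "f \<in> Hol" and c: "c \<ge> 0" and Q: "Besov_norm2 \<mu> N f \<le> ennreal c" and z: "norm z \<le> \<rho>"
    define A where "A = sqrt (C * c)"
    have L2: "L2_norm2 \<mu> ((radial_deriv ^^ N) f) \<le> ennreal c"
      using Q order_trans[OF add_increasing[OF zero_le order_refl]] unfolding Besov_norm2_def by blast
    have f0: "(cmod (f 0))\<^sup>2 \<le> c / m"
    proof -
      have "ennreal m * ennreal ((cmod (f 0))\<^sup>2) \<le> ennreal c"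
        using Q order_trans[OF add_increasing2[OF zero_le order_refl]] unfolding Besov_norm2_def m(1) by blast
      then have "m * (cmod (f 0))\<^sup>2 \<le> c" using c m(2) by (simp add: ennreal_mult'[symmetric])
      then show ?thesis using m(2) by (simp add: field_simps)
    qed
    have top: "cmod ((radial_deriv ^^ N) f x) \<le> A" if "norm x \<le> \<rho>" for x
    proof -
      have "ennreal ((cmod ((radial_deriv ^^ N) f x))\<^sup>2) \<le> ennreal C * L2_norm2 \<mu> ((radial_deriv ^^ N) f)"
        by (rule C(2)[OF Hol_radial_deriv_pow[OF f] that])
      also have "\<dots> \<le> ennreal C * ennreal c" by (rule mult_left_mono[OF L2]) simp
      also have "\<dots> = ennreal (C * c)" by (rule ennreal_mult'[OF C(1), symmetric])
      finally have "(cmod ((radial_deriv ^^ N) f x))\<^sup>2 \<le> C * c" using C c by simp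
      then show ?thesis unfolding A_def by (rule real_le_rsqrt)
    qed
    have A0: "A \<ge> 0" unfolding A_def using C c by simp
    \<comment> \<open>the constant of integration is non-zero only at order \<open>0\<close>\<close>
    have "\<forall>x. norm x \<le> \<rho> \<longrightarrow> cmod ((radial_deriv ^^ (N - j)) f x) \<le> A + (if N - j = 0 then cmod (f 0) else 0)" for j
    proof (induction j)
      case 0
      show ?case using top by (auto intro: add_increasing2)
    next
      case (Suc j)
      show ?case
      proof (cases "N - j = 0")
        case True
        then show ?thesis using Suc by simp
      next
        case False
        then have Nj: "N - j = Suc (N - Suc j)" by simp
        show ?thesis
        proof (intro allI impI)
          fix x :: "complex ^ 'd" assume x: "norm x \<le> \<rho>"
          let ?g = "(radial_deriv ^^ (N - Suc j)) f"
          have "cmod (radial_deriv ?g y) \<le> A" if "norm y \<le> \<rho>" for y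
            using Suc that unfolding Nj by simp
          then have 1: "cmod (?g x - ?g 0) \<le> A"
            by (rule radial_antiderivative_sup[OF Hol_radial_deriv_pow[OF f] \<rho>(2) _ x])
          have 2: "?g 0 = (if N - Suc j = 0 then f 0 else 0)"
            by (cases "N - Suc j") (auto simp: radial_deriv_0)
          show "cmod (?g x) \<le> A + (if N - Suc j = 0 then cmod (f 0) else 0)"
            using norm_triangle_ineq[of "?g x - ?g 0" "?g 0"] 1 unfolding 2 by (auto split: if_splits)
        qed
      qed
    qed
    from this[of N] z have "cmod (f z) \<le> A + cmod (f 0)" by simp
    then have "(cmod (f z))\<^sup>2 \<le> (A + cmod (f 0))\<^sup>2" by (rule power_mono) simp
    also have "\<dots> \<le> 2 * A\<^sup>2 + 2 * (cmod (f 0))\<^sup>2"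
      using sum_squares_bound[of A "cmod (f 0)"] by (simp add: power2_sum)
    also have "\<dots> \<le> 2 * (C * c) + 2 * (c / m)" using f0 C c by (simp add: A_def)
    also have "\<dots> = (2 / m + 2 * C) * c" by (simp add: algebra_simps)
    finally show "(cmod (f z))\<^sup>2 \<le> (2 / m + 2 * C) * c" .
  qed
qed

section \<open>Scaling, series and limits\<close>

lemma L2_norm2_cong:
  assumes "admissible \<mu>" "F \<in> Hol" "\<And>z. z \<in> uball \<Longrightarrow> F z = G z"
  shows "L2_norm2 \<mu> F = L2_norm2 \<mu> G"
proof -
  have G: "G \<in> Hol" by (rule hol_on_cong[OF open_ball assms(3,2)])
  have "Imean F = Imean G"
  proof
    fix s
    have "sq_mean F = sq_mean G"
      by (intro ext smean_cong) (use assms(3) in simp)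
    then show "Imean F s = Imean G s" by (simp add: Imean_def H2_norm2_eq)
  qed
  then show ?thesis using assms(1,2) G by (simp add: L2_norm2_eq hol_on_imp_continuous_on)
qed

lemma L2_norm2_cmult:
  fixes F :: "complex ^ 'd \<Rightarrow> complex"
  assumes \<mu>: "admissible \<mu>" and F: "F \<in> Hol"
  shows "L2_norm2 \<mu> (\<lambda>z. k * F z) \<le> ennreal ((cmod k)\<^sup>2) * L2_norm2 \<mu> F"
proof (rule L2_norm2_le[OF \<mu>])
  fix t :: real
  show "sq_mean (\<lambda>z. k * F z) t \<le> ennreal ((cmod k)\<^sup>2) * sq_mean F t"
    using smean_cmult[OF continuous_on_cmod_square[OF F], of "(cmod k)\<^sup>2" t] by (simp add: norm_mult power_mult_distrib)
qed (use F in \<open>auto intro!: hol_on_imp_continuous_on\<close>)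

lemma Besov_norm2_cmult:
  fixes f :: "complex ^ 'd \<Rightarrow> complex"
  assumes \<mu>: "admissible \<mu>" and f: "f \<in> Hol"
  shows "Besov_norm2 \<mu> N (\<lambda>z. k * f z) \<le> ennreal ((cmod k)\<^sup>2) * Besov_norm2 \<mu> N f"
proof -
  have "L2_norm2 \<mu> ((radial_deriv ^^ N) (\<lambda>z. k * f z)) = L2_norm2 \<mu> (\<lambda>z. k * (radial_deriv ^^ N) f z)"
    by (rule L2_norm2_cong[OF \<mu>]) (use f radial_deriv_pow_cmult[OF f] in auto)
  also have "\<dots> \<le> ennreal ((cmod k)\<^sup>2) * L2_norm2 \<mu> ((radial_deriv ^^ N) f)"
    by (rule L2_norm2_cmult[OF \<mu> Hol_radial_deriv_pow[OF f]])
  finally have 1: "L2_norm2 \<mu> ((radial_deriv ^^ N) (\<lambda>z. k * f z)) \<le> ennreal ((cmod k)\<^sup>2) * L2_norm2 \<mu> ((radial_deriv ^^ N) f)" .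
  have 2: "emeasure \<mu> {0..1} * ennreal ((cmod (k * f 0))\<^sup>2) = ennreal ((cmod k)\<^sup>2) * (emeasure \<mu> {0..1} * ennreal ((cmod (f 0))\<^sup>2))"
    by (simp add: norm_mult power_mult_distrib ennreal_mult' mult_ac)
  show ?thesis unfolding Besov_norm2_def 2 distrib_left by (rule add_left_mono[OF 1])
qed

lemma suminf_tail_bound:
  fixes a :: "nat \<Rightarrow> 'a :: banach"
  assumes q: "0 \<le> q" "q < 1" and a: "\<And>k. norm (a k) \<le> M * q ^ k"
  shows "summable a" "norm (suminf a - (\<Sum>k<n. a k)) \<le> M * q ^ n / (1 - q)"
proof -
  have g: "(\<lambda>k. M * q ^ (k + n)) sums (M * q ^ n / (1 - q))" for n
    using sums_mult[OF geometric_sums, of q "M * q ^ n"] q by (simp add: power_add mult_ac divide_inverse)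
  show s: "summable a"
  proof (rule summable_comparison_test')
    show "summable (\<lambda>k. M * q ^ k)" using g[of 0] by (simp add: sums_iff)
    show "norm (a k) \<le> M * q ^ k" if "k \<ge> 0" for k by (rule a)
  qed
  have "suminf a - (\<Sum>k<n. a k) = (\<Sum>k. a (k + n))"
    using suminf_split_initial_segment[OF s, of n] by simp
  also have "norm \<dots> \<le> (\<Sum>k. M * q ^ (k + n))"
    by (rule norm_suminf_le[OF a sums_summable[OF g]])
  also have "\<dots> = M * q ^ n / (1 - q)" using g[of n] by (simp add: sums_iff)
  finally show "norm (suminf a - (\<Sum>k<n. a k)) \<le> M * q ^ n / (1 - q)" .
qed

text \<open>Termwise differentiation: by \<open>cderiv_bound\<close> the derivatives satisfy the same geometric bound on
  a smaller ball.\<close>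

lemma Hol_series:
  fixes f :: "nat \<Rightarrow> complex ^ 'd \<Rightarrow> complex"
  assumes f: "\<And>k. f k \<in> Hol" and q: "0 \<le> q" "q < 1"
    and M: "\<And>\<rho>. 0 \<le> \<rho> \<Longrightarrow> \<rho> < 1 \<Longrightarrow> \<exists>M. \<forall>k z. norm z \<le> \<rho> \<longrightarrow> cmod (f k z) \<le> M * q ^ k"
  shows "(\<lambda>z. \<Sum>k. f k z) \<in> Hol"
    and "0 \<le> \<rho> \<Longrightarrow> \<rho> < 1 \<Longrightarrow> uniform_limit (cball 0 \<rho>) (\<lambda>n z. \<Sum>k<n. f k z) (\<lambda>z. \<Sum>k. f k z) sequentially"
proof -
  show "uniform_limit (cball 0 \<rho>) (\<lambda>n z. \<Sum>k<n. f k z) (\<lambda>z. \<Sum>k. f k z) sequentially" if \<rho>: "0 \<le> \<rho>" "\<rho> < 1"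
  proof -
    obtain M where M: "\<And>k z. norm z \<le> \<rho> \<Longrightarrow> cmod (f k z) \<le> M * q ^ k" using M[OF \<rho>] by blast
    show ?thesis
      by (rule Weierstrass_m_test[of _ _ "\<lambda>k. M * q ^ k"]) (use M q in \<open>auto intro!: summable_mult summable_geometric\<close>)
  qed
  show "(\<lambda>z. \<Sum>k. f k z) \<in> Hol"
    unfolding hol_on_def
  proof (intro CollectI ballI)
    fix z :: "complex ^ 'd" assume "z \<in> uball"
    then have "norm z < 1" by simp
    then obtain \<rho> where \<rho>: "norm z < \<rho>" "\<rho> < 1" using dense[of "norm z" 1] by blast
    have \<rho>0: "0 \<le> \<rho>" using \<rho> norm_ge_zero[of z] by linarith
    obtain M where M1: "\<And>k z. norm z \<le> (1 + \<rho>) / 2 \<Longrightarrow> cmod (f k z) \<le> M * q ^ k"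
      using M[of "(1 + \<rho>) / 2"] \<rho> \<rho>0 by auto
    define C where "C = 2 * M / (1 - \<rho>)"
    have D: "cmod (cderiv (f k) x h) \<le> (C * norm h) * q ^ k" if "x \<in> ball 0 \<rho>" for x h k
    proof -
      have "cmod (cderiv (f k) x h) \<le> 2 * (M * q ^ k) / (1 - \<rho>) * norm h"
        by (rule cderiv_bound[OF f _ \<rho>(2)]) (use that M1 in auto)
      then show ?thesis by (simp add: C_def mult_ac)
    qed
    define g' where "g' = (\<lambda>x h. \<Sum>k. cderiv (f k) x h)"
    have "\<exists>g. \<forall>x\<in>ball 0 \<rho>. (\<lambda>n. f n x) sums g x \<and> (g has_derivative g' x) (at x within ball 0 \<rho>)"
    proof (rule has_derivative_series)
      show "(f n has_derivative cderiv (f n) x) (at x within ball 0 \<rho>)" if "x \<in> ball 0 \<rho>" for n x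
        by (rule has_derivative_at_withinI[OF hol_on_has_derivative_cderiv(1)[OF f]]) (use that \<rho> in auto)
      fix e :: real assume e: "e > 0"
      have "(\<lambda>n. C * q ^ n / (1 - q)) \<longlonglongrightarrow> C * 0 / (1 - q)"
        by (intro tendsto_intros LIMSEQ_realpow_zero q) (use q in auto)
      then have "\<forall>\<^sub>F n in sequentially. C * q ^ n / (1 - q) < e"
        using e by (auto dest: order_tendstoD(2))
      then show "\<forall>\<^sub>F n in sequentially. \<forall>x\<in>ball 0 \<rho>. \<forall>h. cmod ((\<Sum>i<n. cderiv (f i) x h) - g' x h) \<le> e * norm h"
      proof eventually_elim
        case (elim n)
        show ?case
        proof (intro ballI allI)
          fix x h :: "complex ^ 'd" assume "x \<in> ball 0 \<rho>"
          from suminf_tail_bound(2)[OF q D[OF this, of _ h], of n]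
          have "cmod ((\<Sum>i<n. cderiv (f i) x h) - g' x h) \<le> C * q ^ n / (1 - q) * norm h"
            by (simp add: g'_def norm_minus_commute mult_ac)
          also have "\<dots> \<le> e * norm h" using elim by (intro mult_right_mono) auto
          finally show "cmod ((\<Sum>i<n. cderiv (f i) x h) - g' x h) \<le> e * norm h" .
        qed
      qed
    next
      have "summable (\<lambda>k. f k z)"
        by (rule suminf_tail_bound(1)[OF q, of _ M]) (use M1 \<rho> in auto)
      then show "(\<lambda>k. f k z) sums (\<Sum>k. f k z)" by (rule summable_sums)
    qed (use \<rho> in auto)
    then obtain g where g: "\<And>x. x \<in> ball 0 \<rho> \<Longrightarrow> (\<lambda>n. f n x) sums g x"
      "\<And>x. x \<in> ball 0 \<rho> \<Longrightarrow> (g has_derivative g' x) (at x within ball 0 \<rho>)" by blast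
    have zin: "z \<in> ball 0 \<rho>" using \<rho> by simp
    have "(g has_derivative g' z) (at z)" using g(2)[OF zin] by (simp add: at_within_open[OF zin open_ball])
    then have "((\<lambda>z. \<Sum>k. f k z) has_derivative g' z) (at z)"
      by (rule has_derivative_transform_within_open[OF _ open_ball zin]) (use g(1) in \<open>auto simp: sums_iff\<close>)
    moreover have "g' z (c *s v) = c * g' z v" for c v
    proof -
      have "cderiv (f k) z (c *s v) = c * cderiv (f k) z v" for k
        by (rule hol_on_has_derivative_cderiv(2)[OF f]) (use \<rho> in auto)
      then show ?thesis unfolding g'_def using suminf_mult[OF suminf_tail_bound(1)[OF q D[OF zin]], of c v] by simp
    qed
    ultimately show "\<exists>D. ((\<lambda>z. \<Sum>k. f k z) has_derivative D) (at z) \<and> (\<forall>c v. D (c *s v) = c * D v)" by blast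
  qed
qed

text \<open>Weierstrass' theorem for the slices.\<close>

lemma radial_deriv_pow_limit:
  fixes f :: "complex ^ 'd \<Rightarrow> complex"
  assumes g: "\<And>n. g n \<in> Hol" and f: "f \<in> Hol" and z: "z \<in> uball"
    and lim: "\<And>\<rho>. 0 \<le> \<rho> \<Longrightarrow> \<rho> < 1 \<Longrightarrow> uniform_limit (cball 0 \<rho>) g f sequentially"
  shows "(\<lambda>n. (radial_deriv ^^ N) (g n) z) \<longlonglongrightarrow> (radial_deriv ^^ N) f z"
proof -
  have "norm z < 1" using z by simp
  then obtain \<rho> where \<rho>: "norm z < \<rho>" "\<rho> < 1" using dense[of "norm z" 1] by blast
  have \<rho>0: "0 \<le> \<rho>" using \<rho> norm_ge_zero[of z] by linarith
  define A where "A = {\<zeta>. exp \<zeta> *s z \<in> ball 0 \<rho>}"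
  have A: "open A"
  proof -
    have "open ((\<lambda>\<zeta>. exp \<zeta> *s z) -` ball 0 \<rho>)" by (rule open_vimage) (auto intro!: continuous_intros)
    then show ?thesis by (simp add: A_def vimage_def)
  qed
  have sub: "A \<subseteq> edom z" using \<rho> by (auto simp: A_def)
  have "(\<lambda>n. (deriv ^^ N) (eslice (g n) z) 0) \<longlonglongrightarrow> (deriv ^^ N) (eslice f z) 0"
  proof (rule higher_deriv_complex_uniform_limit[OF _ _ _ A])
    show "uniform_limit A (\<lambda>n. eslice (g n) z) (eslice f z) sequentially"
      unfolding uniform_limit_iff
    proof (intro allI impI)
      fix e :: real assume "e > 0"
      then have "\<forall>\<^sub>F n in sequentially. \<forall>x\<in>cball 0 \<rho>. dist (g n x) (f x) < e"
        using lim[OF \<rho>0 \<rho>(2)] by (auto simp: uniform_limit_iff)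
      then show "\<forall>\<^sub>F n in sequentially. \<forall>x\<in>A. dist (eslice (g n) z x) (eslice f z x) < e"
        by eventually_elim (auto simp: A_def eslice_def)
    qed
    show "\<forall>\<^sub>F n in sequentially. eslice (g n) z holomorphic_on A"
      using holomorphic_on_subset[OF eslice_holomorphic[OF g] sub] by simp
    show "0 \<in> A" using \<rho> by (simp add: A_def)
  qed auto
  then show ?thesis using g f z by (simp add: radial_deriv_pow_eq_deriv)
qed

section \<open>The Besov space and its multipliers\<close>

lemma L2_norm2_sum_le:
  fixes F :: "'i \<Rightarrow> complex ^ 'd \<Rightarrow> complex"
  assumes \<mu>: "admissible \<mu>" and I: "finite I" and F: "\<And>i. i \<in> I \<Longrightarrow> F i \<in> Hol"
  shows "L2_norm2 \<mu> (\<lambda>z. \<Sum>i\<in>I. F i z) \<le> ennreal (card I) * (\<Sum>i\<in>I. L2_norm2 \<mu> (F i))"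
proof (rule L2_norm2_le_sum[OF \<mu> _ I])
  show "continuous_on uball (\<lambda>z. \<Sum>i\<in>I. F i z)" by (intro hol_on_imp_continuous_on Hol_sum F)
  show "continuous_on uball (F i)" if "i \<in> I" for i by (intro hol_on_imp_continuous_on F that)
  fix t :: real
  have "sq_mean (\<lambda>z. \<Sum>i\<in>I. F i z) t \<le> smean (\<lambda>z. real (card I) * (\<Sum>i\<in>I. (cmod (F i z))\<^sup>2)) t"
  proof (rule smean_mono)
    fix z :: "complex ^ 'd"
    have "(cmod (\<Sum>i\<in>I. F i z))\<^sup>2 \<le> (\<Sum>i\<in>I. cmod (F i z))\<^sup>2"
      by (intro power_mono norm_sum norm_ge_zero)
    also have "\<dots> \<le> (\<Sum>i\<in>I. (cmod (F i z))\<^sup>2) * real (card I)" by (rule sum_squared_le_sum_of_squares)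
    finally show "(cmod (\<Sum>i\<in>I. F i z))\<^sup>2 \<le> real (card I) * (\<Sum>i\<in>I. (cmod (F i z))\<^sup>2)" by (simp add: mult.commute)
  qed
  also have "\<dots> = ennreal (card I) * smean (\<lambda>z. \<Sum>i\<in>I. (cmod (F i z))\<^sup>2) t"
    by (rule smean_cmult) (auto intro!: continuous_on_sum continuous_on_cmod_square F)
  also have "smean (\<lambda>z. \<Sum>i\<in>I. (cmod (F i z))\<^sup>2) t = (\<Sum>i\<in>I. sq_mean (F i) t)"
    by (rule smean_sum[OF I]) (auto intro!: continuous_on_cmod_square F)
  finally show "sq_mean (\<lambda>z. \<Sum>i\<in>I. F i z) t \<le> ennreal (card I) * (\<Sum>i\<in>I. sq_mean (F i) t)" .
qed

lemma Besov_norm2_parallelogram: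
  fixes f g :: "complex ^ 'd \<Rightarrow> complex"
  assumes \<mu>: "admissible \<mu>" and f: "f \<in> Hol" and g: "g \<in> Hol"
  shows "Besov_norm2 \<mu> N (\<lambda>z. f z + g z) + Besov_norm2 \<mu> N (\<lambda>z. f z - g z) \<le> 2 * Besov_norm2 \<mu> N f + 2 * Besov_norm2 \<mu> N g"
proof -
  let ?m = "emeasure \<mu> {0..1}"
  let ?R = "radial_deriv ^^ N"
  have "L2_norm2 \<mu> (?R (\<lambda>z. f z + g z)) = L2_norm2 \<mu> (\<lambda>z. ?R f z + ?R g z)"
    by (rule L2_norm2_cong[OF \<mu>]) (use f g radial_deriv_pow_add[OF f g] in auto)
  moreover have "L2_norm2 \<mu> (?R (\<lambda>z. f z - g z)) = L2_norm2 \<mu> (\<lambda>z. ?R f z - ?R g z)"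
    by (rule L2_norm2_cong[OF \<mu>]) (use f g radial_deriv_pow_diff[OF f g] in auto)
  ultimately have 1: "L2_norm2 \<mu> (?R (\<lambda>z. f z + g z)) + L2_norm2 \<mu> (?R (\<lambda>z. f z - g z)) \<le> 2 * L2_norm2 \<mu> (?R f) + 2 * L2_norm2 \<mu> (?R g)"
    using L2_norm2_parallelogram[OF \<mu> Hol_radial_deriv_pow[OF f] Hol_radial_deriv_pow[OF g], of N N] by simp
  have par: "(cmod (a + b))\<^sup>2 + (cmod (a - b))\<^sup>2 = 2 * (cmod a)\<^sup>2 + 2 * (cmod b)\<^sup>2" for a b
    by (simp add: cmod_power2) (simp add: power2_eq_square algebra_simps)
  have "ennreal ((cmod (f 0 + g 0))\<^sup>2) + ennreal ((cmod (f 0 - g 0))\<^sup>2) = 2 * ennreal ((cmod (f 0))\<^sup>2) + 2 * ennreal ((cmod (g 0))\<^sup>2)"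
    using arg_cong[OF par[of "f 0" "g 0"], of ennreal] by (simp add: ennreal_mult')
  then have 2: "?m * ennreal ((cmod (f 0 + g 0))\<^sup>2) + ?m * ennreal ((cmod (f 0 - g 0))\<^sup>2)
     = 2 * (?m * ennreal ((cmod (f 0))\<^sup>2)) + 2 * (?m * ennreal ((cmod (g 0))\<^sup>2))"
    by (metis (no_types, lifting) distrib_left mult.left_commute)
  have "Besov_norm2 \<mu> N (\<lambda>z. f z + g z) + Besov_norm2 \<mu> N (\<lambda>z. f z - g z)
    = (?m * ennreal ((cmod (f 0 + g 0))\<^sup>2) + ?m * ennreal ((cmod (f 0 - g 0))\<^sup>2))
      + (L2_norm2 \<mu> (?R (\<lambda>z. f z + g z)) + L2_norm2 \<mu> (?R (\<lambda>z. f z - g z)))"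
    by (simp add: Besov_norm2_def add_ac)
  also have "\<dots> \<le> (2 * (?m * ennreal ((cmod (f 0))\<^sup>2)) + 2 * (?m * ennreal ((cmod (g 0))\<^sup>2))) + (2 * L2_norm2 \<mu> (?R f) + 2 * L2_norm2 \<mu> (?R g))"
    unfolding 2 by (rule add_left_mono[OF 1])
  also have "\<dots> = 2 * Besov_norm2 \<mu> N f + 2 * Besov_norm2 \<mu> N g"
    by (simp add: Besov_norm2_def distrib_left add_ac)
  finally show ?thesis .
qed

lemma Besov_iff:
  fixes f :: "complex ^ 'd \<Rightarrow> complex"
  assumes \<mu>: "admissible \<mu>" shows "f \<in> Besov \<mu> N \<longleftrightarrow> f \<in> Hol \<and> Besov_norm2 \<mu> N f < \<infinity>"
proof -
  interpret finite_measure \<mu> using \<mu> by (simp add: admissible_def)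
  have "emeasure \<mu> {0..1} * ennreal ((cmod (f 0))\<^sup>2) < \<infinity>"
    by (auto simp: ennreal_mult_eq_top_iff less_top[symmetric] emeasure_finite)
  then show ?thesis by (auto simp: Besov_def Besov_norm2_def)
qed

lemma Besov_add:
  fixes f g :: "complex ^ 'd \<Rightarrow> complex"
  assumes \<mu>: "admissible \<mu>" and "f \<in> Besov \<mu> N" "g \<in> Besov \<mu> N" shows "(\<lambda>z. f z + g z) \<in> Besov \<mu> N"
proof -
  have fg: "f \<in> Hol" "g \<in> Hol" "Besov_norm2 \<mu> N f < \<infinity>" "Besov_norm2 \<mu> N g < \<infinity>"
    using assms by (auto simp: Besov_iff)
  have "Besov_norm2 \<mu> N (\<lambda>z. f z + g z) \<le> 2 * Besov_norm2 \<mu> N f + 2 * Besov_norm2 \<mu> N g"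
    by (rule order_trans[OF _ Besov_norm2_parallelogram[OF \<mu> fg(1,2)]]) simp
  also have "\<dots> < \<infinity>" using fg by (simp add: ennreal_mult_less_top)
  finally show ?thesis using fg \<mu> by (auto simp: Besov_iff)
qed

lemma Besov_cmult:
  fixes f :: "complex ^ 'd \<Rightarrow> complex"
  assumes \<mu>: "admissible \<mu>" and f: "f \<in> Besov \<mu> N" shows "(\<lambda>z. c * f z) \<in> Besov \<mu> N"
proof -
  have f': "f \<in> Hol" "Besov_norm2 \<mu> N f < \<infinity>" using assms by (auto simp: Besov_iff)
  have "Besov_norm2 \<mu> N (\<lambda>z. c * f z) \<le> ennreal ((cmod c)\<^sup>2) * Besov_norm2 \<mu> N f"
    by (rule Besov_norm2_cmult[OF \<mu> f'(1)])
  also have "\<dots> < \<infinity>" using f' by (simp add: ennreal_mult_less_top)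
  finally show ?thesis using f' \<mu> by (auto simp: Besov_iff)
qed

lemma Besov_const:
  assumes \<mu>: "admissible \<mu>" and N: "N \<ge> 1" shows "(\<lambda>z :: complex ^ 'd. c) \<in> Besov \<mu> N"
proof -
  have "L2_norm2 \<mu> ((radial_deriv ^^ N) (\<lambda>z :: complex ^ 'd. c)) = L2_norm2 \<mu> (\<lambda>z :: complex ^ 'd. 0)"
    by (rule L2_norm2_cong[OF \<mu>]) (use N in \<open>auto simp: radial_deriv_pow_const\<close>)
  then show ?thesis using L2_norm2_const_finite[OF \<mu>, of 0] by (simp add: Besov_def)
qed

lemma Mult_add:
  fixes f g :: "complex ^ 'd \<Rightarrow> complex"
  assumes "admissible \<mu>" "f \<in> Mult (Besov \<mu> N)" "g \<in> Mult (Besov \<mu> N)" shows "(\<lambda>z. f z + g z) \<in> Mult (Besov \<mu> N)"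
  unfolding Mult_def
proof (intro CollectI ballI)
  fix h :: "complex ^ 'd \<Rightarrow> complex" assume "h \<in> Besov \<mu> N"
  then have "(\<lambda>z. f z * h z) \<in> Besov \<mu> N" "(\<lambda>z. g z * h z) \<in> Besov \<mu> N"
    using assms(2,3) by (auto simp: Mult_def)
  from Besov_add[OF assms(1) this] show "(\<lambda>z. (f z + g z) * h z) \<in> Besov \<mu> N"
    by (simp add: distrib_right)
qed

lemma Mult_mult:
  assumes "f \<in> Mult S" "g \<in> Mult S" shows "(\<lambda>z. f z * g z) \<in> Mult S"
  using assms by (auto simp: Mult_def mult.assoc)

lemma Mult_const: "admissible \<mu> \<Longrightarrow> (\<lambda>z. c) \<in> Mult (Besov \<mu> N)"
  by (simp add: Mult_def Besov_cmult)

lemma Mult_power: "admissible \<mu> \<Longrightarrow> f \<in> Mult (Besov \<mu> N) \<Longrightarrow> (\<lambda>z. f z ^ n) \<in> Mult (Besov \<mu> N)"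
  by (induction n) (auto intro: Mult_const Mult_mult)

lemma Mult_diff:
  assumes "admissible \<mu>" "f \<in> Mult (Besov \<mu> N)" "g \<in> Mult (Besov \<mu> N)" shows "(\<lambda>z. f z - g z) \<in> Mult (Besov \<mu> N)"
  using Mult_add[OF assms(1,2) Mult_mult[OF Mult_const[OF assms(1), of "-1"] assms(3)]] by simp

lemma Mult_sum:
  assumes \<mu>: "admissible \<mu>" and "finite I" and "\<And>i. i \<in> I \<Longrightarrow> f i \<in> Mult (Besov \<mu> N)"
  shows "(\<lambda>z. \<Sum>i\<in>I. f i z) \<in> Mult (Besov \<mu> N)"
  using assms(2,3) by induction (auto intro: Mult_const[OF \<mu>] Mult_add[OF \<mu>])

lemma Mult_in_Besov: "admissible \<mu> \<Longrightarrow> N \<ge> 1 \<Longrightarrow> f \<in> Mult (Besov \<mu> N) \<Longrightarrow> f \<in> Besov \<mu> N"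
  using Besov_const[of \<mu> N 1] by (force simp: Mult_def)

section \<open>Multipliers are bounded functions\<close>

text \<open>A multiplication operator is bounded by uniform boundedness, and its norm bounds the symbol
  because kernel functions are eigenvectors of the adjoint. Both facts are merged in a gliding
  hump argument. Let \<open>e z\<close> be the norm of the evaluation at \<open>z\<close>. If \<open>\<bar>\<psi>\<bar> > 8 ^ n\<close> at \<open>zs n\<close>, take
  \<open>f n\<close> in the unit ball nearly extremal for the evaluation at \<open>zs n\<close> and form
  \<open>x = (\<Sum>n. \<plusminus> (1/4) ^ n * f n)\<close>. The signs can be chosen such that the first \<open>n\<close> terms do not
  cancel the next one at \<open>zs n\<close>, and the tail is at most a third of \<open>(1/4) ^ n * e (zs n)\<close>. Hence
  \<open>\<psi> * x\<close> is at \<open>zs n\<close> of size at least \<open>2 ^ n * e (zs n) / 6\<close> for every \<open>n\<close>, which is impossible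
  for a function of the space.\<close>

lemma Mult_bounded:
  fixes \<psi> :: "complex ^ 'd \<Rightarrow> complex"
  assumes \<mu>: "admissible \<mu>" and N: "N \<ge> 1" and \<psi>: "\<psi> \<in> Mult (Besov \<mu> N)"
  shows "\<exists>B. \<forall>z\<in>uball. cmod (\<psi> z) \<le> B"
proof (rule ccontr)
  assume "\<not> ?thesis"
  then have unb: "\<exists>z\<in>uball. cmod (\<psi> z) > B" for B by (meson not_le)
  let ?Q = "Besov_norm2 \<mu> N :: (complex ^ 'd \<Rightarrow> complex) \<Rightarrow> ennreal"
  define E where "E = (\<lambda>z. {cmod (f z) | f. f \<in> Hol \<and> ?Q f \<le> 1})"
  define e where "e = (\<lambda>z. Sup (E z))"
  \<comment> \<open>the unit ball of the space is bounded at each point, so that \<open>e z\<close> is finite\<close>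
  have local: "\<exists>C\<ge>0. \<forall>f\<in>Hol. ?Q f \<le> 1 \<longrightarrow> (\<forall>z. norm z \<le> \<rho> \<longrightarrow> cmod (f z) \<le> C)" if \<rho>: "0 \<le> \<rho>" "\<rho> < 1" for \<rho>
  proof -
    obtain C where C: "C \<ge> 0" "\<And>f c z. f \<in> Hol \<Longrightarrow> c \<ge> 0 \<Longrightarrow> ?Q f \<le> ennreal c \<Longrightarrow> norm z \<le> \<rho> \<Longrightarrow> (cmod (f z))\<^sup>2 \<le> C * c"
      using point_evaluation_Besov[OF \<mu> \<rho>, of N, where 'd = 'd] by blast
    show ?thesis
    proof (rule exI[of _ "sqrt C"], intro conjI ballI impI allI)
      fix f :: "complex ^ 'd \<Rightarrow> complex" and z :: "complex ^ 'd" assume "f \<in> Hol" "?Q f \<le> 1" "norm z \<le> \<rho>"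
      then have "(cmod (f z))\<^sup>2 \<le> C" using C(2)[of f 1 z] by simp
      then show "cmod (f z) \<le> sqrt C" by (rule real_le_rsqrt)
    qed (use C in auto)
  qed
  have e_ge: "cmod (f z) \<le> e z" if "f \<in> Hol" "?Q f \<le> 1" "z \<in> uball" for f z
  proof -
    obtain C where "\<forall>f\<in>Hol. ?Q f \<le> 1 \<longrightarrow> (\<forall>w. norm w \<le> norm z \<longrightarrow> cmod (f w) \<le> C)"
      using local[of "norm z"] \<open>z \<in> uball\<close> by auto
    then have "bdd_above (E z)" by (intro bdd_aboveI[of _ C]) (auto simp: E_def)
    then show ?thesis unfolding e_def by (rule cSup_upper[rotated]) (use that in \<open>auto simp: E_def\<close>)
  qed
  have e_ge': "cmod (f z) \<le> sqrt c * e z" if f: "f \<in> Hol" "?Q f \<le> ennreal c" "c > 0" and z: "z \<in> uball" for f c z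
  proof -
    define k where "k = complex_of_real (1 / sqrt c)"
    have "?Q (\<lambda>z. k * f z) \<le> ennreal ((cmod k)\<^sup>2) * ?Q f" by (rule Besov_norm2_cmult[OF \<mu> f(1)])
    also have "\<dots> \<le> ennreal ((cmod k)\<^sup>2) * ennreal c" by (rule mult_left_mono[OF f(2)]) simp
    also have "\<dots> = 1" using f(3) by (simp add: k_def ennreal_mult'[symmetric] norm_divide power_divide)
    finally have "cmod (k * f z) \<le> e z" by (intro e_ge z) (use f in auto)
    then show ?thesis using f(3) by (simp add: k_def norm_mult norm_divide field_simps)
  qed
  have e_pos: "e z > 0" if z: "z \<in> uball" for z
  proof -
    have one: "(\<lambda>z. 1) \<in> Besov \<mu> N" by (rule Besov_const[OF \<mu> N])
    then have "?Q (\<lambda>z. 1) < \<infinity>" using \<mu> by (simp add: Besov_iff)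
    then obtain q where q: "q \<ge> 0" "?Q (\<lambda>z. 1) = ennreal q" by (cases "?Q (\<lambda>z. 1)") auto
    have "cmod 1 \<le> sqrt (q + 1) * e z"
      by (rule e_ge'[of "\<lambda>z. 1"]) (use q z in \<open>auto intro: ennreal_leI\<close>)
    then have "0 < sqrt (q + 1) * e z" by simp
    then show ?thesis using q by (simp add: zero_less_mult_iff)
  qed
  have "\<forall>n. \<exists>z\<in>uball. cmod (\<psi> z) > 8 ^ n" using unb by blast
  then obtain zs where zs: "\<And>n::nat. zs n \<in> uball" "\<And>n. cmod (\<psi> (zs n)) > 8 ^ n" by metis
  have "\<forall>n. \<exists>f. f \<in> Hol \<and> ?Q f \<le> 1 \<and> cmod (f (zs n)) > e (zs n) / 2"
  proof
    fix n
    have ne: "E (zs n) \<noteq> {}"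
    proof -
      have "?Q (\<lambda>z. 0) \<le> ennreal ((cmod 0)\<^sup>2) * ?Q (\<lambda>z. 0)" using Besov_norm2_cmult[OF \<mu>, of "\<lambda>z. 0" N 0] by simp
      then have "?Q (\<lambda>z. 0) \<le> 1" by simp
      then show ?thesis unfolding E_def using Hol_const[of 0] by blast
    qed
    have "e (zs n) / 2 < Sup (E (zs n))" using e_pos[OF zs(1)[of n]] by (simp add: e_def)
    then obtain y where "y \<in> E (zs n)" "e (zs n) / 2 < y" using less_cSupE[OF _ ne] by blast
    then show "\<exists>f. f \<in> Hol \<and> ?Q f \<le> 1 \<and> cmod (f (zs n)) > e (zs n) / 2" by (auto simp: E_def)
  qed
  then obtain f where f: "\<And>n. f n \<in> Hol" "\<And>n. ?Q (f n) \<le> 1" "\<And>n. cmod (f n (zs n)) > e (zs n) / 2" by metis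
  \<comment> \<open>the partial sums; the sign of the next term depends on the value of the previous sum at \<open>zs n\<close>\<close>
  define X where "X = rec_nat (\<lambda>z. 0) (\<lambda>n X z. X z + (if (1/4) ^ n * cmod (f n (zs n)) \<le> cmod (X (zs n) + (1/4) ^ n * f n (zs n)) then 1 else -1) * (1/4) ^ n * f n z)"
  define \<epsilon> where "\<epsilon> = (\<lambda>n. if (1/4) ^ n * cmod (f n (zs n)) \<le> cmod (X n (zs n) + (1/4) ^ n * f n (zs n)) then 1 else -1 :: complex)"
  define g where "g = (\<lambda>n z. \<epsilon> n * (1/4) ^ n * f n z)"
  have X_Suc: "X (Suc n) = (\<lambda>z. X n z + g n z)" for n by (simp add: X_def g_def \<epsilon>_def)
  have X_eq: "X n = (\<lambda>z. \<Sum>k<n. g k z)" for n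
  proof (induction n)
    case 0
    show ?case by (simp add: X_def)
  qed (simp add: X_Suc)
  have norm_\<epsilon>: "cmod (\<epsilon> n) = 1" for n by (simp add: \<epsilon>_def)
  have norm_g: "cmod (g n z) = (1/4) ^ n * cmod (f n z)" for n z
    by (simp add: g_def norm_mult norm_\<epsilon> norm_power norm_divide)
  \<comment> \<open>adding or subtracting \<open>b\<close> gives a number of absolute value at least \<open>\<bar>b\<bar>\<close>\<close>
  have X_large: "(1/4) ^ n * cmod (f n (zs n)) \<le> cmod (X (Suc n) (zs n))" for n
  proof (cases "\<epsilon> n = 1")
    case True
    then show ?thesis by (auto simp: X_Suc g_def \<epsilon>_def split: if_splits)
  next
    case False
    then have eps: "\<epsilon> n = -1" and less: "cmod (X n (zs n) + (1/4) ^ n * f n (zs n)) < (1/4) ^ n * cmod (f n (zs n))"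
      by (auto simp: \<epsilon>_def split: if_splits)
    let ?b = "(1/4) ^ n * f n (zs n)"
    have b: "cmod ?b = (1/4) ^ n * cmod (f n (zs n))" by (simp add: norm_mult norm_power norm_divide)
    have "2 * cmod ?b = cmod ((X n (zs n) + ?b) - (X n (zs n) - ?b))" by (simp add: norm_mult norm_power norm_divide)
    also have "\<dots> \<le> cmod (X n (zs n) + ?b) + cmod (X n (zs n) - ?b)" by (rule norm_triangle_ineq4)
    finally have "cmod ?b \<le> cmod (X n (zs n) - ?b)" using less b by linarith
    then show ?thesis using eps b by (simp add: X_Suc g_def)
  qed
  have gH: "g n \<in> Hol" for n unfolding g_def by (intro Hol_cmult f)
  have gM: "\<exists>M. \<forall>k z. norm z \<le> \<rho> \<longrightarrow> cmod (g k z) \<le> M * (1/4) ^ k" if \<rho>: "0 \<le> \<rho>" "\<rho> < 1" for \<rho>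
  proof -
    obtain C where C: "\<And>f z. f \<in> Hol \<Longrightarrow> ?Q f \<le> 1 \<Longrightarrow> norm z \<le> \<rho> \<Longrightarrow> cmod (f z) \<le> C" using local[OF \<rho>] by blast
    show ?thesis
    proof (rule exI[of _ C], intro allI impI)
      fix k and z :: "complex ^ 'd" assume "norm z \<le> \<rho>"
      then have "cmod (f k z) \<le> C" by (rule C[OF f(1,2)])
      then show "cmod (g k z) \<le> C * (1/4) ^ k" unfolding norm_g by (simp add: mult.commute mult_left_mono)
    qed
  qed
  define x where "x = (\<lambda>z. \<Sum>k. g k z)"
  have xH: "x \<in> Hol" unfolding x_def by (rule Hol_series(1)[OF gH _ _ gM]) auto
  have X_lim: "uniform_limit (cball 0 \<rho>) X x sequentially" if "0 \<le> \<rho>" "\<rho> < 1" for \<rho>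
    unfolding x_def X_eq[abs_def] by (rule Hol_series(2)[OF gH _ _ gM that]) auto
  have XH: "X n \<in> Hol" for n unfolding X_eq by (intro Hol_sum gH)
  have geo: "(\<Sum>k<n. (1/4) ^ k) \<le> (2::real)" for n
  proof -
    have "(\<Sum>k<n. (1/4) ^ k) \<le> (\<Sum>k. (1/4::real) ^ k)" by (rule sum_le_suminf) (auto intro: summable_geometric)
    also have "\<dots> \<le> 2" by (subst suminf_geometric) auto
    finally show ?thesis .
  qed
  \<comment> \<open>Cauchy--Schwarz with \<open>(1/4) ^ k = (1/2) ^ k * (1/2) ^ k\<close>\<close>
  have L2X: "L2_norm2 \<mu> ((radial_deriv ^^ N) (X n)) \<le> 4" for n
  proof -
    let ?G = "\<lambda>k z. (1/2) ^ k * (radial_deriv ^^ N) (f k) z"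
    have GH: "?G k \<in> Hol" for k by (intro Hol_cmult Hol_radial_deriv_pow f)
    have G1: "L2_norm2 \<mu> (?G k) \<le> ennreal ((1/4) ^ k)" for k
    proof -
      have "L2_norm2 \<mu> (?G k) \<le> ennreal ((cmod ((1/2) ^ k))\<^sup>2) * L2_norm2 \<mu> ((radial_deriv ^^ N) (f k))"
        by (rule L2_norm2_cmult[OF \<mu> Hol_radial_deriv_pow[OF f(1)]])
      also have "(cmod ((1/2) ^ k))\<^sup>2 = (1/4) ^ k"
        by (simp add: norm_power norm_divide power2_eq_square flip: power_mult_distrib)
      also have "L2_norm2 \<mu> ((radial_deriv ^^ N) (f k)) \<le> 1"
        using f(2)[of k] order_trans[OF add_increasing[OF zero_le order_refl]] unfolding Besov_norm2_def by blast
      finally show ?thesis by (simp add: mult_left_mono)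
    qed
    have "L2_norm2 \<mu> ((radial_deriv ^^ N) (X n)) \<le> 2 * (\<Sum>k<n. L2_norm2 \<mu> (?G k))"
    proof (rule L2_norm2_le_sum[OF \<mu>])
      fix t :: real
      have "sq_mean ((radial_deriv ^^ N) (X n)) t \<le> smean (\<lambda>z. 2 * (\<Sum>k<n. (cmod (?G k z))\<^sup>2)) t"
      proof (rule smean_mono)
        fix z :: "complex ^ 'd" assume z: "z \<in> uball"
        have "(radial_deriv ^^ N) (X n) z = (\<Sum>k<n. (radial_deriv ^^ N) (g k) z)"
          unfolding X_eq by (rule radial_deriv_pow_sum[OF _ gH z]) simp
        also have "cmod \<dots> \<le> (\<Sum>k<n. (1/2) ^ k * cmod (?G k z))"
        proof (rule sum_norm_le)
          fix k
          have "(radial_deriv ^^ N) (g k) z = \<epsilon> k * (1/4) ^ k * (radial_deriv ^^ N) (f k) z"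
            unfolding g_def by (rule radial_deriv_pow_cmult[OF f(1) z])
          then show "cmod ((radial_deriv ^^ N) (g k) z) \<le> (1/2) ^ k * cmod (?G k z)"
            by (simp add: norm_mult norm_\<epsilon> norm_power norm_divide mult.assoc[symmetric] flip: power_mult_distrib)
        qed
        finally have "(cmod ((radial_deriv ^^ N) (X n) z))\<^sup>2 \<le> (\<Sum>k<n. (1/2) ^ k * cmod (?G k z))\<^sup>2"
          by (rule power_mono) simp
        also have "\<dots> \<le> (\<Sum>k<n. ((1/2) ^ k)\<^sup>2) * (\<Sum>k<n. (cmod (?G k z))\<^sup>2)"
          by (rule Cauchy_Schwarz_ineq_sum)
        also have "(\<Sum>k<n. ((1/2) ^ k)\<^sup>2) = (\<Sum>k<n. (1/4::real) ^ k)"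
          by (simp add: power2_eq_square flip: power_mult_distrib)
        also have "\<dots> * (\<Sum>k<n. (cmod (?G k z))\<^sup>2) \<le> 2 * (\<Sum>k<n. (cmod (?G k z))\<^sup>2)"
          by (rule mult_right_mono[OF geo]) (auto intro: sum_nonneg)
        finally show "(cmod ((radial_deriv ^^ N) (X n) z))\<^sup>2 \<le> 2 * (\<Sum>k<n. (cmod (?G k z))\<^sup>2)" .
      qed
      also have "\<dots> = ennreal 2 * smean (\<lambda>z. \<Sum>k<n. (cmod (?G k z))\<^sup>2) t"
        by (rule smean_cmult) (auto intro!: continuous_on_sum continuous_on_cmod_square GH)
      also have "smean (\<lambda>z. \<Sum>k<n. (cmod (?G k z))\<^sup>2) t = (\<Sum>k<n. sq_mean (?G k) t)"
        by (rule smean_sum) (auto intro!: continuous_on_cmod_square GH)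
      finally show "sq_mean ((radial_deriv ^^ N) (X n)) t \<le> 2 * (\<Sum>k<n. sq_mean (?G k) t)"
        by simp
    qed (intro hol_on_imp_continuous_on GH Hol_radial_deriv_pow XH finite_lessThan)+
    also have "\<dots> \<le> 2 * (\<Sum>k<n. ennreal ((1/4) ^ k))" by (intro mult_left_mono sum_mono G1) auto
    also have "(\<Sum>k<n. ennreal ((1/4) ^ k)) = ennreal (\<Sum>k<n. (1/4) ^ k)" by (rule sum_ennreal) auto
    also have "2 * ennreal (\<Sum>k<n. (1/4) ^ k) \<le> 2 * ennreal 2" by (intro mult_left_mono ennreal_leI geo) auto
    finally show ?thesis by simp
  qed
  have "L2_norm2 \<mu> ((radial_deriv ^^ N) x) \<le> liminf (\<lambda>n. L2_norm2 \<mu> ((radial_deriv ^^ N) (X n)))"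
    by (rule L2_norm2_Fatou[OF \<mu>])
       (use radial_deriv_pow_limit[OF XH xH _ X_lim] in \<open>auto intro!: hol_on_imp_continuous_on Hol_radial_deriv_pow XH xH\<close>)
  also have "\<dots> \<le> limsup (\<lambda>n. L2_norm2 \<mu> ((radial_deriv ^^ N) (X n)))" by (rule Liminf_le_Limsup) simp
  also have "\<dots> \<le> 4" by (rule Limsup_bounded) (use L2X in auto)
  also have "\<dots> < \<infinity>" by simp
  finally have "x \<in> Besov \<mu> N" using xH by (simp add: Besov_def)
  then have "(\<lambda>z. \<psi> z * x z) \<in> Besov \<mu> N" using \<psi> by (simp add: Mult_def)
  then have \<psi>x: "(\<lambda>z. \<psi> z * x z) \<in> Hol" "?Q (\<lambda>z. \<psi> z * x z) < \<infinity>" using \<mu> by (auto simp: Besov_iff)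
  then obtain c where c: "c \<ge> 0" "?Q (\<lambda>z. \<psi> z * x z) = ennreal c" by (cases "?Q (\<lambda>z. \<psi> z * x z)") auto
  \<comment> \<open>\<open>8 ^ n * (1/4) ^ n * (1/2 - 1/3) = 2 ^ n / 6\<close>\<close>
  have key: "2 ^ n \<le> 6 * sqrt (c + 1)" for n
  proof -
    let ?e = "e (zs n)"
    have ep: "?e > 0" by (rule e_pos[OF zs(1)])
    have "cmod (g k (zs n)) \<le> ?e * (1/4) ^ k" for k
      unfolding norm_g using e_ge[OF f(1,2) zs(1), of k n] by (simp add: mult.commute mult_right_mono)
    from suminf_tail_bound(2)[OF _ _ this, of "Suc n"]
    have "cmod ((\<Sum>k. g k (zs n)) - (\<Sum>k<Suc n. g k (zs n))) \<le> ?e * (1/4) ^ Suc n / (1 - 1/4)" by simp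
    then have tail: "cmod (x (zs n) - X (Suc n) (zs n)) \<le> (1/4) ^ n * ?e / 3" by (simp add: x_def X_eq mult.commute)
    have "(1/4) ^ n * (?e / 2) \<le> (1/4) ^ n * cmod (f n (zs n))" using f(3)[of n] by (intro mult_left_mono) auto
    also have "\<dots> \<le> cmod (X (Suc n) (zs n))" by (rule X_large)
    finally have lower: "(1/4) ^ n * ?e / 6 \<le> cmod (x (zs n))"
      using tail norm_triangle_ineq2[of "X (Suc n) (zs n)" "x (zs n)"] by (simp add: norm_minus_commute)
    have "8 ^ n * ((1/4) ^ n * ?e / 6) \<le> cmod (\<psi> (zs n)) * cmod (x (zs n))"
      using zs(2)[of n] lower ep by (intro mult_mono) auto
    also have "\<dots> = cmod (\<psi> (zs n) * x (zs n))" by (simp add: norm_mult)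
    also have "\<dots> \<le> sqrt (c + 1) * ?e"
      by (rule e_ge'[OF \<psi>x(1) _ _ zs(1)]) (use c in \<open>auto intro: ennreal_leI\<close>)
    also have "8 ^ n * ((1/4) ^ n * ?e / 6) = 2 ^ n / 6 * ?e"
      by (simp add: mult.assoc[symmetric] flip: power_mult_distrib)
    finally have "2 ^ n / 6 \<le> sqrt (c + 1)" using ep by simp
    then show ?thesis by simp
  qed
  obtain n where "6 * sqrt (c + 1) < 2 ^ n" using real_arch_pow[of 2 "6 * sqrt (c + 1)"] by auto
  with key[of n] show False by simp
qed

section \<open>Small convex combinations\<close>

text \<open>The functions obtained from the tail \<open>e n\<close>, \<open>e (n + 1)\<close>, \<dots> by repeatedly taking midpoints. They
  replace the convex hull: the parallelogram law needs midpoints only, and properties of convex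
  combinations become inductions.\<close>

inductive_set midpoint_hull :: "(nat \<Rightarrow> 'a \<Rightarrow> complex) \<Rightarrow> nat \<Rightarrow> ('a \<Rightarrow> complex) set" for e n where
  base: "n \<le> k \<Longrightarrow> e k \<in> midpoint_hull e n"
| mid: "f \<in> midpoint_hull e n \<Longrightarrow> g \<in> midpoint_hull e n \<Longrightarrow> (\<lambda>z. (1/2) * (f z + g z)) \<in> midpoint_hull e n"

lemma midpoint_hull_mono: "m \<le> n \<Longrightarrow> midpoint_hull e n \<subseteq> midpoint_hull e m"
proof
  fix f assume "m \<le> n" "f \<in> midpoint_hull e n"
  from this(2,1) show "f \<in> midpoint_hull e m"
  proof induction
    case (base k)
    then show ?case by (intro midpoint_hull.base) simp
  next
    case (mid f g)
    then show ?case by (intro midpoint_hull.mid) simp_all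
  qed
qed

lemma midpoint_hull_Hol:
  assumes "\<And>k. e k \<in> Hol" "f \<in> midpoint_hull e n" shows "f \<in> Hol"
  using assms(2)
proof induction
  case (mid f g)
  then show ?case by (intro Hol_cmult Hol_add)
qed (rule assms(1))

lemma midpoint_hull_Besov_norm2:
  fixes e :: "nat \<Rightarrow> complex ^ 'd \<Rightarrow> complex"
  assumes \<mu>: "admissible \<mu>" and e: "\<And>k. e k \<in> Hol" "\<And>k. Besov_norm2 \<mu> N (e k) \<le> C" and f: "f \<in> midpoint_hull e n"
  shows "Besov_norm2 \<mu> N f \<le> C"
  using f
proof induction
  case (mid f g)
  have H: "f \<in> Hol" "g \<in> Hol" using mid midpoint_hull_Hol[OF e(1)] by auto
  let ?Q = "Besov_norm2 \<mu> N"
  have "?Q (\<lambda>z. (1/2) * (f z + g z)) \<le> ennreal ((cmod (1/2))\<^sup>2) * ?Q (\<lambda>z. f z + g z)"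
    by (rule Besov_norm2_cmult[OF \<mu> Hol_add[OF H]])
  also have "\<dots> \<le> ennreal (1/4) * (2 * ?Q f + 2 * ?Q g)"
  proof (rule mult_mono)
    show "?Q (\<lambda>z. f z + g z) \<le> 2 * ?Q f + 2 * ?Q g"
      by (rule order_trans[OF _ Besov_norm2_parallelogram[OF \<mu> H]]) simp
  qed (auto simp: power2_eq_square)
  also have "\<dots> \<le> ennreal (1/4) * (2 * C + 2 * C)" by (intro mult_left_mono add_mono mid) auto
  also have "\<dots> = (ennreal (1/4) * ennreal 4) * C" by (simp add: distrib_right[symmetric] mult.assoc)
  also have "ennreal (1/4) * ennreal 4 = 1" by (subst ennreal_mult'[symmetric]) auto
  finally show ?case by simp
qed (use e in auto)

lemma midpoint_hull_radial_deriv: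
  fixes e :: "nat \<Rightarrow> complex ^ 'd \<Rightarrow> complex"
  assumes e: "\<And>k. e k \<in> Hol" and z: "z \<in> uball" and b: "\<And>k. n \<le> k \<Longrightarrow> cmod ((radial_deriv ^^ N) (e k) z) \<le> \<eta>"
    and f: "f \<in> midpoint_hull e n"
  shows "cmod ((radial_deriv ^^ N) f z) \<le> \<eta>"
  using f
proof induction
  case (mid f g)
  have H: "f \<in> Hol" "g \<in> Hol" using mid midpoint_hull_Hol[OF e] by auto
  have "(radial_deriv ^^ N) (\<lambda>z. (1/2) * (f z + g z)) z = (1/2) * (radial_deriv ^^ N) (\<lambda>z. f z + g z) z"
    by (rule radial_deriv_pow_cmult[OF Hol_add[OF H] z])
  also have "(radial_deriv ^^ N) (\<lambda>z. f z + g z) z = (radial_deriv ^^ N) f z + (radial_deriv ^^ N) g z"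
    by (rule radial_deriv_pow_add[OF H z])
  finally have eq: "(radial_deriv ^^ N) (\<lambda>z. (1/2) * (f z + g z)) z = (1/2) * ((radial_deriv ^^ N) f z + (radial_deriv ^^ N) g z)" .
  show ?case unfolding eq using mid norm_triangle_ineq[of "(radial_deriv ^^ N) f z" "(radial_deriv ^^ N) g z"]
    by (simp add: norm_mult norm_divide)
qed (use b in auto)

lemma midpoint_hull_at_0:
  assumes "\<And>k. e k 0 = 0" "f \<in> midpoint_hull e n" shows "f 0 = 0"
  using assms(2) by induction (auto simp: assms(1))

text \<open>Mazur's lemma in a Hilbert space, without reference to weak topologies. Let \<open>d n\<close> be the infimum
  of the squared norms over the hull of the \<open>n\<close>-th tail; it increases to a limit \<open>D\<close>. If \<open>d n\<close> is
  close to \<open>D\<close>, near-minimisers \<open>y n\<close> and \<open>y m\<close>, \<open>m \<ge> n\<close>, are close to each other by the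
  parallelogram law, because their midpoint lies in the hull of the \<open>n\<close>-th tail. As \<open>m\<close> tends to
  infinity, the radial derivatives of \<open>y m\<close> tend to \<open>0\<close> pointwise, so by Fatou's lemma the bound
  for \<open>y n - y m\<close> is inherited by \<open>y n\<close>.\<close>

lemma midpoint_hull_small:
  fixes e :: "nat \<Rightarrow> complex ^ 'd \<Rightarrow> complex"
  assumes \<mu>: "admissible \<mu>" and e: "\<And>k. e k \<in> Hol" and bound: "\<And>k. Besov_norm2 \<mu> N (e k) \<le> ennreal C"
    and lim: "\<And>z. z \<in> uball \<Longrightarrow> (\<lambda>k. (radial_deriv ^^ N) (e k) z) \<longlonglongrightarrow> 0" and e0: "\<And>k. e k 0 = 0"
    and \<epsilon>: "\<epsilon> > 0"
  shows "\<exists>f\<in>midpoint_hull e 0. Besov_norm2 \<mu> N f < ennreal \<epsilon>"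
proof -
  let ?Q = "Besov_norm2 \<mu> N :: (complex ^ 'd \<Rightarrow> complex) \<Rightarrow> ennreal"
  define q where "q = (\<lambda>f. enn2real (?Q f))"
  define C' where "C' = max C 0"
  have C': "ennreal C \<le> ennreal C'" "C' \<ge> 0" by (auto simp: C'_def intro: ennreal_leI)
  have HH: "f \<in> Hol" if "f \<in> midpoint_hull e n" for f n using midpoint_hull_Hol[OF e that] .
  have QC: "?Q f \<le> ennreal C'" if "f \<in> midpoint_hull e n" for f n
    using midpoint_hull_Besov_norm2[OF \<mu> e bound that] C'(1) by (rule order_trans)
  have Qq: "?Q f = ennreal (q f)" if "f \<in> midpoint_hull e n" for f n
    unfolding q_def using QC[OF that] by (metis ennreal_enn2real ennreal_less_top order_le_less_trans)
  have q0: "q f \<ge> 0" for f by (simp add: q_def)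
  have qC: "q f \<le> C'" if "f \<in> midpoint_hull e n" for f n
    using QC[OF that] Qq[OF that] C'(2) by simp
  define d where "d = (\<lambda>n. Inf (q ` midpoint_hull e n))"
  have bdd: "bdd_below (q ` midpoint_hull e n)" for n using q0 by (intro bdd_belowI[of _ 0]) auto
  have ne: "q ` midpoint_hull e n \<noteq> {}" for n using midpoint_hull.base[of n n e] by auto
  have d_le: "d n \<le> q f" if "f \<in> midpoint_hull e n" for f n
    unfolding d_def by (rule cInf_lower[OF _ bdd]) (use that in auto)
  have d_mono: "d m \<le> d n" if "m \<le> n" for m n
    unfolding d_def by (rule cInf_superset_mono[OF ne bdd]) (use midpoint_hull_mono[OF that] in auto)
  have d_C: "d n \<le> C'" for n using d_le[OF midpoint_hull.base[of n n e]] qC[OF midpoint_hull.base[of n n e]] by simp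
  have "incseq d" using d_mono by (simp add: incseq_def)
  then obtain D where D: "d \<longlonglongrightarrow> D" "\<And>n. d n \<le> D"
    using incseq_convergent[of d C'] d_C by blast
  \<comment> \<open>the estimates below give the squared norm bound \<open>10 * \<eta>\<close>, which must be strictly less than \<open>\<epsilon>\<close>\<close>
  define \<eta> where "\<eta> = \<epsilon> / 20"
  have \<eta>: "\<eta> > 0" using \<epsilon> by (simp add: \<eta>_def)
  have "\<forall>\<^sub>F n in sequentially. D - \<eta> < d n"
    by (rule order_tendstoD(1)[OF D(1)]) (use \<eta> in simp)
  then obtain n where "D - \<eta> < d n" by (auto simp: eventually_sequentially)
  then have n: "D - d n < \<eta>" by simp
  have "\<exists>f\<in>midpoint_hull e m. q f < d m + \<eta>" for m
  proof -
    have "Inf (q ` midpoint_hull e m) < d m + \<eta>" using \<eta> by (simp add: d_def)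
    then show ?thesis using cInf_lessD[OF ne] by blast
  qed
  then obtain y where y: "\<And>m. y m \<in> midpoint_hull e m" "\<And>m. q (y m) < d m + \<eta>" by metis
  have yH: "y m \<in> Hol" for m by (rule HH[OF y(1)])
  have diff: "?Q (\<lambda>z. y n z - y m z) \<le> ennreal (10 * \<eta>)" if "n \<le> m" for m
  proof -
    have ym: "y m \<in> midpoint_hull e n" using y(1) midpoint_hull_mono[OF that] by blast
    have hm: "(\<lambda>z. (1/2) * (y n z + y m z)) \<in> midpoint_hull e n" by (rule midpoint_hull.mid[OF y(1) ym])
    have par: "?Q (\<lambda>z. y n z + y m z) + ?Q (\<lambda>z. y n z - y m z) \<le> 2 * ?Q (y n) + 2 * ?Q (y m)"
      by (rule Besov_norm2_parallelogram[OF \<mu> yH yH])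
    also have "\<dots> = ennreal (2 * q (y n) + 2 * q (y m))"
      using q0 Qq[OF y(1)] by (simp add: ennreal_mult')
    finally have par': "?Q (\<lambda>z. y n z + y m z) + ?Q (\<lambda>z. y n z - y m z) \<le> ennreal (2 * q (y n) + 2 * q (y m))" .
    obtain s where s: "s \<ge> 0" "?Q (\<lambda>z. y n z + y m z) = ennreal s"
      using par' by (cases "?Q (\<lambda>z. y n z + y m z)") (auto simp: top_unique)
    obtain t where t: "t \<ge> 0" "?Q (\<lambda>z. y n z - y m z) = ennreal t"
      using par' by (cases "?Q (\<lambda>z. y n z - y m z)") (auto simp: top_unique)
    have st: "s + t \<le> 2 * q (y n) + 2 * q (y m)"
      using par' s t q0[of "y n"] q0[of "y m"] by (simp add: ennreal_plus[symmetric] del: ennreal_plus)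
    have "ennreal (q (\<lambda>z. (1/2) * (y n z + y m z))) \<le> ennreal ((cmod (1/2))\<^sup>2) * ?Q (\<lambda>z. y n z + y m z)"
      unfolding Qq[OF hm, symmetric] by (rule Besov_norm2_cmult[OF \<mu> Hol_add[OF yH yH]])
    also have "\<dots> = ennreal (s / 4)" using s by (simp add: ennreal_mult'[symmetric] power2_eq_square norm_divide)
    finally have "q (\<lambda>z. (1/2) * (y n z + y m z)) \<le> s / 4" using s by simp
    then have "4 * d n \<le> s" using d_le[OF hm] by simp
    then have "t \<le> 2 * q (y n) + 2 * q (y m) - 4 * d n" using st by simp
    also have "\<dots> \<le> 2 * (d n + \<eta>) + 2 * (d m + \<eta>) - 4 * d n"
      using y(2)[of n] y(2)[of m] by simp
    also have "\<dots> = 2 * (d m - d n) + 4 * \<eta>" by simp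
    also have "\<dots> \<le> 2 * (D - d n) + 4 * \<eta>" using D(2)[of m] by simp
    also have "\<dots> \<le> 10 * \<eta>" using n \<eta> by simp
    finally show ?thesis unfolding t by (rule ennreal_leI)
  qed
  have R_lim: "(\<lambda>m. (radial_deriv ^^ N) (y m) z) \<longlonglongrightarrow> 0" if z: "z \<in> uball" for z
  proof (rule LIMSEQ_I)
    fix r :: real assume r: "r > 0"
    have "\<forall>\<^sub>F k in sequentially. cmod ((radial_deriv ^^ N) (e k) z) < r / 2"
      using tendstoD[OF lim[OF z], of "r / 2"] r by (simp add: dist_norm)
    then obtain k0 where k0: "\<And>k. k0 \<le> k \<Longrightarrow> cmod ((radial_deriv ^^ N) (e k) z) \<le> r / 2"
      unfolding eventually_sequentially by (meson less_imp_le)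
    have le: "cmod ((radial_deriv ^^ N) (y m) z) \<le> r / 2" if "k0 \<le> m" for m
      by (rule midpoint_hull_radial_deriv[OF e z _ y(1)]) (use k0 that in auto)
    then show "\<exists>no. \<forall>m\<ge>no. norm ((radial_deriv ^^ N) (y m) z - 0) < r"
    proof (intro exI[of _ k0] allI impI)
      fix m assume "k0 \<le> m"
      from le[OF this] r show "norm ((radial_deriv ^^ N) (y m) z - 0) < r" by simp
    qed
  qed
  have y0: "y m 0 = 0" for m by (rule midpoint_hull_at_0[OF e0 y(1)])
  have "L2_norm2 \<mu> ((radial_deriv ^^ N) (y n)) \<le> liminf (\<lambda>m. L2_norm2 \<mu> ((radial_deriv ^^ N) (\<lambda>z. y n z - y (m + n) z)))"
  proof (rule L2_norm2_Fatou[OF \<mu>])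
    fix z :: "complex ^ 'd" assume z: "z \<in> uball"
    have "(\<lambda>m. (radial_deriv ^^ N) (y n) z - (radial_deriv ^^ N) (y (m + n)) z) \<longlonglongrightarrow> (radial_deriv ^^ N) (y n) z - 0"
      by (intro tendsto_intros LIMSEQ_ignore_initial_segment R_lim[OF z])
    then show "(\<lambda>m. (radial_deriv ^^ N) (\<lambda>z. y n z - y (m + n) z) z) \<longlonglongrightarrow> (radial_deriv ^^ N) (y n) z"
      using radial_deriv_pow_diff[OF yH yH z] by simp
  qed (intro hol_on_imp_continuous_on Hol_radial_deriv_pow Hol_diff yH)+
  also have "\<dots> \<le> limsup (\<lambda>m. L2_norm2 \<mu> ((radial_deriv ^^ N) (\<lambda>z. y n z - y (m + n) z)))"
    by (rule Liminf_le_Limsup) simp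
  also have "\<dots> \<le> ennreal (10 * \<eta>)"
  proof (rule Limsup_bounded, rule always_eventually, rule allI)
    fix m
    have "L2_norm2 \<mu> ((radial_deriv ^^ N) (\<lambda>z. y n z - y (m + n) z)) \<le> ?Q (\<lambda>z. y n z - y (m + n) z)"
      unfolding Besov_norm2_def by (rule add_increasing) auto
    also have "\<dots> \<le> ennreal (10 * \<eta>)" by (rule diff) simp
    finally show "L2_norm2 \<mu> ((radial_deriv ^^ N) (\<lambda>z. y n z - y (m + n) z)) \<le> ennreal (10 * \<eta>)" .
  qed
  finally have "L2_norm2 \<mu> ((radial_deriv ^^ N) (y n)) \<le> ennreal (10 * \<eta>)" .
  then have "?Q (y n) \<le> ennreal (10 * \<eta>)" by (simp add: Besov_norm2_def y0)
  also have "\<dots> < ennreal \<epsilon>" using \<epsilon> by (intro ennreal_lessI) (auto simp: \<eta>_def)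
  finally show ?thesis using y(1)[of n] midpoint_hull_mono[of 0 n e] by blast
qed

section \<open>Approximation of powers of the numerator\<close>

lemma dilation_uniform_limit:
  fixes f :: "complex ^ 'd \<Rightarrow> complex"
  assumes f: "f \<in> Hol" and \<rho>: "0 \<le> \<rho>" "\<rho> < 1" and a: "\<And>n. a n \<ge> 0" "a \<longlonglongrightarrow> 0"
  shows "uniform_limit (cball 0 \<rho>) (\<lambda>n z. f (exp (- a n) *\<^sub>R z)) f sequentially"
  unfolding uniform_limit_iff
proof (intro allI impI)
  fix e :: real assume e: "e > 0"
  have "uniformly_continuous_on (cball 0 \<rho>) f"
    by (intro compact_uniformly_continuous continuous_on_subset[OF hol_on_imp_continuous_on[OF f]]) (use \<rho> in auto)
  then obtain \<delta> where \<delta>: "\<delta> > 0" "\<And>x y. x \<in> cball 0 \<rho> \<Longrightarrow> y \<in> cball 0 \<rho> \<Longrightarrow> dist x y < \<delta> \<Longrightarrow> dist (f x) (f y) < e"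
    using e by (metis uniformly_continuous_onE)
  have "(\<lambda>n. exp (- a n)) \<longlonglongrightarrow> exp (- 0)" by (intro tendsto_intros a)
  then have "\<forall>\<^sub>F n in sequentially. dist (exp (- a n)) 1 < \<delta>"
    using \<delta>(1) by (auto dest: tendstoD)
  then show "\<forall>\<^sub>F n in sequentially. \<forall>x\<in>cball 0 \<rho>. dist (f (exp (- a n) *\<^sub>R x)) (f x) < e"
  proof eventually_elim
    case (elim n)
    show ?case
    proof
      fix x :: "complex ^ 'd" assume x: "x \<in> cball 0 \<rho>"
      have r: "0 \<le> exp (- a n)" "exp (- a n) \<le> 1" using a(1)[of n] by auto
      have "norm (exp (- a n) *\<^sub>R x) \<le> 1 * norm x" using mult_right_mono[OF r(2) norm_ge_zero[of x]] by simp
      then have 1: "exp (- a n) *\<^sub>R x \<in> cball 0 \<rho>" using x by simp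
      have "dist (exp (- a n) *\<^sub>R x) x = \<bar>exp (- a n) - 1\<bar> * norm x"
        by (simp add: dist_norm flip: norm_scaleR scaleR_left_diff_distrib[of _ 1, simplified])
      also have "\<dots> \<le> \<bar>exp (- a n) - 1\<bar> * 1" using x \<rho> by (intro mult_left_mono) auto
      also have "\<dots> < \<delta>" using elim by (simp add: dist_real_def)
      finally show "dist (f (exp (- a n) *\<^sub>R x)) (f x) < e" by (rule \<delta>(2)[OF 1 x])
    qed
  qed
qed

text \<open>The exponent \<open>N + k - 1\<close> of the theorem comes from here: for \<open>m = N + k - 1\<close>, every term either
  contains \<open>x ^ k\<close> or at least \<open>N\<close> factors \<open>y\<close>.\<close>

lemma binomial_split:
  fixes x y :: complex
  assumes "k \<le> m + 1"
  shows "(x + y) ^ m = x ^ k * (\<Sum>i = k..m. of_nat (m choose i) * (x ^ (i - k) * y ^ (m - i)))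
    + (\<Sum>i<k. of_nat (m choose i) * (x ^ i * y ^ (m - i)))"
proof -
  have "(x + y) ^ m = (\<Sum>i\<le>m. of_nat (m choose i) * x ^ i * y ^ (m - i))" by (rule binomial_ring)
  also have "{..m} = {k..m} \<union> {..<k}" using assms by auto
  also have "(\<Sum>i\<in>{k..m} \<union> {..<k}. of_nat (m choose i) * x ^ i * y ^ (m - i))
    = (\<Sum>i = k..m. of_nat (m choose i) * x ^ i * y ^ (m - i)) + (\<Sum>i<k. of_nat (m choose i) * x ^ i * y ^ (m - i))"
    by (rule sum.union_disjoint) auto
  also have "(\<Sum>i = k..m. of_nat (m choose i) * x ^ i * y ^ (m - i)) = x ^ k * (\<Sum>i = k..m. of_nat (m choose i) * (x ^ (i - k) * y ^ (m - i)))"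
    unfolding sum_distrib_left by (rule sum.cong) (auto simp: mult_ac simp flip: power_add)
  finally show ?thesis by (simp add: mult.assoc)
qed

theorem theorem3p1:
  fixes \<mu> :: "real measure" and N :: nat and \<phi> \<psi> :: "complex ^ 'd \<Rightarrow> complex"
  assumes "N \<ge> 1" and "admissible \<mu>"
    and "\<phi> \<in> Mult (Besov \<mu> N)" and "\<psi> \<in> Mult (Besov \<mu> N)"
    and "quotient_in_Hinf \<phi> \<psi>"
  shows "\<forall>k\<ge>1. (\<lambda>z. \<phi> z ^ (N + k - 1)) \<in> cyclic \<mu> N (\<lambda>z. \<psi> z ^ k) \<and>
    cyclic \<mu> N (\<lambda>z. \<psi> z ^ k) \<subseteq> cyclic \<mu> N \<psi>"
proof (intro allI impI conjI)
  note N = assms(1) and \<mu> = assms(2)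
  let ?Q = "Besov_norm2 \<mu> N :: (complex ^ 'd \<Rightarrow> complex) \<Rightarrow> ennreal"
  fix k :: nat assume k: "k \<ge> 1"
  define m where "m = N + k - 1"
  have m: "m \<ge> k" "m \<ge> 1" using N k by (auto simp: m_def)
  have mi: "N \<le> m - i" if "i < k" for i using that k by (simp add: m_def)
  obtain h where h: "h \<in> Hol" "bounded (h ` uball)" "\<And>z. z \<in> uball \<Longrightarrow> \<phi> z = h z * \<psi> z"
    using assms(5) by (auto simp: quotient_in_Hinf_def Hinf_def)
  obtain L where "\<forall>x\<in>h ` uball. cmod x \<le> L"
    using h(2) unfolding bounded_iff by blast
  then have L: "\<And>z. z \<in> uball \<Longrightarrow> cmod (h z) \<le> L" by blast
  obtain B where B: "\<And>z. z \<in> uball \<Longrightarrow> cmod (\<psi> z) \<le> B"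
    using Mult_bounded[OF \<mu> N assms(4)] by blast
  have \<psi>B: "\<psi> \<in> Besov \<mu> N" and \<psi>H: "\<psi> \<in> Hol"
    using Mult_in_Besov[OF \<mu> N assms(4)] by (auto simp: Besov_def)
  \<comment> \<open>\<open>\<phi> ^ m = H * \<psi> ^ m\<close> with \<open>H\<close> bounded and holomorphic\<close>
  define H where "H = (\<lambda>z. h z ^ m)"
  have HH: "H \<in> Hol" unfolding H_def by (intro Hol_power h)
  have HL: "cmod (H z) \<le> L ^ m" if "z \<in> uball" for z
    unfolding H_def norm_power by (intro power_mono L that) auto
  define F where "F = (\<lambda>z. \<phi> z ^ m)"
  have FB: "F \<in> Besov \<mu> N" and FH: "F \<in> Hol"
    using Mult_in_Besov[OF \<mu> N Mult_power[OF \<mu> assms(3), of m]] by (auto simp: Besov_def F_def)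
  have F_eq: "F z = H z * \<psi> z ^ m" if "z \<in> uball" for z
    using h(3)[OF that] by (simp add: F_def H_def power_mult_distrib)
  \<comment> \<open>any sequence of dilations tending to the identity; the exponential form matches the estimates\<close>
  define r where "r = (\<lambda>n. exp (- (1 / real (Suc n))))"
  have r: "0 \<le> r n" "r n < 1" "r n \<le> 1" for n by (auto simp: r_def)
  define u where "u = (\<lambda>n z. \<psi> (r n *\<^sub>R z) - \<psi> z)"
  \<comment> \<open>The part of the expansion of \<open>H (r n *\<^sub>R z) * (\<psi> z + u n z) ^ m\<close> that is divisible by
    \<open>\<psi> z ^ k\<close>, after division. It is built from dilations and \<open>\<psi>\<close>, hence a multiplier.\<close>
  define p where "p = (\<lambda>n z. H (r n *\<^sub>R z) * (\<Sum>i = k..m. of_nat (m choose i) * (\<psi> z ^ (i - k) * u n z ^ (m - i))))"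
  define e where "e = (\<lambda>n z. F z - p n z * \<psi> z ^ k)"
  \<comment> \<open>the remaining terms, each with at least \<open>N\<close> factors \<open>u n z\<close>\<close>
  define T where "T = (\<lambda>i n z. H (r n *\<^sub>R z) * (\<psi> z ^ i * u n z ^ (m - i)))"
  have dil: "(\<lambda>z. f (r n *\<^sub>R z)) \<in> Hol" if "f \<in> Hol" for f :: "complex ^ 'd \<Rightarrow> complex" and n
    using r by (intro Hol_scaleR that) auto
  have uM: "u n \<in> Mult (Besov \<mu> N)" for n
    unfolding u_def by (intro Mult_diff \<mu> Mult_dilation \<psi>H r assms)
  have pM: "p n \<in> Mult (Besov \<mu> N)" for n
    unfolding p_def
    by (intro Mult_mult Mult_sum \<mu> Mult_dilation HH r Mult_const Mult_power uM assms finite_atLeastAtMost)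
  have uH: "u n \<in> Hol" for n unfolding u_def by (intro Hol_diff dil \<psi>H)
  have TH: "T i n \<in> Hol" for i n unfolding T_def by (intro Hol_mult Hol_power dil HH \<psi>H uH)
  have eH: "e n \<in> Hol" for n
    unfolding e_def p_def by (intro Hol_diff Hol_mult Hol_sum Hol_const Hol_power dil HH \<psi>H uH FH)
  have e_eq: "e n z = (F z - F (r n *\<^sub>R z)) + (\<Sum>i<k. of_nat (m choose i) * T i n z)" if z: "z \<in> uball" for n z
  proof -
    have rz: "r n *\<^sub>R z \<in> uball" by (rule scaleR_in_ball[OF r(1,3) z])
    have "F (r n *\<^sub>R z) = H (r n *\<^sub>R z) * (\<psi> z + u n z) ^ m"
      by (simp add: F_eq[OF rz] u_def)
    also have "\<dots> = p n z * \<psi> z ^ k + (\<Sum>i<k. of_nat (m choose i) * T i n z)"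
      using m by (simp add: binomial_split[of k m] p_def T_def distrib_left sum_distrib_left mult_ac)
    finally show ?thesis by (simp add: e_def)
  qed
  let ?R = "radial_deriv ^^ N"
  have Re: "?R (e n) z = (?R F z - ?R F (r n *\<^sub>R z)) + (\<Sum>i<k. of_nat (m choose i) * ?R (T i n) z)" if z: "z \<in> uball" for n z
  proof -
    have "?R (e n) z = ?R (\<lambda>z. (F z - F (r n *\<^sub>R z)) + (\<Sum>i<k. of_nat (m choose i) * T i n z)) z"
      by (rule radial_deriv_pow_cong[OF eH e_eq z])
    also have "\<dots> = ?R (\<lambda>z. F z - F (r n *\<^sub>R z)) z + ?R (\<lambda>z. \<Sum>i<k. of_nat (m choose i) * T i n z) z"
      by (intro radial_deriv_pow_add z Hol_diff Hol_sum Hol_cmult TH FH dil)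
    also have "?R (\<lambda>z. F z - F (r n *\<^sub>R z)) z = ?R F z - ?R (\<lambda>z. F (r n *\<^sub>R z)) z"
      by (intro radial_deriv_pow_diff z FH dil)
    also have "?R (\<lambda>z. F (r n *\<^sub>R z)) z = ?R F (r n *\<^sub>R z)"
      by (intro radial_deriv_pow_scaleR FH r z)
    also have "?R (\<lambda>z. \<Sum>i<k. of_nat (m choose i) * T i n z) z = (\<Sum>i<k. ?R (\<lambda>z. of_nat (m choose i) * T i n z) z)"
      by (intro radial_deriv_pow_sum z Hol_cmult TH finite_lessThan)
    also have "\<dots> = (\<Sum>i<k. of_nat (m choose i) * ?R (T i n) z)"
      by (intro sum.cong refl radial_deriv_pow_cmult z TH)
    finally show ?thesis .
  qed
  have "\<exists>C\<ge>0. \<forall>n. L2_norm2 \<mu> (?R (T i n)) \<le> ennreal C" if i: "i < k" for i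
  proof -
    obtain C where C: "C \<ge> 0" "\<And>a. a > 0 \<Longrightarrow> L2_norm2 \<mu> (?R (dilation_product H \<psi> a i (m - i)))
      \<le> ennreal C * L2_norm2 \<mu> (?R \<psi>)"
      using L2_norm2_jet_product_bound[OF \<mu> N mi[OF i] \<psi>H B HH HL, of i] by blast
    obtain c where c: "c \<ge> 0" "L2_norm2 \<mu> (?R \<psi>) = ennreal c"
      using \<psi>B by (cases "L2_norm2 \<mu> (?R \<psi>)") (auto simp: Besov_def)
    have "L2_norm2 \<mu> (?R (T i n)) \<le> ennreal (C * c)" for n
      using C(2)[of "1 / real (Suc n)"] C(1) unfolding T_def u_def r_def c(2) by (simp add: ennreal_mult')
    then show ?thesis using C c by (intro exI[of _ "C * c"]) auto
  qed
  then obtain C where C: "\<And>i n. i < k \<Longrightarrow> C i \<ge> 0" "\<And>i n. i < k \<Longrightarrow> L2_norm2 \<mu> (?R (T i n)) \<le> ennreal (C i)" by metis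
  obtain c where c: "c \<ge> 0" "L2_norm2 \<mu> (?R F) = ennreal c"
    using FB by (cases "L2_norm2 \<mu> (?R F)") (auto simp: Besov_def)
  \<comment> \<open>dilation does not increase the norm\<close>
  have RFr: "L2_norm2 \<mu> (\<lambda>z. ?R F (r n *\<^sub>R z)) \<le> ennreal c" for n
  proof -
    have "L2_norm2 \<mu> (\<lambda>z. ?R F (r n *\<^sub>R z)) \<le> 1 * L2_norm2 \<mu> (?R F)"
    proof (rule L2_norm2_le[OF \<mu>])
      fix t :: real assume t: "0 \<le> t" "t < 1"
      have "sq_mean (\<lambda>z. ?R F (r n *\<^sub>R z)) t = sq_mean (?R F) (r n * t)"
        using t r smean_scaleR[of t "r n" "\<lambda>z. (cmod (?R F z))\<^sup>2"] by simp
      also have "\<dots> \<le> sq_mean (?R F) t"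
        by (rule smean_square_mono) (use t r in \<open>auto intro!: Hol_radial_deriv_pow FH mult_left_le_one_le\<close>)
      finally show "sq_mean (\<lambda>z. ?R F (r n *\<^sub>R z)) t \<le> 1 * sq_mean (?R F) t" by simp
    qed (intro hol_on_imp_continuous_on dil Hol_radial_deriv_pow FH)+
    then show ?thesis using c by simp
  qed
  define K where "K = real (k + 2) * (c + c + (\<Sum>i<k. (real (m choose i))\<^sup>2 * C i))"
  have e0: "e n 0 = 0" for n
  proof -
    have "T i n 0 = 0" if "i < k" for i
    proof -
      have "m - i \<noteq> 0" using mi[OF that] N by simp
      then show ?thesis by (simp add: T_def u_def)
    qed
    then show ?thesis using e_eq[of 0 n] by simp
  qed
  \<comment> \<open>the errors are bounded in norm, since each of the \<open>k + 2\<close> summands in \<open>Re\<close> is\<close>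
  have bound: "?Q (e n) \<le> ennreal K" for n
  proof -
    \<comment> \<open>those summands, indexed by \<open>{..<k + 2}\<close>\<close>
    define G where "G = (\<lambda>i z. if i < k then of_nat (m choose i) * ?R (T i n) z else if i = k then ?R F z else - 1 * ?R F (r n *\<^sub>R z))"
    have GH: "G i \<in> Hol" for i
    proof -
      have "(\<lambda>z. of_nat (m choose i) * ?R (T i n) z) \<in> Hol" "?R F \<in> Hol" "(\<lambda>z. - 1 * ?R F (r n *\<^sub>R z)) \<in> Hol"
        by (intro Hol_cmult Hol_radial_deriv_pow TH FH dil)+
      then show ?thesis unfolding G_def by (cases "i < k"; cases "i = k") simp_all
    qed
    have "L2_norm2 \<mu> (?R (e n)) = L2_norm2 \<mu> (\<lambda>z. \<Sum>i<k + 2. G i z)"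
      by (rule L2_norm2_cong[OF \<mu> Hol_radial_deriv_pow[OF eH]]) (simp add: Re G_def)
    also have "\<dots> \<le> ennreal (card {..<k + 2}) * (\<Sum>i<k + 2. L2_norm2 \<mu> (G i))"
      by (rule L2_norm2_sum_le[OF \<mu> _ GH]) simp
    also have "(\<Sum>i<k + 2. L2_norm2 \<mu> (G i)) \<le> (\<Sum>i<k. ennreal ((real (m choose i))\<^sup>2 * C i)) + ennreal c + ennreal c"
    proof -
      have 1: "L2_norm2 \<mu> (G i) \<le> ennreal ((real (m choose i))\<^sup>2 * C i)" if "i < k" for i
      proof -
        have "L2_norm2 \<mu> (G i) = L2_norm2 \<mu> (\<lambda>z. of_nat (m choose i) * ?R (T i n) z)" using that by (simp add: G_def)
        also have "\<dots> \<le> ennreal ((cmod (of_nat (m choose i)))\<^sup>2) * L2_norm2 \<mu> (?R (T i n))"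
          by (rule L2_norm2_cmult[OF \<mu> Hol_radial_deriv_pow[OF TH]])
        also have "\<dots> \<le> ennreal ((cmod (of_nat (m choose i)))\<^sup>2) * ennreal (C i)"
          by (rule mult_left_mono[OF C(2)[OF that]]) simp
        finally show ?thesis by (simp add: ennreal_mult')
      qed
      have 2: "L2_norm2 \<mu> (G k) \<le> ennreal c" using c by (simp add: G_def)
      have 3: "L2_norm2 \<mu> (G (Suc k)) \<le> ennreal c"
      proof -
        have "L2_norm2 \<mu> (G (Suc k)) = L2_norm2 \<mu> (\<lambda>z. - 1 * ?R F (r n *\<^sub>R z))" by (simp add: G_def)
        also have "\<dots> \<le> ennreal ((cmod (- 1))\<^sup>2) * L2_norm2 \<mu> (\<lambda>z. ?R F (r n *\<^sub>R z))"
          by (rule L2_norm2_cmult[OF \<mu> dil[OF Hol_radial_deriv_pow[OF FH]]])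
        also have "\<dots> \<le> ennreal c" using RFr by simp
        finally show ?thesis .
      qed
      have "(\<Sum>i<k + 2. L2_norm2 \<mu> (G i)) = (\<Sum>i<k. L2_norm2 \<mu> (G i)) + L2_norm2 \<mu> (G k) + L2_norm2 \<mu> (G (Suc k))"
        by (simp add: numeral_2_eq_2)
      also have "\<dots> \<le> (\<Sum>i<k. ennreal ((real (m choose i))\<^sup>2 * C i)) + ennreal c + ennreal c"
        by (intro add_mono sum_mono 1 2 3) auto
      finally show ?thesis .
    qed
    also have "(\<Sum>i<k. ennreal ((real (m choose i))\<^sup>2 * C i)) = ennreal (\<Sum>i<k. (real (m choose i))\<^sup>2 * C i)"
      by (rule sum_ennreal) (use C in auto)
    also have "ennreal (card {..<k + 2}) * (ennreal (\<Sum>i<k. (real (m choose i))\<^sup>2 * C i) + ennreal c + ennreal c) = ennreal K"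
    proof -
      have "(\<Sum>i<k. (real (m choose i))\<^sup>2 * C i) \<ge> 0" using C by (intro sum_nonneg) auto
      then show ?thesis using c by (simp add: K_def ennreal_mult' ennreal_plus[symmetric] add_ac del: ennreal_plus)
    qed
    finally have "L2_norm2 \<mu> (?R (e n)) \<le> ennreal K" by (simp add: mult_left_mono)
    then show ?thesis by (simp add: Besov_norm2_def e0)
  qed
  \<comment> \<open>the errors tend to \<open>0\<close> locally uniformly, hence so do their radial derivatives\<close>
  have lim: "(\<lambda>n. ?R (e n) z) \<longlonglongrightarrow> 0" if z: "z \<in> uball" for z
  proof -
    have "(\<lambda>n. ?R (e n) z) \<longlonglongrightarrow> ?R (\<lambda>z. 0) z"
    proof (rule radial_deriv_pow_limit[OF eH Hol_const z])
      fix \<rho> :: real assume \<rho>: "0 \<le> \<rho>" "\<rho> < 1"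
      have a: "(\<lambda>n. 1 / real (Suc n)) \<longlonglongrightarrow> 0" using LIMSEQ_inverse_real_of_nat by (simp add: inverse_eq_divide)
      define M where "M = (\<Sum>i<k. real (m choose i) * (L ^ m * (B ^ i * (2 * B) ^ (m - i - 1))))"
      have L0: "L \<ge> 0" and B0: "B \<ge> 0" using order_trans[OF norm_ge_zero L[of 0]] order_trans[OF norm_ge_zero B[of 0]] by auto
      have M0: "M \<ge> 0" unfolding M_def using L0 B0 by (intro sum_nonneg) auto
      have T_le: "cmod (T i n x) \<le> L ^ m * (B ^ i * (2 * B) ^ (m - i - 1)) * cmod (u n x)" if i: "i < k" and x: "x \<in> uball" for i n x
      proof -
        have rx: "r n *\<^sub>R x \<in> uball" by (rule scaleR_in_ball[OF r(1,3) x])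
        have u2: "cmod (u n x) \<le> 2 * B"
          unfolding u_def using norm_triangle_ineq4[of "\<psi> (r n *\<^sub>R x)" "\<psi> x"] B[OF x] B[OF rx] by simp
        have "m - i = Suc (m - i - 1)" using mi[OF i] N by simp
        then have "cmod (u n x) ^ (m - i) = cmod (u n x) ^ (m - i - 1) * cmod (u n x)" by (metis power_Suc mult.commute)
        also have "\<dots> \<le> (2 * B) ^ (m - i - 1) * cmod (u n x)"
          by (intro mult_right_mono power_mono u2) auto
        finally have "cmod (T i n x) \<le> L ^ m * (B ^ i * ((2 * B) ^ (m - i - 1) * cmod (u n x)))"
          unfolding T_def norm_mult norm_power using HL[OF rx] B[OF x] L0 B0
          by (intro mult_mono power_mono) auto
        then show ?thesis by (simp add: mult_ac)
      qed
      show "uniform_limit (cball 0 \<rho>) e (\<lambda>z. 0) sequentially"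
        unfolding uniform_limit_iff
      proof (intro allI impI)
        fix \<eta> :: real assume \<eta>: "\<eta> > 0"
        have "\<forall>\<^sub>F n in sequentially. \<forall>x\<in>cball 0 \<rho>. dist (F (exp (- (1 / real (Suc n))) *\<^sub>R x)) (F x) < \<eta> / 2"
          by (rule uniform_limitD[OF dilation_uniform_limit[OF FH \<rho> _ a]]) (use \<eta> in auto)
        moreover have "\<forall>\<^sub>F n in sequentially. \<forall>x\<in>cball 0 \<rho>. dist (\<psi> (exp (- (1 / real (Suc n))) *\<^sub>R x)) (\<psi> x) < \<eta> / (2 * (M + 1))"
          by (rule uniform_limitD[OF dilation_uniform_limit[OF \<psi>H \<rho> _ a]]) (use \<eta> M0 in auto)
        ultimately show "\<forall>\<^sub>F n in sequentially. \<forall>x\<in>cball 0 \<rho>. dist (e n x) 0 < \<eta>"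
        proof eventually_elim
          case (elim n)
          show ?case
          proof
            fix x :: "complex ^ 'd" assume x: "x \<in> cball 0 \<rho>"
            then have xu: "x \<in> uball" using \<rho> by simp
            have F2: "cmod (F x - F (r n *\<^sub>R x)) < \<eta> / 2"
              using elim(1) x by (auto simp: r_def dist_norm norm_minus_commute)
            have u2: "cmod (u n x) < \<eta> / (2 * (M + 1))"
              using elim(2) x by (auto simp: r_def u_def dist_norm)
            have "cmod (\<Sum>i<k. of_nat (m choose i) * T i n x) \<le> (\<Sum>i<k. real (m choose i) * (L ^ m * (B ^ i * (2 * B) ^ (m - i - 1)) * cmod (u n x)))"
              by (rule sum_norm_le) (use T_le xu in \<open>auto simp: norm_mult intro!: mult_left_mono\<close>)
            also have "\<dots> = M * cmod (u n x)" unfolding M_def sum_distrib_right by (simp only: mult.assoc)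
            also have "\<dots> \<le> M * (\<eta> / (2 * (M + 1)))" using u2 M0 by (intro mult_left_mono) auto
            also have "\<dots> \<le> \<eta> / 2" using \<eta> M0 by (simp add: field_simps)
            finally have "cmod (e n x) < \<eta>"
              unfolding e_eq[OF xu]
              using norm_triangle_ineq[of "F x - F (r n *\<^sub>R x)" "\<Sum>i<k. of_nat (m choose i) * T i n x"] F2 by linarith
            then show "dist (e n x) 0 < \<eta>" by simp
          qed
        qed
      qed
    qed
    then show ?thesis using radial_deriv_pow_const[OF z, of N 0] N by simp
  qed
  \<comment> \<open>midpoints of errors are errors of approximation by multiples of \<open>\<psi> ^ k\<close>\<close>
  have hull: "\<exists>q\<in>Mult (Besov \<mu> N). f = (\<lambda>z. F z - q z * \<psi> z ^ k)" if "f \<in> midpoint_hull e 0" for f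
    using that
  proof induction
    case (base n)
    show ?case by (rule bexI[OF _ pM[of n]]) (simp add: e_def)
  next
    case (mid f g)
    then obtain q1 q2 where q: "q1 \<in> Mult (Besov \<mu> N)" "f = (\<lambda>z. F z - q1 z * \<psi> z ^ k)"
      "q2 \<in> Mult (Besov \<mu> N)" "g = (\<lambda>z. F z - q2 z * \<psi> z ^ k)" by blast
    have "(\<lambda>z. (1/2) * (q1 z + q2 z)) \<in> Mult (Besov \<mu> N)"
      by (intro Mult_mult Mult_const Mult_add \<mu> q)
    then show ?case by (rule bexI[rotated]) (simp add: q fun_eq_iff field_simps)
  qed
  show "(\<lambda>z. \<phi> z ^ (N + k - 1)) \<in> cyclic \<mu> N (\<lambda>z. \<psi> z ^ k)"
    unfolding cyclic_def m_def[symmetric] F_def[symmetric]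
  proof (intro CollectI conjI allI impI FB)
    fix \<epsilon> :: real assume "\<epsilon> > 0"
    then have "\<epsilon>\<^sup>2 > 0" by simp
    from midpoint_hull_small[OF \<mu> eH bound lim e0 this]
    obtain f where "f \<in> midpoint_hull e 0" "?Q f < ennreal (\<epsilon>\<^sup>2)" by blast
    with hull show "\<exists>q\<in>Mult (Besov \<mu> N). ?Q (\<lambda>z. F z - q z * \<psi> z ^ k) < ennreal (\<epsilon>\<^sup>2)" by blast
  qed
  show "cyclic \<mu> N (\<lambda>z. \<psi> z ^ k) \<subseteq> cyclic \<mu> N \<psi>"
  proof
    fix g assume g: "g \<in> cyclic \<mu> N (\<lambda>z. \<psi> z ^ k)"
    show "g \<in> cyclic \<mu> N \<psi>"
      unfolding cyclic_def
    proof (intro CollectI conjI allI impI)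
      show "g \<in> Besov \<mu> N" using g by (simp add: cyclic_def)
      fix \<epsilon> :: real assume "\<epsilon> > 0"
      then obtain q where q: "q \<in> Mult (Besov \<mu> N)" "?Q (\<lambda>z. g z - q z * \<psi> z ^ k) < ennreal (\<epsilon>\<^sup>2)"
        using g by (auto simp: cyclic_def)
      have "q z * \<psi> z ^ k = (q z * \<psi> z ^ (k - 1)) * \<psi> z" for z
        using k by (cases k) (auto simp: mult_ac)
      with q(2) have "?Q (\<lambda>z. g z - (q z * \<psi> z ^ (k - 1)) * \<psi> z) < ennreal (\<epsilon>\<^sup>2)" by simp
      then show "\<exists>q\<in>Mult (Besov \<mu> N). ?Q (\<lambda>z. g z - q z * \<psi> z) < ennreal (\<epsilon>\<^sup>2)"
        by (rule bexI[of _ "\<lambda>z. q z * \<psi> z ^ (k - 1)"]) (intro Mult_mult q Mult_power \<mu> assms)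
    qed
  qed
qed

end
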